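(* For each integer $n>3$ let $u_n\in W^{1,2}_0((-2,2))$ be the weak solution of $$-u_n''(t)=\frac{\chi_{(-1,1)}}{u_n^n}\ \text{ in }(-2,2),\qquad u_n(\pm2)=0,$$ and let $v_n=\frac{u_n^{n+1}}{n+1}$, a weak solution of $$-v_n''+\frac{n}{n+1}\frac{|v_n'|^2}{v_n}=\chi_{(-1,1)}\ \text{ in }(-2,2),\qquad v_n(\pm2)=0.$$ Then $\{v_n\}$ converges weakly in $W^{1,2}_0((-2,2))$ to a function $v$, and $v$, belonging to $C^\infty_0((-1,1))$, is a classical solution of $$-v''+\frac{|v'|^2}{v}=1\ \text{ in }(-1,1),\qquad v(\pm1)=0.$$ Moreover $v(t)=\frac{2}{\pi^2}\cos^2\left(\frac{\pi}{2}t\right)$ in $(-1,1)$ and $v(t)\equiv0$ in $[-2,-1]\cup[1,2]$.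
   Context: $\chi_{(-1,1)}$ is the characteristic function of $(-1,1)$. $C^\infty_0((-1,1))$ denotes the $C^\infty$ functions on $(-1,1)$ that vanish at the boundary points $\pm1$ (not the compactly supported ones). The weak solution $u_n\in W^{1,2}_0((-2,2))$ is the unique function that is bounded below by a positive constant on every compact subset of $(-2,2)$ and satisfies $\int_{-2}^2u_n'\varphi'=\int_{-1}^{1}\frac{\varphi}{u_n^n}$ for all $\varphi\in W^{1,2}_0((-2,2))$. A weak solution of $-v''+B\frac{|v'|^2}{v}=f$ in $(-2,2)$, $v(\pm2)=0$ (with $B>0$) is a function $v\in W^{1,2}_0((-2,2))$ such that $v>0$ a.e., $\frac{|v'|^2}{v}\in L^1((-2,2))$, and $\int_{-2}^2v'\varphi'+B\int_{-2}^2\frac{|v'|^2}{v}\varphi=\int_{-2}^2f\varphi$ for all $\varphi\in W^{1,2}_0((-2,2))\cap L^\infty((-2,2))$. *)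

theory Defs
  imports "HOL-Analysis.Analysis"
begin

definition smooth_on :: "real set \<Rightarrow> (real \<Rightarrow> real) \<Rightarrow> bool" where
  "smooth_on S f \<longleftrightarrow> (\<forall>k. \<forall>x\<in>S. (deriv ^^ k) f differentiable (at x))"

definition test_function :: "real set \<Rightarrow> (real \<Rightarrow> real) \<Rightarrow> bool" where
  "test_function S \<phi> \<longleftrightarrow>
     smooth_on UNIV \<phi> \<and> (\<exists>K. compact K \<and> K \<subseteq> S \<and> (\<forall>x. x \<notin> K \<longrightarrow> \<phi> x = 0))"

text \<open>
  Elements of the Lebesgue and Sobolev spaces over an open set \<open>S\<close> are represented by total
  functions; values outside \<open>S\<close>, or on a null set, are irrelevant.
\<close>

definition L2 :: "real set \<Rightarrow> (real \<Rightarrow> real) set" where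
  "L2 S = {f \<in> borel_measurable (lebesgue_on S). integrable (lebesgue_on S) (\<lambda>x. (f x)\<^sup>2)}"

definition Linfty :: "real set \<Rightarrow> (real \<Rightarrow> real) set" where
  "Linfty S = {f \<in> borel_measurable (lebesgue_on S). \<exists>C. AE x in lebesgue_on S. \<bar>f x\<bar> \<le> C}"

definition locally_integrable_on :: "real set \<Rightarrow> (real \<Rightarrow> real) \<Rightarrow> bool" where
  "locally_integrable_on S f \<longleftrightarrow> (\<forall>K. compact K \<and> K \<subseteq> S \<longrightarrow> integrable (lebesgue_on K) f)"

definition has_weak_deriv :: "real set \<Rightarrow> (real \<Rightarrow> real) \<Rightarrow> (real \<Rightarrow> real) \<Rightarrow> bool" where
  "has_weak_deriv S u g \<longleftrightarrow>
     locally_integrable_on S u \<and> locally_integrable_on S g \<and>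
     (\<forall>\<phi>. test_function S \<phi> \<longrightarrow>
        (LINT x|lebesgue_on S. u x * deriv \<phi> x) = - (LINT x|lebesgue_on S. g x * \<phi> x))"

text \<open>The weak derivative is determined only up to null sets; a representative is chosen.\<close>

definition weak_deriv :: "real set \<Rightarrow> (real \<Rightarrow> real) \<Rightarrow> real \<Rightarrow> real" where
  "weak_deriv S u = (SOME g. has_weak_deriv S u g)"

definition W12 :: "real set \<Rightarrow> (real \<Rightarrow> real) set" where
  "W12 S = {u \<in> L2 S. \<exists>g\<in>L2 S. has_weak_deriv S u g}"

definition W12_norm :: "real set \<Rightarrow> (real \<Rightarrow> real) \<Rightarrow> real" where
  "W12_norm S u =
     sqrt ((LINT x|lebesgue_on S. (u x)\<^sup>2) + (LINT x|lebesgue_on S. (weak_deriv S u x)\<^sup>2))"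

text \<open>\<open>W\<^sub>0\<^sup>1\<^sup>,\<^sup>2(S)\<close>: the closure of the test functions in \<open>W\<^sup>1\<^sup>,\<^sup>2(S)\<close>.\<close>

definition W012 :: "real set \<Rightarrow> (real \<Rightarrow> real) set" where
  "W012 S = {u \<in> W12 S. \<exists>\<phi> :: nat \<Rightarrow> real \<Rightarrow> real.
     (\<forall>k. test_function S (\<phi> k)) \<and> (\<lambda>k. W12_norm S (\<lambda>x. u x - \<phi> k x)) \<longlonglongrightarrow> 0}"

text \<open>
  The dual space. A functional bounded by the norm respects almost everywhere equality, so these
  are exactly the continuous linear functionals on the space of equivalence classes.
\<close>

definition W012_dual :: "real set \<Rightarrow> ((real \<Rightarrow> real) \<Rightarrow> real) set" where
  "W012_dual S = {F.
     (\<forall>u\<in>W012 S. \<forall>w\<in>W012 S. F (\<lambda>x. u x + w x) = F u + F w) \<and>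
     (\<forall>c. \<forall>u\<in>W012 S. F (\<lambda>x. c * u x) = c * F u) \<and>
     (\<exists>C. \<forall>u\<in>W012 S. \<bar>F u\<bar> \<le> C * W12_norm S u)}"

definition weakly_converges_W012 ::
    "real set \<Rightarrow> (nat \<Rightarrow> real \<Rightarrow> real) \<Rightarrow> (real \<Rightarrow> real) \<Rightarrow> bool" where
  "weakly_converges_W012 S f v \<longleftrightarrow>
     (\<forall>k. f k \<in> W012 S) \<and> v \<in> W012 S \<and> (\<forall>F\<in>W012_dual S. (\<lambda>k. F (f k)) \<longlonglongrightarrow> F v)"

text \<open>
  The weak solution of \<open>-u'' = \<chi>\<^bsub>(-1,1)\<^esub> / u\<^sup>n\<close> in \<open>(-2,2)\<close>, \<open>u(\<plusminus>2) = 0\<close>; the boundary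
  condition is membership in \<open>W012\<close>.
\<close>

definition singular_weak_solution :: "nat \<Rightarrow> (real \<Rightarrow> real) \<Rightarrow> bool" where
  "singular_weak_solution n u \<longleftrightarrow>
     u \<in> W012 {-2<..<2} \<and>
     (\<forall>K. compact K \<and> K \<subseteq> {-2<..<2} \<longrightarrow> (\<exists>c>0. AE x in lebesgue_on K. c \<le> u x)) \<and>
     (\<forall>\<phi>\<in>W012 {-2<..<2}.
        (LINT x|lebesgue_on {-2<..<2}. weak_deriv {-2<..<2} u x * weak_deriv {-2<..<2} \<phi> x) =
        (LINT x|lebesgue_on {-1<..<1}. \<phi> x / u x ^ n))"

text \<open>Weak solutions of \<open>-v'' + B |v'|\<^sup>2 / v = f\<close> in \<open>(-2,2)\<close>, \<open>v(\<plusminus>2) = 0\<close>.\<close>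

definition quadratic_weak_solution :: "real \<Rightarrow> (real \<Rightarrow> real) \<Rightarrow> (real \<Rightarrow> real) \<Rightarrow> bool" where
  "quadratic_weak_solution B f v \<longleftrightarrow>
     v \<in> W012 {-2<..<2} \<and>
     (AE x in lebesgue_on {-2<..<2}. 0 < v x) \<and>
     integrable (lebesgue_on {-2<..<2}) (\<lambda>x. (weak_deriv {-2<..<2} v x)\<^sup>2 / v x) \<and>
     (\<forall>\<phi>\<in>W012 {-2<..<2} \<inter> Linfty {-2<..<2}.
        (LINT x|lebesgue_on {-2<..<2}. weak_deriv {-2<..<2} v x * weak_deriv {-2<..<2} \<phi> x) +
        B * (LINT x|lebesgue_on {-2<..<2}. (weak_deriv {-2<..<2} v x)\<^sup>2 / v x * \<phi> x) =
        (LINT x|lebesgue_on {-2<..<2}. f x * \<phi> x))"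

text \<open>
  Smooth functions on the open interval that vanish at its end points, continuously up to the
  boundary; no compact support is required.
\<close>

definition C0_infinity :: "real \<Rightarrow> real \<Rightarrow> (real \<Rightarrow> real) set" where
  "C0_infinity a b = {v. smooth_on {a<..<b} v \<and> continuous_on {a..b} v \<and> v a = 0 \<and> v b = 0}"

text \<open>
  Classical solutions of \<open>-v'' + |v'|\<^sup>2 / v = 1\<close> in \<open>(-1,1)\<close>, \<open>v(\<plusminus>1) = 0\<close>. Positivity is
  required so that the quotient is a genuine one.
\<close>

definition quadratic_classical_solution :: "(real \<Rightarrow> real) \<Rightarrow> bool" where
  "quadratic_classical_solution v \<longleftrightarrow>
     v differentiable_on {-1<..<1} \<and> deriv v differentiable_on {-1<..<1} \<and>
     continuous_on {-1<..<1} (deriv (deriv v)) \<and> continuous_on {-1..1} v \<and>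
     (\<forall>t\<in>{-1<..<1}. 0 < v t \<and> - deriv (deriv v) t + (deriv v t)\<^sup>2 / v t = 1) \<and>
     v (-1) = 0 \<and> v 1 = 0"

end

theory Submission
  imports Defs
begin

text \<open>
  The theorem becomes transparent in polar form. On \<open>(-1, 1)\<close> the solution satisfies \<open>- u'' = u^(-n)\<close>,
  and outside it is affine. The first integral \<open>u^(1-n) - (n-1)/2 * u'^2 = level\<close> has the same positive
  value everywhere on \<open>[-1, 1]\<close>. Comparing it at \<open>-1\<close> and \<open>1\<close> shows that \<open>u\<close> takes equal values there.
  Let \<open>\<kappa>^2 = (n-1)/2 * level\<close>, put \<open>s = u / \<kappa>\<close>, and let \<open>\<theta>\<close> be the angle with
  \<open>tan \<theta> = - (\<kappa> / level) * u'\<close>. Then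
  \<open>\<theta>' = 1 / s\<close>, \<open>s' = - 2 / (n-1) * tan \<theta>\<close>, and \<open>v = u^(n+1) / (n+1)\<close> has derivative
  \<open>- s * sin \<theta> * cos \<theta>\<close>.

  Concavity of \<open>u\<close> confines \<open>s\<close> on \<open>[-1, 1]\<close> between its boundary value and three times that value. As \<open>\<theta>\<close>
  increases by less than \<open>pi\<close>, and by an amount that is bounded below through the boundary condition,
  the boundary value is bounded from both sides independently of \<open>n\<close> (\<open>s_bounds\<close>). Consequently \<open>\<theta>\<close> stays
  away from \<open>\<plusminus>pi/2\<close> on compact subsets of \<open>(-1, 1)\<close>, so \<open>s\<close> becomes constant there as \<open>n\<close> grows
  (\<open>s_variation\<close>), while the boundary angles tend to \<open>\<plusminus>pi/2\<close>. Hence \<open>\<theta>\<close> tends to the linear function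
  \<open>pi * t / 2\<close> and \<open>s\<close> to \<open>2 / pi\<close>, so that \<open>v'\<close> tends to \<open>- sin (pi * t) / pi\<close>, the derivative of
  \<open>2 / pi^2 * cos^2 (pi * t / 2)\<close> (\<open>flux_tendsto\<close>). On the affine pieces \<open>v'\<close> is bounded by a constant
  times \<open>(2 - \<bar>t\<bar>)^n\<close> and tends to zero. As \<open>v'\<close> is uniformly bounded, dominated convergence gives
  convergence in the Sobolev norm, which is stronger than the weak convergence claimed.

  The differential equation for \<open>v\<close> is a direct computation, written weakly by means of integration by
  parts against functions in \<open>W012\<close> (\<open>quadratic_V\<close>).

  The weak formulation is linked to this calculus by three facts about \<open>W012\<close> on an interval: its
  members are primitives of their weak derivatives (\<open>W012_AE_primitive\<close>), they can be integrated by
  parts against piecewise differentiable functions (\<open>W012_integral_by_parts\<close>), and a continuous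
  function that vanishes at the end points is a member as soon as its derivative, off finitely many
  points, agrees with a continuous function on the closed interval
  (\<open>W012_if_continuous_deriv\<close>). They imply that the weak solution \<open>u\<close> is a classical one
  (\<open>singular_weak_solution_regularity\<close>).
\<close>

section \<open>Smooth functions and bumps\<close>

text \<open>
  Smoothness is defined through all iterated derivatives. The usual way to control them at once is
  to exhibit a family of functions that differentiation does not leave: every iterate then agrees
  on the open set with a member of the family.
\<close>

lemma smooth_on_closed_family:
  assumes S: "open S" and f: "f \<in> F"
    and step: "\<And>h. h \<in> F \<Longrightarrow> \<exists>h'\<in>F. \<forall>x\<in>S. (h has_real_derivative h' x) (at x)"
  shows "smooth_on S f"
proof -
  have iter: "\<exists>h\<in>F. \<forall>x\<in>S. (deriv ^^ k) f x = h x" for k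
  proof (induction k)
    case 0
    show ?case using f by auto
  next
    case (Suc k)
    then obtain h where h: "h \<in> F" "\<forall>x\<in>S. (deriv ^^ k) f x = h x" by blast
    obtain h' where h': "h' \<in> F" "\<forall>x\<in>S. (h has_real_derivative h' x) (at x)"
      using step[OF h(1)] by blast
    have "(deriv ^^ Suc k) f x = h' x" if x: "x \<in> S" for x
    proof -
      have "((deriv ^^ k) f has_real_derivative h' x) (at x)"
        by (rule has_field_derivative_transform_within_open[of h _ _ S]) (use h h' S x in auto)
      then show ?thesis by (simp add: DERIV_imp_deriv)
    qed
    then show ?case using h'(1) by auto
  qed
  show ?thesis
    unfolding smooth_on_def
  proof (intro allI ballI)
    fix k x assume x: "x \<in> S"
    obtain h where h: "h \<in> F" "\<forall>x\<in>S. (deriv ^^ k) f x = h x" using iter by blast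
    obtain h' where h': "h' \<in> F" "\<forall>x\<in>S. (h has_real_derivative h' x) (at x)"
      using step[OF h(1)] by blast
    have "((deriv ^^ k) f has_real_derivative h' x) (at x)"
      by (rule has_field_derivative_transform_within_open[of h _ _ S]) (use h h' S x in auto)
    then show "(deriv ^^ k) f differentiable at x"
      using real_differentiable_def by blast
  qed
qed

lemma smooth_on_has_deriv:
  assumes "smooth_on S f" "x \<in> S"
  shows "(f has_real_derivative deriv f x) (at x)"
  using assms unfolding smooth_on_def
  by (metis DERIV_deriv_iff_real_differentiable funpow_0)

lemma smooth_on_deriv: "smooth_on S f \<Longrightarrow> smooth_on S (deriv f)"
  unfolding smooth_on_def by (metis funpow_Suc_right o_apply)

lemma smooth_on_polynomial:
  assumes "open S" "real_polynomial_function f"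
  shows "smooth_on S f"
  by (rule smooth_on_closed_family[OF assms(1), of f "Collect real_polynomial_function"])
    (use assms(2) has_real_derivative_polynomial_function in fastforce)+

text \<open>
  The Leibniz rule turns a product into a sum of products, so it is the sums of products of smooth
  functions, rather than the products alone, that are closed under differentiation.
\<close>

inductive product_sum :: "real set \<Rightarrow> (real \<Rightarrow> real) \<Rightarrow> bool" for S where
  product: "smooth_on S f \<Longrightarrow> smooth_on S g \<Longrightarrow> product_sum S (\<lambda>x. f x * g x)"
| sum: "product_sum S p \<Longrightarrow> product_sum S q \<Longrightarrow> product_sum S (\<lambda>x. p x + q x)"

lemma product_sum_has_deriv:
  "product_sum S p \<Longrightarrow> \<exists>p'. product_sum S p' \<and> (\<forall>x\<in>S. (p has_real_derivative p' x) (at x))"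
proof (induction rule: product_sum.induct)
  case (product f g)
  have "product_sum S (\<lambda>x. f x * deriv g x + deriv f x * g x)"
    by (intro product_sum.intros smooth_on_deriv product)
  moreover have "((\<lambda>x. f x * g x) has_real_derivative f x * deriv g x + deriv f x * g x) (at x)"
    if "x \<in> S" for x
    by (rule DERIV_mult') (use product that smooth_on_has_deriv in auto)
  ultimately show ?case by blast
next
  case (sum p q)
  then obtain p' q' where "product_sum S p'" "product_sum S q'"
    "\<forall>x\<in>S. (p has_real_derivative p' x) (at x)" "\<forall>x\<in>S. (q has_real_derivative q' x) (at x)"
    by blast
  then show ?case
    by (intro exI[of _ "\<lambda>x. p' x + q' x"]) (auto intro: product_sum.sum DERIV_add)
qed

lemma smooth_on_product_sum: "open S \<Longrightarrow> product_sum S p \<Longrightarrow> smooth_on S p"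
  by (rule smooth_on_closed_family[where F="Collect (product_sum S)"])
    (use product_sum_has_deriv in auto)

lemma smooth_on_mult:
  "open S \<Longrightarrow> smooth_on S f \<Longrightarrow> smooth_on S g \<Longrightarrow> smooth_on S (\<lambda>x. f x * g x)"
  by (rule smooth_on_product_sum[OF _ product_sum.product])

lemma smooth_on_const: "open S \<Longrightarrow> smooth_on S (\<lambda>x. c)"
  by (intro smooth_on_polynomial) (auto intro: real_polynomial_function.intros)

lemma smooth_on_add:
  assumes "open S" "smooth_on S f" "smooth_on S g"
  shows "smooth_on S (\<lambda>x. f x + g x)"
proof -
  have "product_sum S (\<lambda>x. f x * 1 + g x * 1)"
    by (intro product_sum.intros smooth_on_const assms)
  then show ?thesis
    using smooth_on_product_sum[OF assms(1)] by simp
qed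

lemma smooth_on_affine_compose:
  assumes "smooth_on UNIV f"
  shows "smooth_on UNIV (\<lambda>x. f (m * x + c))"
proof (rule smooth_on_closed_family[of UNIV _ "{\<lambda>x. C * h (m * x + c) | C h. smooth_on UNIV h}"])
  show "(\<lambda>x. f (m * x + c)) \<in> {\<lambda>x. C * h (m * x + c) | C h. smooth_on UNIV h}"
    using assms by (auto intro!: exI[of _ 1] exI[of _ f])
next
  fix p assume "p \<in> {\<lambda>x. C * h (m * x + c) | C h. smooth_on UNIV h}"
  then obtain C h where p: "p = (\<lambda>x. C * h (m * x + c))" and h: "smooth_on UNIV h" by blast
  have "(p has_real_derivative (C * m) * deriv h (m * x + c)) (at x)" for x
  proof -
    have "((\<lambda>x. h (m * x + c)) has_real_derivative deriv h (m * x + c) * m) (at x)"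
      by (rule DERIV_chain2[OF smooth_on_has_deriv[OF h]]) (auto intro!: derivative_eq_intros)
    from DERIV_cmult[OF this, of C] show ?thesis by (simp add: p mult_ac)
  qed
  moreover have "(\<lambda>x. (C * m) * deriv h (m * x + c)) \<in> {\<lambda>x. C * h (m * x + c) | C h. smooth_on UNIV h}"
    using smooth_on_deriv[OF h] by blast
  ultimately show "\<exists>h'\<in>{\<lambda>x. C * h (m * x + c) | C h. smooth_on UNIV h}.
      \<forall>x\<in>UNIV. (p has_real_derivative h' x) (at x)"
    by (intro bexI) auto
qed simp

text \<open>
  The classical flat function \<open>exp (-1/x)\<close> is \<open>flat_exp 1\<close>. The polynomial factor in \<open>1/x\<close> makes
  the family closed under differentiation.
\<close>

definition flat_exp :: "real poly \<Rightarrow> real \<Rightarrow> real" where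
  "flat_exp P x = (if x \<le> 0 then 0 else poly P (inverse x) * exp (- inverse x))"

lemma poly_exp_tendsto_0: "((\<lambda>y. poly P y * exp (- y)) \<longlongrightarrow> (0::real)) at_top"
proof -
  have "((\<lambda>y. \<Sum>i\<le>degree P. coeff P i * (y ^ i / exp y)) \<longlongrightarrow> (\<Sum>i\<le>degree P. coeff P i * 0)) at_top"
    by (intro tendsto_intros tendsto_power_div_exp_0)
  then show ?thesis
    by (simp add: poly_altdef sum_distrib_right exp_minus divide_inverse mult.assoc)
qed

text \<open>
  Away from the origin this is the chain rule. At the origin the difference quotient from the right
  is \<open>y P(y) exp (-y)\<close> with \<open>y = 1/h\<close>, and the exponential beats every polynomial.
\<close>

lemma flat_exp_deriv:
  "(flat_exp P has_real_derivative flat_exp (monom 1 2 * (P - pderiv P)) x) (at x)"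
proof -
  consider "x < 0" | "x = 0" | "x > 0" by linarith
  then show ?thesis
  proof cases
    case 1
    have "(flat_exp P has_real_derivative 0) (at x)"
      by (rule has_field_derivative_transform_within_open[of "\<lambda>x. 0" _ _ "{..<0}"])
        (use 1 in \<open>auto simp: flat_exp_def\<close>)
    then show ?thesis using 1 by (simp add: flat_exp_def)
  next
    case 2
    have "((\<lambda>h. flat_exp P h / h) \<longlongrightarrow> 0) (at_right 0)"
    proof -
      have "((\<lambda>y. poly (pCons 0 P) y * exp (- y)) \<longlongrightarrow> (0::real)) at_top"
        by (rule poly_exp_tendsto_0)
      then have "((\<lambda>h. poly (pCons 0 P) (inverse h) * exp (- inverse h)) \<longlongrightarrow> (0::real)) (at_right 0)"
        by (rule filterlim_compose[OF _ filterlim_inverse_at_top_right])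
      then show ?thesis
        by (rule Lim_transform_eventually)
          (auto simp: eventually_at_right_less flat_exp_def field_simps
            intro!: eventually_mono[OF eventually_at_right_less[of 0]])
    qed
    moreover have "((\<lambda>h. flat_exp P h / h) \<longlongrightarrow> 0) (at_left 0)"
      by (rule Lim_transform_eventually[OF tendsto_const])
        (auto simp: flat_exp_def eventually_at_left_field intro!: exI[of _ "-1"])
    ultimately have "((\<lambda>h. flat_exp P h / h) \<longlongrightarrow> 0) (at 0)"
      by (simp add: filterlim_at_split)
    then show ?thesis
      using 2 by (simp add: DERIV_def flat_exp_def)
  next
    case 3
    have "((\<lambda>x. poly P (inverse x) * exp (- inverse x)) has_real_derivative
      poly (monom 1 2 * (P - pderiv P)) (inverse x) * exp (- inverse x)) (at x)"
      using 3 by (auto intro!: derivative_eq_intros DERIV_chain2[OF poly_DERIV]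
        simp: poly_monom algebra_simps power2_eq_square)
    then have "(flat_exp P has_real_derivative
      poly (monom 1 2 * (P - pderiv P)) (inverse x) * exp (- inverse x)) (at x)"
      by (rule has_field_derivative_transform_within_open[of _ _ _ "{0<..}"])
        (use 3 in \<open>auto simp: flat_exp_def\<close>)
    then show ?thesis using 3 by (simp add: flat_exp_def)
  qed
qed

lemma smooth_on_flat_exp: "smooth_on UNIV (flat_exp P)"
  by (rule smooth_on_closed_family[where F="range flat_exp"]) (use flat_exp_deriv in blast)+

text \<open>
  A smooth function supported in \<open>[p, q]\<close>. Since \<open>exp (-1/y)\<close> tends to 1 as \<open>y\<close> tends to infinity, dilating by
  \<open>k + 1\<close> drives the bump to the indicator of \<open>(p, q)\<close> from below, without any normalisation.
\<close>

definition bump :: "real \<Rightarrow> real \<Rightarrow> nat \<Rightarrow> real \<Rightarrow> real" where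
  "bump p q k x = flat_exp 1 (real (Suc k) * (x - p)) * flat_exp 1 (real (Suc k) * (q - x))"

lemma smooth_on_bump: "smooth_on UNIV (bump p q k)"
proof -
  have "smooth_on UNIV (\<lambda>x. flat_exp 1 (real (Suc k) * x + - (real (Suc k) * p)) *
      flat_exp 1 (- real (Suc k) * x + real (Suc k) * q))"
    by (intro smooth_on_mult smooth_on_affine_compose smooth_on_flat_exp open_UNIV)
  then show ?thesis
    by (simp add: bump_def[abs_def] algebra_simps)
qed

lemma flat_exp_1_bounds: "0 \<le> flat_exp 1 x" "flat_exp 1 x \<le> 1"
  by (auto simp: flat_exp_def)

lemma bump_bounds: "0 \<le> bump p q k x" "bump p q k x \<le> 1"
  by (auto simp: bump_def flat_exp_1_bounds intro!: mult_nonneg_nonneg mult_le_one)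

lemma bump_outside: "x \<notin> {p<..<q} \<Longrightarrow> bump p q k x = 0"
proof -
  assume "x \<notin> {p<..<q}"
  then have "real (Suc k) * (x - p) \<le> 0 \<or> real (Suc k) * (q - x) \<le> 0"
    by (auto simp: mult_le_0_iff)
  then show ?thesis by (auto simp: bump_def flat_exp_def)
qed

lemma bump_pos: "x \<in> {p<..<q} \<Longrightarrow> 0 < bump p q k x"
proof -
  assume "x \<in> {p<..<q}"
  then have "real (Suc k) * (x - p) > 0 \<and> real (Suc k) * (q - x) > 0"
    by (auto)
  then show ?thesis by (auto simp: bump_def flat_exp_def)
qed

lemma flat_exp_1_tendsto: "(flat_exp 1 \<longlongrightarrow> 1) at_top"
proof -
  have "((\<lambda>x::real. exp (- inverse x)) \<longlongrightarrow> exp (- 0)) at_top"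
    by (intro tendsto_intros tendsto_inverse_0_at_top filterlim_ident)
  then have "((\<lambda>x::real. exp (- inverse x)) \<longlongrightarrow> 1) at_top" by simp
  then show ?thesis
    by (rule Lim_transform_eventually)
      (auto intro!: eventually_mono[OF eventually_gt_at_top[of 0]] simp: flat_exp_def)
qed

lemma bump_tendsto:
  assumes "x \<in> {p<..<q}"
  shows "(\<lambda>k. bump p q k x) \<longlonglongrightarrow> 1"
proof -
  have "filterlim (\<lambda>k. real (Suc k) * c) at_top sequentially" if "c > 0" for c
    by (rule filterlim_at_top_mult_tendsto_pos[OF tendsto_const that])
      (intro filterlim_compose[OF filterlim_real_sequentially] filterlim_Suc)
  then have "(\<lambda>k. flat_exp 1 (real (Suc k) * c)) \<longlonglongrightarrow> 1" if "c > 0" for c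
    using that by (intro filterlim_compose[OF flat_exp_1_tendsto]) auto
  from tendsto_mult[OF this[of "x - p"] this[of "q - x"]] assms
  show ?thesis by (simp add: bump_def)
qed

text \<open>
  Cut-off functions whose supports stay in the open interval while they exhaust it.
\<close>

lemma bump_exhaustion_tendsto:
  assumes x: "x \<in> {a<..<b}"
  shows "(\<lambda>k. bump (a + inverse (real (Suc k))) (b - inverse (real (Suc k))) k x) \<longlonglongrightarrow> 1"
proof -
  have "filterlim (\<lambda>k. real (Suc k) * (c - inverse (real (Suc k)))) at_top sequentially"
    if "c > 0" for c
  proof (rule filterlim_at_top_mult_tendsto_pos[OF _ that])
    show "(\<lambda>k. c - inverse (real (Suc k))) \<longlonglongrightarrow> c"
      using tendsto_diff[OF tendsto_const LIMSEQ_inverse_real_of_nat, of c] by simp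
    show "filterlim (\<lambda>k. real (Suc k)) at_top sequentially"
      by (intro filterlim_compose[OF filterlim_real_sequentially] filterlim_Suc)
  qed
  then have "(\<lambda>k. flat_exp 1 (real (Suc k) * (c - inverse (real (Suc k))))) \<longlonglongrightarrow> 1"
    if "c > 0" for c
    using that by (intro filterlim_compose[OF flat_exp_1_tendsto]) auto
  from tendsto_mult[OF this[of "x - a"] this[of "b - x"]] assms
  show ?thesis by (simp add: bump_def diff_diff_eq add.commute diff_right_commute del: of_nat_Suc)
qed

lemma test_function_interval_iff:
  "test_function {a<..<b} \<phi> \<longleftrightarrow> smooth_on UNIV \<phi> \<and>
     (\<exists>p q. a < p \<and> q < b \<and> (\<forall>x. x \<notin> {p..q} \<longrightarrow> \<phi> x = 0))"
proof
  assume "test_function {a<..<b} \<phi>"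
  then obtain K where K: "smooth_on UNIV \<phi>" "compact K" "K \<subseteq> {a<..<b}" "\<forall>x. x \<notin> K \<longrightarrow> \<phi> x = 0"
    unfolding test_function_def by blast
  show "smooth_on UNIV \<phi> \<and> (\<exists>p q. a < p \<and> q < b \<and> (\<forall>x. x \<notin> {p..q} \<longrightarrow> \<phi> x = 0))"
  proof (cases "K = {}")
    case True
    have "a < a + 1" "b - 1 < b" by auto
    then show ?thesis using K True by blast
  next
    case False
    obtain p where p: "p \<in> K" "\<forall>y\<in>K. p \<le> y" using compact_attains_inf[OF K(2) False] by blast
    obtain q where q: "q \<in> K" "\<forall>y\<in>K. y \<le> q" using compact_attains_sup[OF K(2) False] by blast
    have "a < p" "q < b" using p q K by auto
    moreover have "\<forall>x. x \<notin> {p..q} \<longrightarrow> \<phi> x = 0" using p q K by auto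
    ultimately show ?thesis using K by blast
  qed
next
  assume "smooth_on UNIV \<phi> \<and> (\<exists>p q. a < p \<and> q < b \<and> (\<forall>x. x \<notin> {p..q} \<longrightarrow> \<phi> x = 0))"
  then obtain p q where *: "smooth_on UNIV \<phi>" "a < p" "q < b" "\<forall>x. x \<notin> {p..q} \<longrightarrow> \<phi> x = 0" by blast
  then have "{p..q} \<subseteq> {a<..<b}" by auto
  then show "test_function {a<..<b} \<phi>"
    unfolding test_function_def using * compact_Icc by blast
qed

section \<open>Uniqueness of weak derivatives\<close>

text \<open>
  Completeness of Lebesgue measure passes to its restrictions. It is what makes the representative
  chosen by \<open>weak_deriv\<close> measurable.
\<close>

lemma lebesgue_on_AE_eq_measurable:
  fixes f g :: "real \<Rightarrow> real"
  assumes S: "S \<in> sets lebesgue" and f: "f \<in> borel_measurable (lebesgue_on S)"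
    and eq: "AE x in lebesgue_on S. f x = g x"
  shows "g \<in> borel_measurable (lebesgue_on S)"
  unfolding borel_measurable_iff_le
proof
  fix c
  have "{x \<in> S. f x \<le> c} \<in> sets (lebesgue_on S)"
    using f unfolding borel_measurable_iff_le by simp
  then have A: "{x \<in> S. f x \<le> c} \<in> sets lebesgue"
    using S by (simp add: sets_restrict_space_iff)
  have "AE x in lebesgue. x \<in> {x \<in> S. f x \<le> c} \<longleftrightarrow> x \<in> {x \<in> S. g x \<le> c}"
    using eq S by (subst (asm) AE_restrict_space_iff) auto
  then have "{x \<in> S. g x \<le> c} \<in> sets lebesgue"
    by (rule completion.in_sets_AE[OF _ A]) auto
  then show "{w \<in> space (lebesgue_on S). g w \<le> c} \<in> sets (lebesgue_on S)"
    using S by (simp add: sets_restrict_space_iff)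
qed

lemma integrable_mult_bounded:
  fixes f g :: "'a \<Rightarrow> real"
  assumes "integrable M f" "g \<in> borel_measurable M" "\<And>x. x \<in> space M \<Longrightarrow> \<bar>g x\<bar> \<le> C"
  shows "integrable M (\<lambda>x. f x * g x)"
proof (rule Bochner_Integration.integrable_bound[of M "\<lambda>x. C * f x"])
  show "AE x in M. norm (f x * g x) \<le> norm (C * f x)"
  proof (rule AE_I2)
    fix x assume "x \<in> space M"
    then have "\<bar>g x\<bar> \<le> \<bar>C\<bar>" using assms(3)[of x] by linarith
    from mult_right_mono[OF this, of "\<bar>f x\<bar>"]
    show "norm (f x * g x) \<le> norm (C * f x)" by (simp add: abs_mult mult.commute)
  qed
qed (use assms in auto)

lemma finite_measure_lebesgue_on_Ioo: "finite_measure (lebesgue_on {a<..<b::real})"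
  by (rule finite_measure_lebesgue_on) simp

lemma lebesgue_on_cong_support:
  fixes h :: "real \<Rightarrow> real"
  assumes "S \<in> sets lebesgue" "T \<in> sets lebesgue" "\<And>x. x \<in> S - T \<Longrightarrow> h x = 0" "\<And>x. x \<in> T - S \<Longrightarrow> h x = 0"
  shows "integrable (lebesgue_on S) h \<longleftrightarrow> integrable (lebesgue_on T) h"
    and "(LINT x|lebesgue_on S. h x) = (LINT x|lebesgue_on T. h x)"
proof -
  have "(\<lambda>x. if x \<in> S then h x else 0) = (\<lambda>x. if x \<in> T then h x else 0)"
    using assms by auto
  then show "integrable (lebesgue_on S) h \<longleftrightarrow> integrable (lebesgue_on T) h"
    "(LINT x|lebesgue_on S. h x) = (LINT x|lebesgue_on T. h x)"
    using assms(1,2) by (metis Lebesgue_Measure.integrable_restrict_UNIV,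
      metis Lebesgue_Measure.integral_restrict_UNIV)
qed

lemma test_function_smooth: "test_function S \<phi> \<Longrightarrow> smooth_on UNIV \<phi>"
  by (simp add: test_function_def)

lemma test_function_has_deriv:
  "test_function S \<phi> \<Longrightarrow> (\<phi> has_real_derivative deriv \<phi> x) (at x)"
  by (rule smooth_on_has_deriv[of UNIV]) (auto simp: test_function_def)

lemma test_function_continuous: "test_function S \<phi> \<Longrightarrow> continuous_on T \<phi>"
  by (meson DERIV_isCont continuous_at_imp_continuous_on test_function_has_deriv)

lemma test_function_deriv:
  assumes "test_function S \<phi>"
  shows "test_function S (deriv \<phi>)"
proof -
  obtain K where K: "compact K" "K \<subseteq> S" "\<forall>x. x \<notin> K \<longrightarrow> \<phi> x = 0"
    using assms unfolding test_function_def by blast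
  have "deriv \<phi> x = 0" if "x \<notin> K" for x
  proof -
    have "(\<phi> has_real_derivative 0) (at x)"
      by (rule has_field_derivative_transform_within_open[of "\<lambda>x. 0" _ _ "- K"])
        (use K that compact_imp_closed[OF K(1)] in auto)
    then show ?thesis by (rule DERIV_imp_deriv)
  qed
  then show ?thesis
    using assms K smooth_on_deriv unfolding test_function_def by blast
qed

lemma test_function_bounded:
  assumes "test_function S \<phi>"
  obtains C where "\<And>x. \<bar>\<phi> x\<bar> \<le> C" "0 \<le> C"
proof -
  obtain K where K: "compact K" "K \<subseteq> S" "\<forall>x. x \<notin> K \<longrightarrow> \<phi> x = 0"
    using assms unfolding test_function_def by blast
  have "bounded (\<phi> ` K)"
    by (intro compact_imp_bounded compact_continuous_image test_function_continuous[OF assms] K)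
  then obtain C where "\<forall>y\<in>\<phi> ` K. norm y \<le> C" unfolding bounded_iff by blast
  then have "\<bar>\<phi> x\<bar> \<le> max C 0" for x using K by (cases "x \<in> K") (auto simp: max_def)
  then show ?thesis using that by fastforce
qed

lemma test_function_measurable: "test_function S \<phi> \<Longrightarrow> T \<in> sets lebesgue \<Longrightarrow> \<phi> \<in> borel_measurable (lebesgue_on T)"
  by (intro continuous_imp_measurable_on_sets_lebesgue test_function_continuous)

lemma integrable_mult_test_function:
  assumes d: "locally_integrable_on S d" and S: "S \<in> sets lebesgue" and \<phi>: "test_function S \<phi>"
  shows "integrable (lebesgue_on S) (\<lambda>x. d x * \<phi> x)"
proof -
  obtain K where K: "compact K" "K \<subseteq> S" "\<forall>x. x \<notin> K \<longrightarrow> \<phi> x = 0"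
    using \<phi> unfolding test_function_def by blast
  have K': "K \<in> sets lebesgue" using K by (simp add: compact_imp_closed lmeasurable_compact fmeasurableD)
  obtain C where C: "\<And>x. \<bar>\<phi> x\<bar> \<le> C" using test_function_bounded[OF \<phi>] by blast
  have "integrable (lebesgue_on K) d" using d K unfolding locally_integrable_on_def by blast
  then have "integrable (lebesgue_on K) (\<lambda>x. d x * \<phi> x)"
    by (rule integrable_mult_bounded[OF _ test_function_measurable[OF \<phi> K'] C])
  then show ?thesis
    using lebesgue_on_cong_support(1)[OF K' S, of "\<lambda>x. d x * \<phi> x"] K by auto
qed

lemma test_function_bump: "a < p \<Longrightarrow> q < b \<Longrightarrow> test_function {a<..<b} (bump p q k)"
  unfolding test_function_interval_iff
  by (intro conjI smooth_on_bump exI[of _ p] exI[of _ q] allI impI bump_outside) auto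

lemma locally_integrable_on_Icc:
  "locally_integrable_on {a<..<b} d \<Longrightarrow> a < p \<Longrightarrow> q < b \<Longrightarrow> integrable (lebesgue_on {p..q}) d"
  unfolding locally_integrable_on_def by (elim allE[of _ "{p..q}"]) auto

lemma integrable_lebesgue_on_subset:
  fixes f :: "real \<Rightarrow> real"
  assumes "integrable (lebesgue_on S) f" "T \<subseteq> S" "T \<in> sets lebesgue" "S \<in> sets lebesgue"
  shows "integrable (lebesgue_on T) f"
proof -
  have "set_integrable lebesgue T f"
    by (rule set_integrable_subset[of _ S]) (use assms in \<open>auto simp: set_integrable_def integrable_restrict_space\<close>)
  then show ?thesis using assms by (auto simp: set_integrable_def integrable_restrict_space)
qed

text \<open>
  By Lebesgue's differentiation theorem the function is almost everywhere the limit of its means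
  over intervals \<open>[x, x + h]\<close>, and these all vanish.
\<close>

lemma AE_eq_0_if_interval_integrals_eq_0:
  fixes d :: "real \<Rightarrow> real"
  assumes int: "integrable (lebesgue_on {P..Q}) d"
    and zero: "\<And>p q. P \<le> p \<Longrightarrow> q \<le> Q \<Longrightarrow> integral {p..q} d = 0"
  shows "AE x in lebesgue. x \<in> {P<..<Q} \<longrightarrow> d x = 0"
proof -
  define D where "D x = (if x \<in> {P..Q} then d x else 0)" for x
  have "integrable lebesgue D"
    unfolding D_def using int by (subst Lebesgue_Measure.integrable_restrict_UNIV) auto
  then have "D integrable_on UNIV"
    by (simp add: integrable_on_lebesgue)
  then have "D integrable_on cbox p q" for p q
    using integrable_on_subcbox by blast
  then obtain N where N: "negligible N" and lim:
    "\<And>x e. x \<notin> N \<Longrightarrow> 0 < e \<Longrightarrow> \<exists>\<delta>>0. \<forall>h. 0 < h \<and> h < \<delta> \<longrightarrow>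
        norm (integral (cbox x (x + h *\<^sub>R One)) D /\<^sub>R h ^ DIM(real) - D x) < e"
    using integrable_ccontinuous_explicit[of D] by blast
  have "d x = 0" if x: "x \<in> {P<..<Q}" "x \<notin> N" for x
  proof (rule ccontr)
    assume "d x \<noteq> 0"
    then obtain \<delta> where \<delta>: "\<delta> > 0" "\<And>h. 0 < h \<Longrightarrow> h < \<delta> \<Longrightarrow>
        norm (integral (cbox x (x + h *\<^sub>R One)) D /\<^sub>R h ^ DIM(real) - D x) < \<bar>d x\<bar>"
      using lim[OF x(2), of "\<bar>d x\<bar>"] by auto
    define h where "h = min (\<delta> / 2) (Q - x)"
    have h: "0 < h" "h < \<delta>" "x + h \<le> Q" using \<delta>(1) x by (auto simp: h_def)
    have "integral {x..x + h} D = integral {x..x + h} d"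
      by (rule integral_cong) (use x h in \<open>auto simp: D_def\<close>)
    also have "\<dots> = 0" using zero[of x "x + h"] x h by auto
    finally show False using \<delta>(2)[OF h(1,2)] x by (simp add: D_def)
  qed
  then have "\<forall>x. x \<in> - N \<longrightarrow> x \<in> {P<..<Q} \<longrightarrow> d x = 0" by blast
  then show ?thesis
    using N by (intro AE_I'[of N]) (auto simp: negligible_iff_null_sets)
qed

text \<open>
  Testing with bumps that increase to the indicator of an interval shows that the integral over
  every compact subinterval is zero.
\<close>

lemma fundamental_lemma_calculus_of_variations:
  assumes loc: "locally_integrable_on {a<..<b} d"
    and zero: "\<And>\<phi>. test_function {a<..<b} \<phi> \<Longrightarrow> (LINT x|lebesgue_on {a<..<b}. d x * \<phi> x) = 0"
  shows "AE x in lebesgue_on {a<..<b}. d x = 0"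
proof -
  \<comment> \<open>Dominated convergence along the bumps over \<open>(p, q)\<close>.\<close>
  have int0: "integral {p..q} d = 0" if pq: "a < p" "q < b" for p q
  proof -
    have d: "integrable (lebesgue_on {p<..<q}) d"
      by (rule integrable_lebesgue_on_subset[OF locally_integrable_on_Icc[OF loc pq]]) auto
    have "(\<lambda>k. LINT x|lebesgue_on {p<..<q}. d x * bump p q k x) \<longlonglongrightarrow> (LINT x|lebesgue_on {p<..<q}. d x)"
    proof (rule integral_dominated_convergence[where w="\<lambda>x. \<bar>d x\<bar>"])
      show "(\<lambda>x. d x * bump p q k x) \<in> borel_measurable (lebesgue_on {p<..<q})" for k
        using d by (intro borel_measurable_times test_function_measurable[OF test_function_bump[OF pq]]) auto
      show "AE x in lebesgue_on {p<..<q}. (\<lambda>k. d x * bump p q k x) \<longlonglongrightarrow> d x"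
        using bump_tendsto[of _ p q] by (intro AE_I2) (auto intro!: tendsto_eq_intros)
      show "AE x in lebesgue_on {p<..<q}. norm (d x * bump p q k x) \<le> \<bar>d x\<bar>" for k
        using bump_bounds[of p q k] by (intro AE_I2) (auto simp: abs_mult intro!: mult_left_le)
    qed (use d in auto)
    moreover have "(LINT x|lebesgue_on {p<..<q}. d x * bump p q k x) = 0" for k
    proof -
      have "(LINT x|lebesgue_on {p<..<q}. d x * bump p q k x) = (LINT x|lebesgue_on {a<..<b}. d x * bump p q k x)"
        by (rule lebesgue_on_cong_support) (use pq bump_outside in auto)
      then show ?thesis using zero[OF test_function_bump[OF pq]] by simp
    qed
    ultimately have "(LINT x|lebesgue_on {p<..<q}. d x) = 0"
      by (simp add: LIMSEQ_const_iff)
    then show ?thesis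
      using lebesgue_integral_eq_integral[OF d] by (simp add: integral_open_interval_real)
  qed
  have "AE x in lebesgue. x \<in> {a + inverse (real (Suc m))<..<b - inverse (real (Suc m))} \<longrightarrow> d x = 0" for m
  proof (rule AE_eq_0_if_interval_integrals_eq_0)
    have m: "inverse (real (Suc m)) > 0" by simp
    then have "a < a + inverse (real (Suc m))" "b - inverse (real (Suc m)) < b" by linarith+
    then show "integrable (lebesgue_on {a + inverse (real (Suc m))..b - inverse (real (Suc m))}) d"
      by (rule locally_integrable_on_Icc[OF loc])
    show "integral {p..q} d = 0" if "a + inverse (real (Suc m)) \<le> p" "q \<le> b - inverse (real (Suc m))" for p q
      by (rule int0) (use that m in linarith)+
  qed
  then have "AE x in lebesgue. \<forall>m. x \<in> {a + inverse (real (Suc m))<..<b - inverse (real (Suc m))} \<longrightarrow> d x = 0"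
    unfolding AE_all_countable by blast
  then have "AE x in lebesgue. x \<in> {a<..<b} \<longrightarrow> d x = 0"
  proof (eventually_elim, intro impI)
    fix x assume *: "\<forall>m. x \<in> {a + inverse (real (Suc m))<..<b - inverse (real (Suc m))} \<longrightarrow> d x = 0"
      and x: "x \<in> {a<..<b}"
    then have "0 < min (x - a) (b - x)" by auto
    then obtain m where "inverse (real (Suc m)) < min (x - a) (b - x)"
      using reals_Archimedean by blast
    then show "d x = 0" using *[rule_format, of m] by auto
  qed
  then show ?thesis by (subst AE_restrict_space_iff) auto
qed

lemma has_weak_deriv_AE_unique:
  assumes g: "has_weak_deriv {a<..<b} u g" and g': "has_weak_deriv {a<..<b} u' g'"
    and eq: "AE x in lebesgue_on {a<..<b}. u x = u' x"
  shows "AE x in lebesgue_on {a<..<b}. g x = g' x"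
proof -
  have "locally_integrable_on {a<..<b} (\<lambda>x. g x - g' x)"
    using g g' unfolding has_weak_deriv_def locally_integrable_on_def by auto
  then have "AE x in lebesgue_on {a<..<b}. g x - g' x = 0"
  proof (rule fundamental_lemma_calculus_of_variations)
    fix \<phi> assume \<phi>: "test_function {a<..<b} \<phi>"
    note int = integrable_mult_test_function[OF _ _ \<phi>] integrable_mult_test_function[OF _ _ test_function_deriv[OF \<phi>]]
    have "(LINT x|lebesgue_on {a<..<b}. (g x - g' x) * \<phi> x) =
        (LINT x|lebesgue_on {a<..<b}. g x * \<phi> x) - (LINT x|lebesgue_on {a<..<b}. g' x * \<phi> x)"
      unfolding left_diff_distrib
      by (rule Bochner_Integration.integral_diff) (use int g g' in \<open>auto simp: has_weak_deriv_def\<close>)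
    also have "\<dots> = (LINT x|lebesgue_on {a<..<b}. u' x * deriv \<phi> x) - (LINT x|lebesgue_on {a<..<b}. u x * deriv \<phi> x)"
      using g g' \<phi> by (simp add: has_weak_deriv_def)
    also have "(LINT x|lebesgue_on {a<..<b}. u' x * deriv \<phi> x) = (LINT x|lebesgue_on {a<..<b}. u x * deriv \<phi> x)"
      by (rule integral_cong_AE) (use int g g' eq in \<open>auto simp: has_weak_deriv_def\<close>)
    finally show "(LINT x|lebesgue_on {a<..<b}. (g x - g' x) * \<phi> x) = 0" by simp
  qed
  then show ?thesis by simp
qed

lemma has_weak_deriv_weak_deriv: "has_weak_deriv S u g \<Longrightarrow> has_weak_deriv S u (weak_deriv S u)"
  unfolding weak_deriv_def by (rule someI[of "has_weak_deriv S u"])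

text \<open>
  The representative chosen by \<open>weak_deriv\<close> can thus be replaced by any weak derivative at hand.
\<close>

lemma weak_deriv_AE_eq:
  assumes "has_weak_deriv {a<..<b} u g"
  shows "AE x in lebesgue_on {a<..<b}. weak_deriv {a<..<b} u x = g x"
  by (rule has_weak_deriv_AE_unique[OF has_weak_deriv_weak_deriv[OF assms] assms]) auto

lemma weak_deriv_W12:
  assumes "u \<in> W12 {a<..<b}"
  shows "has_weak_deriv {a<..<b} u (weak_deriv {a<..<b} u)" "weak_deriv {a<..<b} u \<in> L2 {a<..<b}"
proof -
  obtain g where g: "g \<in> L2 {a<..<b}" "has_weak_deriv {a<..<b} u g"
    using assms unfolding W12_def by blast
  show "has_weak_deriv {a<..<b} u (weak_deriv {a<..<b} u)"
    by (rule has_weak_deriv_weak_deriv[OF g(2)])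
  have eq: "AE x in lebesgue_on {a<..<b}. g x = weak_deriv {a<..<b} u x"
    using weak_deriv_AE_eq[OF g(2)] by auto
  have m: "weak_deriv {a<..<b} u \<in> borel_measurable (lebesgue_on {a<..<b})"
    by (rule lebesgue_on_AE_eq_measurable[OF _ _ eq]) (use g in \<open>auto simp: L2_def\<close>)
  moreover have "integrable (lebesgue_on {a<..<b}) (\<lambda>x. (weak_deriv {a<..<b} u x)\<^sup>2)"
    by (rule integrable_cong_AE_imp[of _ "\<lambda>x. (g x)\<^sup>2"]) (use g m eq in \<open>auto simp: L2_def\<close>)
  ultimately show "weak_deriv {a<..<b} u \<in> L2 {a<..<b}"
    by (simp add: L2_def)
qed

section \<open>Sobolev norms of piecewise differentiable functions\<close>

lemma L2_integrable:
  assumes "f \<in> L2 {a<..<b}"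
  shows "integrable (lebesgue_on {a<..<b}) f"
proof (rule Bochner_Integration.integrable_bound[of _ "\<lambda>x. 1 + (f x)\<^sup>2"])
  interpret finite_measure "lebesgue_on {a<..<b}" by (rule finite_measure_lebesgue_on_Ioo)
  show "integrable (lebesgue_on {a<..<b}) (\<lambda>x. 1 + (f x)\<^sup>2)"
    using assms by (auto simp: L2_def)
  have "\<bar>y\<bar> \<le> 1 + y\<^sup>2" for y :: real
    using zero_le_power2[of "\<bar>y\<bar> - 1"] abs_ge_zero[of y] zero_le_power2[of y]
    by (simp add: power2_diff)
  then show "AE x in lebesgue_on {a<..<b}. norm (f x) \<le> norm (1 + (f x)\<^sup>2)"
    by (intro AE_I2) (simp add: abs_of_nonneg add_nonneg_nonneg)
qed (use assms in \<open>auto simp: L2_def\<close>)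

lemma bounded_imp_L2:
  assumes "f \<in> borel_measurable (lebesgue_on {a<..<b})" "\<And>x. x \<in> {a<..<b} \<Longrightarrow> \<bar>f x\<bar> \<le> C"
  shows "f \<in> L2 {a<..<b}"
proof -
  interpret finite_measure "lebesgue_on {a<..<b}" by (rule finite_measure_lebesgue_on_Ioo)
  have "integrable (lebesgue_on {a<..<b}) (\<lambda>x. (f x)\<^sup>2)"
  proof (rule integrable_const_bound[of _ "C\<^sup>2"])
    show "AE x in lebesgue_on {a<..<b}. norm ((f x)\<^sup>2) \<le> C\<^sup>2"
      using power_mono[OF assms(2), of _ 2] by (intro AE_I2) simp
  qed (use assms in auto)
  then show ?thesis using assms by (simp add: L2_def)
qed

lemma L2_diff:
  assumes "f \<in> L2 S" "g \<in> L2 S"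
  shows "(\<lambda>x. f x - g x) \<in> L2 S"
proof -
  have "integrable (lebesgue_on S) (\<lambda>x. (f x - g x)\<^sup>2)"
  proof (rule Bochner_Integration.integrable_bound[of _ "\<lambda>x. 2 * (f x)\<^sup>2 + 2 * (g x)\<^sup>2"])
    have "(s - t)\<^sup>2 \<le> 2 * s\<^sup>2 + 2 * t\<^sup>2" for s t :: real
      using zero_le_power2[of "s + t"] by (simp add: power2_eq_square algebra_simps)
    then show "AE x in lebesgue_on S. norm ((f x - g x)\<^sup>2) \<le> norm (2 * (f x)\<^sup>2 + 2 * (g x)\<^sup>2)"
      by (intro AE_I2) (simp add: abs_of_nonneg add_nonneg_nonneg)
  qed (use assms in \<open>auto simp: L2_def\<close>)
  then show ?thesis using assms by (auto simp: L2_def)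
qed

lemma integrable_imp_locally_integrable:
  assumes "integrable (lebesgue_on S) f" "S \<in> sets lebesgue"
  shows "locally_integrable_on S f"
  unfolding locally_integrable_on_def
  by (auto intro!: integrable_lebesgue_on_subset[OF assms(1)] simp: assms lmeasurable_compact fmeasurableD)

text \<open>
  The Cauchy-Schwarz inequality against the constant 1, in the form that the variance of \<open>\<bar>f\<bar>\<close> is
  nonnegative.
\<close>

lemma L1_le_L2:
  assumes ab: "a < b" and f: "f \<in> L2 {a<..<b}"
  shows "(LINT x|lebesgue_on {a<..<b}. \<bar>f x\<bar>)\<^sup>2 \<le> (b - a) * (LINT x|lebesgue_on {a<..<b}. (f x)\<^sup>2)"
proof -
  interpret finite_measure "lebesgue_on {a<..<b}" by (rule finite_measure_lebesgue_on_Ioo)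
  let ?M = "lebesgue_on {a<..<b}"
  define I m where "I = (LINT x|?M. \<bar>f x\<bar>)" and "m = I / (b - a)"
  have i: "integrable ?M f" "integrable ?M (\<lambda>x. (f x)\<^sup>2)"
    using L2_integrable[OF f] f by (auto simp: L2_def)
  have \<mu>: "measure ?M {a<..<b} = b - a"
    using ab by (simp add: measure_restrict_space)
  have "0 \<le> (LINT x|?M. (\<bar>f x\<bar> - m)\<^sup>2)" by (rule Bochner_Integration.integral_nonneg) simp
  also have "(\<lambda>x. (\<bar>f x\<bar> - m)\<^sup>2) = (\<lambda>x. (f x)\<^sup>2 - 2 * m * \<bar>f x\<bar> + m\<^sup>2)"
    by (auto simp: power2_eq_square algebra_simps)
  also have "(LINT x|?M. (f x)\<^sup>2 - 2 * m * \<bar>f x\<bar> + m\<^sup>2) =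
      (LINT x|?M. (f x)\<^sup>2) - 2 * m * I + (b - a) * m\<^sup>2"
    using i \<mu> by (simp add: I_def)
  also have "\<dots> = (LINT x|?M. (f x)\<^sup>2) - I\<^sup>2 / (b - a)"
  proof -
    have "2 * m * I - (b - a) * m\<^sup>2 = I\<^sup>2 / (b - a)"
      using ab unfolding m_def power2_eq_square by (simp add: divide_simps)
    then show ?thesis by simp
  qed
  finally show ?thesis
    using ab by (simp add: I_def field_simps)
qed

lemma integral_by_parts_test_function:
  assumes ab: "a < b" and F: "continuous_on {a..b} F" and Z: "finite Z"
    and deriv: "\<And>x. x \<in> {a<..<b} - Z \<Longrightarrow> (F has_real_derivative f x) (at x)"
    and f: "integrable (lebesgue_on {a<..<b}) f" and \<phi>: "test_function {a<..<b} \<phi>"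
  shows "(LINT x|lebesgue_on {a<..<b}. F x * deriv \<phi> x) = - (LINT x|lebesgue_on {a<..<b}. f x * \<phi> x)"
proof -
  note \<phi>' = test_function_deriv[OF \<phi>]
  have "\<phi> a = 0" "\<phi> b = 0"
    using \<phi> unfolding test_function_interval_iff by force+
  have "((\<lambda>x. F x * deriv \<phi> x + f x * \<phi> x) has_integral (F b * \<phi> b - F a * \<phi> a)) {a..b}"
  proof (rule fundamental_theorem_of_calculus_interior_strong[OF Z])
    show "((\<lambda>x. F x * \<phi> x) has_vector_derivative F x * deriv \<phi> x + f x * \<phi> x) (at x)"
      if "x \<in> {a<..<b} - Z" for x
      using DERIV_mult'[OF deriv[OF that] test_function_has_deriv[OF \<phi>]]
      by (simp add: has_real_derivative_iff_has_vector_derivative)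
    show "continuous_on {a..b} (\<lambda>x. F x * \<phi> x)"
      by (intro continuous_intros F test_function_continuous[OF \<phi>])
  qed (use ab in auto)
  then have "((\<lambda>x. F x * deriv \<phi> x + f x * \<phi> x) has_integral 0) {a<..<b}"
    using \<open>\<phi> a = 0\<close> \<open>\<phi> b = 0\<close> by (simp add: has_integral_Icc_iff_Ioo)
  then have "integral {a<..<b} (\<lambda>x. F x * deriv \<phi> x + f x * \<phi> x) = 0"
    by (rule integral_unique)
  moreover have i: "integrable (lebesgue_on {a<..<b}) (\<lambda>x. F x * deriv \<phi> x)"
    "integrable (lebesgue_on {a<..<b}) (\<lambda>x. f x * \<phi> x)"
  proof -
    have "integrable (lebesgue_on {a<..<b}) F"
      by (rule integrable_lebesgue_on_subset[OF continuous_imp_integrable_real[OF F]]) auto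
    from integrable_mult_test_function[OF integrable_imp_locally_integrable[OF this] _ \<phi>']
    show "integrable (lebesgue_on {a<..<b}) (\<lambda>x. F x * deriv \<phi> x)" by simp
    from integrable_mult_test_function[OF integrable_imp_locally_integrable[OF f] _ \<phi>]
    show "integrable (lebesgue_on {a<..<b}) (\<lambda>x. f x * \<phi> x)" by simp
  qed
  ultimately have "(LINT x|lebesgue_on {a<..<b}. F x * deriv \<phi> x + f x * \<phi> x) = 0"
    by (subst lebesgue_integral_eq_integral) auto
  then show ?thesis using i by (simp add: add_eq_0_iff2)
qed

lemma continuous_on_Icc_L2:
  fixes F :: "real \<Rightarrow> real"
  assumes "continuous_on {a..b} F"
  shows "F \<in> L2 {a<..<b}"
proof -
  have "F \<in> borel_measurable (lebesgue_on {a<..<b})"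
    by (rule continuous_imp_measurable_on_sets_lebesgue)
      (auto intro: continuous_on_subset[OF assms])
  moreover have "bounded (F ` {a..b})"
    by (intro compact_imp_bounded compact_continuous_image assms) auto
  then obtain C where "\<forall>y\<in>F ` {a..b}. norm y \<le> C" unfolding bounded_iff by blast
  then have "\<bar>F x\<bar> \<le> C" if "x \<in> {a<..<b}" for x using that by auto
  ultimately show ?thesis by (rule bounded_imp_L2)
qed

lemma L2_cong_AE:
  assumes "S \<in> sets lebesgue" "f \<in> L2 S" "AE x in lebesgue_on S. f x = g x"
  shows "g \<in> L2 S"
proof -
  have g: "g \<in> borel_measurable (lebesgue_on S)"
    using lebesgue_on_AE_eq_measurable[OF assms(1) _ assms(3)] assms(2) by (auto simp: L2_def)
  have "integrable (lebesgue_on S) (\<lambda>x. (g x)\<^sup>2)"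
    by (rule integrable_cong_AE_imp[of _ "\<lambda>x. (f x)\<^sup>2"]) (use g assms in \<open>auto simp: L2_def\<close>)
  with g show ?thesis by (simp add: L2_def)
qed

lemma has_weak_deriv_L2_I:
  assumes "u \<in> L2 {a<..<b}" "g \<in> L2 {a<..<b}"
    and "\<And>\<phi>. test_function {a<..<b} \<phi> \<Longrightarrow>
      (LINT x|lebesgue_on {a<..<b}. u x * deriv \<phi> x) = - (LINT x|lebesgue_on {a<..<b}. g x * \<phi> x)"
  shows "has_weak_deriv {a<..<b} u g"
  using assms by (auto simp: has_weak_deriv_def intro!: integrable_imp_locally_integrable L2_integrable)

text \<open>
  The fundamental theorem of calculus, and with it integration by parts, holds for a continuous
  function that is differentiable off a finite set. Its pointwise derivative is therefore its weak
  derivative.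
\<close>

lemma has_weak_deriv_piecewise:
  assumes ab: "a < b" and F: "continuous_on {a..b} F" and Z: "finite Z"
    and deriv: "\<And>x. x \<in> {a<..<b} - Z \<Longrightarrow> (F has_real_derivative f x) (at x)"
    and f: "f \<in> L2 {a<..<b}"
    and u: "AE x in lebesgue_on {a<..<b}. F x = u x"
  shows "has_weak_deriv {a<..<b} u f" "u \<in> W12 {a<..<b}"
proof -
  have u2: "u \<in> L2 {a<..<b}"
    by (rule L2_cong_AE[OF _ continuous_on_Icc_L2[OF F] u]) simp
  show w: "has_weak_deriv {a<..<b} u f"
  proof (rule has_weak_deriv_L2_I[OF u2 f])
    fix \<phi> assume \<phi>: "test_function {a<..<b} \<phi>"
    have [measurable]: "u \<in> borel_measurable (lebesgue_on {a<..<b})" "F \<in> borel_measurable (lebesgue_on {a<..<b})"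
        "deriv \<phi> \<in> borel_measurable (lebesgue_on {a<..<b})"
      using u2 continuous_on_Icc_L2[OF F] test_function_measurable[OF test_function_deriv[OF \<phi>], of "{a<..<b}"]
      by (auto simp: L2_def)
    have "(LINT x|lebesgue_on {a<..<b}. u x * deriv \<phi> x) = (LINT x|lebesgue_on {a<..<b}. F x * deriv \<phi> x)"
      by (rule integral_cong_AE) (use u in auto)
    then show "(LINT x|lebesgue_on {a<..<b}. u x * deriv \<phi> x) = - (LINT x|lebesgue_on {a<..<b}. f x * \<phi> x)"
      using integral_by_parts_test_function[OF ab F Z deriv L2_integrable[OF f] \<phi>] by simp
  qed
  then show "u \<in> W12 {a<..<b}" using u2 f by (auto simp: W12_def)
qed

lemma has_weak_deriv_test_function:
  assumes "a < b" "test_function {a<..<b} \<phi>"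
  shows "has_weak_deriv {a<..<b} \<phi> (deriv \<phi>)" "\<phi> \<in> L2 {a<..<b}" "deriv \<phi> \<in> L2 {a<..<b}"
proof -
  show "\<phi> \<in> L2 {a<..<b}" "deriv \<phi> \<in> L2 {a<..<b}"
    using assms by (auto intro!: continuous_on_Icc_L2 test_function_continuous test_function_deriv)
  then show "has_weak_deriv {a<..<b} \<phi> (deriv \<phi>)"
    by (intro has_weak_deriv_piecewise(1)[OF assms(1) test_function_continuous[OF assms(2)], of "{}"]
        test_function_has_deriv[OF assms(2)]) auto
qed

lemma has_weak_deriv_diff:
  assumes S: "S \<in> sets lebesgue" and u: "has_weak_deriv S u g" and u': "has_weak_deriv S u' g'"
  shows "has_weak_deriv S (\<lambda>x. u x - u' x) (\<lambda>x. g x - g' x)"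
  unfolding has_weak_deriv_def
proof (intro conjI allI impI)
  show "locally_integrable_on S (\<lambda>x. u x - u' x)" "locally_integrable_on S (\<lambda>x. g x - g' x)"
    using u u' unfolding has_weak_deriv_def locally_integrable_on_def by auto
  fix \<phi> assume \<phi>: "test_function S \<phi>"
  note int = integrable_mult_test_function[OF _ S \<phi>] integrable_mult_test_function[OF _ S test_function_deriv[OF \<phi>]]
  show "(LINT x|lebesgue_on S. (u x - u' x) * deriv \<phi> x) = - (LINT x|lebesgue_on S. (g x - g' x) * \<phi> x)"
    using u u' \<phi> unfolding has_weak_deriv_def left_diff_distrib
    by (subst (1 2) Bochner_Integration.integral_diff) (auto simp: int)
qed

lemma integral_weak_deriv_sq:
  assumes "has_weak_deriv {a<..<b} u g" "g \<in> L2 {a<..<b}"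
  shows "(LINT x|lebesgue_on {a<..<b}. (weak_deriv {a<..<b} u x)\<^sup>2) = (LINT x|lebesgue_on {a<..<b}. (g x)\<^sup>2)"
proof -
  have eq: "AE x in lebesgue_on {a<..<b}. g x = weak_deriv {a<..<b} u x"
    using weak_deriv_AE_eq[OF assms(1)] by auto
  then have "weak_deriv {a<..<b} u \<in> L2 {a<..<b}"
    by (intro L2_cong_AE[OF _ assms(2)]) auto
  then show ?thesis
    by (intro integral_cong_AE) (use assms eq in \<open>auto simp: L2_def\<close>)
qed

lemma primitive_bound:
  assumes ab: "a < b" and F: "continuous_on {a..b} F" and Z: "finite Z"
    and deriv: "\<And>x. x \<in> {a<..<b} - Z \<Longrightarrow> (F has_real_derivative f x) (at x)"
    and f: "integrable (lebesgue_on {a<..<b}) f" and x: "x \<in> {a..b}"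
  shows "\<bar>F x - F a\<bar> \<le> (LINT x|lebesgue_on {a<..<b}. \<bar>f x\<bar>)"
proof -
  have ax: "(f has_integral F x - F a) {a..x}"
    by (rule fundamental_theorem_of_calculus_interior_strong[OF Z])
      (use x deriv continuous_on_subset[OF F] in \<open>auto simp: has_real_derivative_iff_has_vector_derivative\<close>)
  have i: "integrable (lebesgue_on {a<..<b}) (\<lambda>x. \<bar>f x\<bar>)" using f by auto
  have i': "(\<lambda>x. \<bar>f x\<bar>) integrable_on {a..b}"
    using integrable_on_lebesgue_on[OF i] by (simp add: integrable_on_Icc_iff_Ioo)
  then have i'': "(\<lambda>x. \<bar>f x\<bar>) integrable_on {a..x}"
    by (rule integrable_subinterval_real) (use x in auto)
  have "norm (integral {a..x} f) \<le> integral {a..x} (\<lambda>x. \<bar>f x\<bar>)"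
    by (rule integral_norm_bound_integral) (use ax i'' in \<open>auto simp: has_integral_integrable\<close>)
  also have "\<dots> \<le> integral {a..b} (\<lambda>x. \<bar>f x\<bar>)"
    by (rule integral_subset_le) (use x i' i'' in auto)
  also have "\<dots> = (LINT x|lebesgue_on {a<..<b}. \<bar>f x\<bar>)"
    by (subst lebesgue_integral_eq_integral[OF i]) (auto simp: integral_open_interval_real)
  finally show ?thesis using integral_unique[OF ax] by simp
qed

lemma W12_norm_nonneg: "0 \<le> W12_norm S u"
  unfolding W12_norm_def by (intro real_sqrt_ge_zero add_nonneg_nonneg Bochner_Integration.integral_nonneg) auto

text \<open>
  A Poincare inequality: a function that vanishes at the left end point is controlled by its
  derivative. Convergence in the Sobolev norm therefore only has to be checked for derivatives.
\<close>

lemma W12_norm_le_deriv: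
  assumes ab: "a < b" and F: "continuous_on {a..b} F" and Z: "finite Z"
    and deriv: "\<And>x. x \<in> {a<..<b} - Z \<Longrightarrow> (F has_real_derivative f x) (at x)"
    and f: "f \<in> L2 {a<..<b}" and Fa: "F a = 0"
    and u: "AE x in lebesgue_on {a<..<b}. F x = u x"
  shows "W12_norm {a<..<b} u \<le> sqrt (((b - a)\<^sup>2 + 1) * (LINT x|lebesgue_on {a<..<b}. (f x)\<^sup>2))"
proof -
  interpret finite_measure "lebesgue_on {a<..<b}" by (rule finite_measure_lebesgue_on_Ioo)
  let ?J = "LINT x|lebesgue_on {a<..<b}. (f x)\<^sup>2"
  have w: "has_weak_deriv {a<..<b} u f" and uW: "u \<in> W12 {a<..<b}"
    using has_weak_deriv_piecewise[OF ab F Z deriv f u] by auto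
  have "(LINT x|lebesgue_on {a<..<b}. (u x)\<^sup>2) \<le> (LINT x|lebesgue_on {a<..<b}. (b - a) * ?J)"
  proof (rule integral_mono_AE)
    show "AE x in lebesgue_on {a<..<b}. (u x)\<^sup>2 \<le> (b - a) * ?J"
    proof -
      have "(F x)\<^sup>2 \<le> (b - a) * ?J" if "x \<in> {a<..<b}" for x
      proof -
        have "\<bar>F x\<bar> \<le> (LINT x|lebesgue_on {a<..<b}. \<bar>f x\<bar>)"
          using primitive_bound[OF ab F Z deriv L2_integrable[OF f], of x] that Fa by auto
        from power_mono[OF this, of 2] L1_le_L2[OF ab f] show ?thesis by simp
      qed
      then have "AE x in lebesgue_on {a<..<b}. (F x)\<^sup>2 \<le> (b - a) * ?J" by (intro AE_I2) auto
      with u show ?thesis by eventually_elim simp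
    qed
  qed (use uW in \<open>auto simp: W12_def L2_def\<close>)
  also have "\<dots> = (b - a)\<^sup>2 * ?J"
    using ab by (simp add: measure_restrict_space power2_eq_square)
  finally show ?thesis
    unfolding W12_norm_def integral_weak_deriv_sq[OF w f] by (simp add: algebra_simps)
qed

section \<open>Approximation by test functions\<close>

lemma test_function_primitive:
  assumes ab: "a < b" and \<psi>: "test_function {a<..<b} \<psi>" and zero: "(LINT x|lebesgue_on {a<..<b}. \<psi> x) = 0"
  obtains \<phi> where "test_function {a<..<b} \<phi>" "\<And>x. (\<phi> has_real_derivative \<psi> x) (at x)"
proof -
  obtain p q where pq: "a < p" "q < b" "\<And>x. x \<notin> {p..q} \<Longrightarrow> \<psi> x = 0" and s: "smooth_on UNIV \<psi>"
    using \<psi> unfolding test_function_interval_iff by blast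
  define \<phi> where "\<phi> x = integral {a..x} \<psi>" for x
  have c: "continuous_on T \<psi>" for T by (rule test_function_continuous[OF \<psi>])
  have left: "\<phi> x = 0" if "x < p" for x
  proof -
    have "integral {a..x} \<psi> = integral {a..x} (\<lambda>x. 0)"
      by (rule integral_cong) (use that pq in auto)
    then show ?thesis by (simp add: \<phi>_def)
  qed
  have D: "(\<phi> has_real_derivative \<psi> x) (at x)" for x
  proof (cases "x < p")
    case True
    have "(\<phi> has_real_derivative 0) (at x)"
      by (rule has_field_derivative_transform_within_open[of "\<lambda>x. 0" _ _ "{..<p}"])
        (use True left in auto)
    then show ?thesis using pq True by simp
  next
    case False
    have "(\<phi> has_real_derivative \<psi> x) (at x within {a..x + 1})"
      unfolding \<phi>_def[abs_def] by (rule integral_has_real_derivative[OF c]) (use False pq in auto)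
    then show ?thesis
      using False pq by (simp add: at_within_Icc_at)
  qed
  have "(LINT x|lebesgue_on {a<..<b}. \<psi> x) = \<phi> b"
    using has_weak_deriv_test_function(2)[OF ab \<psi>]
    by (subst lebesgue_integral_eq_integral) (auto simp: L2_integrable \<phi>_def integral_open_interval_real)
  then have \<phi>b: "\<phi> b = 0" using zero by simp
  have right: "\<phi> x = 0" if "x > q" for x
  proof -
    have "\<phi> x = \<phi> b"
    proof (cases "x = b")
      case False
      have "\<phi> (max x b) = \<phi> (min x b)"
      proof (rule DERIV_isconst_end[of "min x b" "max x b" \<phi>])
        show "min x b < max x b" using False by auto
        show "continuous_on {min x b..max x b} \<phi>"
          using D by (meson DERIV_isCont continuous_at_imp_continuous_on)
        show "(\<phi> has_real_derivative 0) (at y)" if "min x b < y" "y < max x b" for y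
        proof -
          have "q < y" using that \<open>q < x\<close> pq(2) by (auto simp: min_def split: if_splits)
          then show ?thesis using D[of y] pq(3)[of y] by simp
        qed
      qed
      then show ?thesis by (auto simp: max_def min_def split: if_splits)
    qed simp
    then show ?thesis using \<phi>b by simp
  qed
  have "smooth_on UNIV \<phi>"
    by (rule smooth_on_closed_family[where F="insert \<phi> (Collect (smooth_on UNIV))"])
      (use D s smooth_on_deriv smooth_on_has_deriv in blast)+
  then have "test_function {a<..<b} \<phi>"
    unfolding test_function_interval_iff using pq left right
    by (intro conjI exI[of _ p] exI[of _ q]) (auto simp: not_le)
  then show ?thesis using D that by blast
qed

lemma test_function_mult_smooth:
  "test_function S \<phi> \<Longrightarrow> smooth_on UNIV f \<Longrightarrow> test_function S (\<lambda>x. f x * \<phi> x)"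
  unfolding test_function_def by (auto intro!: smooth_on_mult)

lemma test_function_add:
  assumes "test_function {a<..<b} \<phi>" "test_function {a<..<b} \<psi>"
  shows "test_function {a<..<b} (\<lambda>x. \<phi> x + \<psi> x)"
proof -
  obtain p q p' q' where *: "a < p" "q < b" "\<And>x. x \<notin> {p..q} \<Longrightarrow> \<phi> x = 0"
    "a < p'" "q' < b" "\<And>x. x \<notin> {p'..q'} \<Longrightarrow> \<psi> x = 0"
    using assms unfolding test_function_interval_iff by blast
  have "smooth_on UNIV (\<lambda>x. \<phi> x + \<psi> x)"
    by (intro smooth_on_add open_UNIV assms[THEN test_function_smooth])
  moreover have "a < min p p'" "max q q' < b" using * by auto
  moreover have "\<forall>x. x \<notin> {min p p'..max q q'} \<longrightarrow> \<phi> x + \<psi> x = 0"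
  proof (intro allI impI)
    fix x assume "x \<notin> {min p p'..max q q'}"
    then have "x \<notin> {p..q}" "x \<notin> {p'..q'}" by auto
    then show "\<phi> x + \<psi> x = 0" using *(3,6) by simp
  qed
  ultimately show ?thesis
    unfolding test_function_interval_iff by blast
qed

text \<open>
  Polynomials approximate \<open>p\<close> uniformly, and cut-off functions make the approximants compactly
  supported at a small cost in the mean square. Their integrals tend to the integral of \<open>p\<close>, which is
  zero, so subtracting these integrals times a fixed test function of mass one is harmless. The mean
  value zero is what allows the approximants to be integrated to test functions.
\<close>

lemma continuous_approx_by_test_functions:
  assumes ab: "a < b" and p: "continuous_on {a..b} p" and zero: "(LINT x|lebesgue_on {a<..<b}. p x) = 0"
  obtains \<psi> where "\<And>k::nat. test_function {a<..<b} (\<psi> k)" "\<And>k. (LINT x|lebesgue_on {a<..<b}. \<psi> k x) = 0"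
    "(\<lambda>k. LINT x|lebesgue_on {a<..<b}. (p x - \<psi> k x)\<^sup>2) \<longlonglongrightarrow> 0"
proof -
  let ?M = "lebesgue_on {a<..<b}"
  interpret finite_measure ?M by (rule finite_measure_lebesgue_on_Ioo)
  have "bounded (p ` {a..b})"
    by (intro compact_imp_bounded compact_continuous_image p) auto
  then obtain P where "\<forall>y\<in>p ` {a..b}. norm y \<le> P" unfolding bounded_iff by blast
  then have P: "\<bar>p x\<bar> \<le> P" if "x \<in> {a..b}" for x using that by auto
  have P0: "0 \<le> P" using P[of a] ab by auto
  have "\<exists>q. real_polynomial_function q \<and> (\<forall>x\<in>{a..b}. \<bar>p x - q x\<bar> < inverse (real (Suc k)))" for k
    by (rule Stone_Weierstrass_real_polynomial_function[of "{a..b}" p "inverse (real (Suc k))"])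
      (use p in auto)
  then obtain q where q: "\<And>k. real_polynomial_function (q k)"
    "\<And>k x. x \<in> {a..b} \<Longrightarrow> \<bar>p x - q k x\<bar> < inverse (real (Suc k))" by metis
  define c where "c k = bump (a + inverse (real (Suc k))) (b - inverse (real (Suc k))) k" for k
  have c: "test_function {a<..<b} (c k)" for k
    unfolding c_def by (rule test_function_bump) auto
  have c01: "0 \<le> c k x" "c k x \<le> 1" for k x unfolding c_def by (auto simp: bump_bounds)
  define w where "w k x = q k x * c k x" for k x
  have w: "test_function {a<..<b} (w k)" for k
    unfolding w_def by (intro test_function_mult_smooth c smooth_on_polynomial q open_UNIV)
  have wlim: "(\<lambda>k. w k x) \<longlonglongrightarrow> p x" if x: "x \<in> {a<..<b}" for x
  proof -
    have "(\<lambda>k. p x - q k x) \<longlonglongrightarrow> 0"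
      by (rule Lim_null_comparison[OF _ LIMSEQ_inverse_real_of_nat])
        (use q(2)[of x] x in \<open>auto intro!: always_eventually less_imp_le\<close>)
    from tendsto_diff[OF tendsto_const[of "p x"] this] have "(\<lambda>k. q k x) \<longlonglongrightarrow> p x" by simp
    from tendsto_mult[OF this bump_exhaustion_tendsto[OF x]] show ?thesis
      by (simp add: w_def c_def)
  qed
  have wb: "\<bar>w k x\<bar> \<le> P + 1" if x: "x \<in> {a<..<b}" for k x
  proof -
    have "inverse (real (Suc k)) \<le> 1" by (simp add: inverse_le_1_iff)
    then have "\<bar>q k x\<bar> \<le> P + 1" using q(2)[of x k] P[of x] x by auto
    then show ?thesis using c01[of k x]
      by (auto simp: w_def abs_mult intro: order_trans[OF mult_left_le])
  qed
  \<comment> \<open>A fixed test function whose integral is not zero, to correct the mean values.\<close>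
  define \<rho>0 where "\<rho>0 = bump (a + (b - a) / 3) (b - (b - a) / 3) 0"
  have \<rho>0: "test_function {a<..<b} \<rho>0"
    unfolding \<rho>0_def by (rule test_function_bump) (use ab in auto)
  have \<rho>0i: "integrable ?M \<rho>0" by (intro L2_integrable has_weak_deriv_test_function(2) ab \<rho>0)
  have r: "(LINT x|?M. \<rho>0 x) \<noteq> 0"
  proof
    assume "(LINT x|?M. \<rho>0 x) = 0"
    then have "AE x in ?M. \<rho>0 x = 0"
      using integral_nonneg_eq_0_iff_AE[OF \<rho>0i] by (auto simp: \<rho>0_def bump_bounds)
    then have "AE x in lebesgue. x \<in> {a<..<b} \<longrightarrow> \<rho>0 x = 0"
      by (subst (asm) AE_restrict_space_iff) auto
    then have "AE x in lebesgue. x \<notin> {a + (b - a) / 3<..<b - (b - a) / 3}"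
    proof (eventually_elim, intro notI)
      fix x assume "x \<in> {a<..<b} \<longrightarrow> \<rho>0 x = 0" and x: "x \<in> {a + (b - a) / 3<..<b - (b - a) / 3}"
      moreover have "x \<in> {a<..<b}" using x ab by (auto simp: field_simps)
      ultimately show False using bump_pos[OF x, of 0] by (simp add: \<rho>0_def)
    qed
    then have "{a + (b - a) / 3<..<b - (b - a) / 3} \<in> null_sets lebesgue"
      by (simp add: completion.null_sets_iff_AE del: greaterThanLessThan_iff)
    then have "negligible (box (a + (b - a) / 3) (b - (b - a) / 3))"
      by (simp add: negligible_iff_null_sets)
    then have "box (a + (b - a) / 3) (b - (b - a) / 3) = {}"
      by (simp only: negligible_interval)
    then have "b - (b - a) / 3 \<le> a + (b - a) / 3"
      by simp
    then show False using ab by (simp add: field_simps)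
  qed
  define \<rho> where "\<rho> x = \<rho>0 x / (LINT x|?M. \<rho>0 x)" for x
  have \<rho>: "test_function {a<..<b} \<rho>"
    using test_function_mult_smooth[OF \<rho>0 smooth_on_const[OF open_UNIV, of "inverse (LINT x|?M. \<rho>0 x)"]]
    by (simp add: \<rho>_def[abs_def] divide_inverse mult.commute)
  have \<rho>i: "(LINT x|?M. \<rho> x) = 1" using r by (simp add: \<rho>_def)
  obtain R where R: "\<And>x. \<bar>\<rho> x\<bar> \<le> R" "0 \<le> R" using test_function_bounded[OF \<rho>] by blast
  have wi: "integrable ?M (w k)" for k by (intro L2_integrable has_weak_deriv_test_function(2) ab w)
  have \<rho>int: "integrable ?M \<rho>" by (intro L2_integrable has_weak_deriv_test_function(2) ab \<rho>)
  define m where "m k = (LINT x|?M. w k x)" for k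
  have pm: "p \<in> borel_measurable ?M" using continuous_on_Icc_L2[OF p] by (simp add: L2_def)
  have m: "m \<longlonglongrightarrow> 0"
  proof -
    have "(\<lambda>k. LINT x|?M. w k x) \<longlonglongrightarrow> (LINT x|?M. p x)"
      by (rule integral_dominated_convergence[where w="\<lambda>x. P + 1"])
        (use wlim wb wi pm in \<open>auto\<close>)
    then show ?thesis using zero by (simp add: m_def[abs_def])
  qed
  then obtain B where B: "\<And>k. \<bar>m k\<bar> \<le> B"
    using convergent_imp_Bseq[OF convergentI[OF m]] by (auto simp: Bseq_def)
  have B0: "0 \<le> B" using B[of 0] by auto
  define \<psi> where "\<psi> k x = w k x + - m k * \<rho> x" for k x
  have \<psi>: "test_function {a<..<b} (\<psi> k)" for k
    unfolding \<psi>_def by (intro test_function_add w test_function_mult_smooth \<rho> smooth_on_const open_UNIV)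
  have \<psi>0: "(LINT x|?M. \<psi> k x) = 0" for k
    unfolding \<psi>_def using wi \<rho>int \<rho>i by (simp add: m_def)
  have "(\<lambda>k. LINT x|?M. (p x - \<psi> k x)\<^sup>2) \<longlonglongrightarrow> (LINT x|?M. 0)"
  proof (rule integral_dominated_convergence[where w="\<lambda>x. (P + (P + 1) + B * R)\<^sup>2"])
    show "(\<lambda>x. (p x - \<psi> k x)\<^sup>2) \<in> borel_measurable ?M" for k
      using pm test_function_measurable[OF \<psi>, of "{a<..<b}"] by simp
    show "AE x in ?M. (\<lambda>k. (p x - \<psi> k x)\<^sup>2) \<longlonglongrightarrow> 0"
    proof (rule AE_I2)
      fix x assume "x \<in> space ?M"
      then have "(\<lambda>k. (p x - (w k x + - m k * \<rho> x))\<^sup>2) \<longlonglongrightarrow> (p x - (p x + - 0 * \<rho> x))\<^sup>2"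
        by (intro tendsto_intros wlim m) auto
      then show "(\<lambda>k. (p x - \<psi> k x)\<^sup>2) \<longlonglongrightarrow> 0" by (simp add: \<psi>_def)
    qed
    show "AE x in ?M. norm ((p x - \<psi> k x)\<^sup>2) \<le> (P + (P + 1) + B * R)\<^sup>2" for k
    proof (rule AE_I2)
      fix x assume x: "x \<in> space ?M"
      have "\<bar>m k * \<rho> x\<bar> \<le> B * R" unfolding abs_mult by (intro mult_mono B R B0) auto
      then have "\<bar>p x - \<psi> k x\<bar> \<le> P + (P + 1) + B * R"
        using wb[of x k] P[of x] x by (auto simp: \<psi>_def)
      from power_mono[OF this, of 2] show "norm ((p x - \<psi> k x)\<^sup>2) \<le> (P + (P + 1) + B * R)\<^sup>2"
        by simp
    qed
  qed auto
  then have "(\<lambda>k. LINT x|?M. (p x - \<psi> k x)\<^sup>2) \<longlonglongrightarrow> 0" by simp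
  then show ?thesis by (rule that[OF \<psi> \<psi>0])
qed

text \<open>
  The derivative is approximated by test functions of mean zero. Their primitives are test
  functions, and by the Poincare inequality they converge to the given function.
\<close>

lemma W012_if_continuous_deriv:
  assumes ab: "a < b" and F: "continuous_on {a..b} F" and F0: "F a = 0" "F b = 0"
    and p: "continuous_on {a..b} p" and Z: "finite Z"
    and deriv: "\<And>x. x \<in> {a<..<b} - Z \<Longrightarrow> (F has_real_derivative p x) (at x)"
    and u: "AE x in lebesgue_on {a<..<b}. F x = u x"
  shows "u \<in> W012 {a<..<b}"
proof -
  have p2: "p \<in> L2 {a<..<b}" by (rule continuous_on_Icc_L2[OF p])
  have "(p has_integral F b - F a) {a..b}"
    by (rule fundamental_theorem_of_calculus_interior_strong[OF Z])
      (use ab F deriv in \<open>auto simp: has_real_derivative_iff_has_vector_derivative\<close>)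
  then have "(LINT x|lebesgue_on {a<..<b}. p x) = 0"
    using F0 by (subst lebesgue_integral_eq_integral)
      (auto simp: L2_integrable p2 integral_open_interval_real[symmetric] integral_unique)
  from continuous_approx_by_test_functions[OF ab p this] obtain \<psi> where \<psi>:
    "\<And>k::nat. test_function {a<..<b} (\<psi> k)" "\<And>k. (LINT x|lebesgue_on {a<..<b}. \<psi> k x) = 0"
    "(\<lambda>k. LINT x|lebesgue_on {a<..<b}. (p x - \<psi> k x)\<^sup>2) \<longlonglongrightarrow> 0" by blast
  have "\<exists>\<phi>. test_function {a<..<b} \<phi> \<and> (\<forall>x. (\<phi> has_real_derivative \<psi> k x) (at x))" for k
    using test_function_primitive[OF ab \<psi>(1,2)] by metis
  then obtain \<phi> where \<phi>: "\<And>k. test_function {a<..<b} (\<phi> k)"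
    "\<And>k x. (\<phi> k has_real_derivative \<psi> k x) (at x)" by metis
  have bound: "W12_norm {a<..<b} (\<lambda>x. u x - \<phi> k x) \<le>
      sqrt (((b - a)\<^sup>2 + 1) * (LINT x|lebesgue_on {a<..<b}. (p x - \<psi> k x)\<^sup>2))" for k
  proof (rule W12_norm_le_deriv[OF ab, of "\<lambda>x. F x - \<phi> k x" Z])
    have "\<phi> k a = 0" using \<phi>(1)[of k] unfolding test_function_interval_iff by force
    then show "F a - \<phi> k a = 0" using F0 by simp
    show "continuous_on {a..b} (\<lambda>x. F x - \<phi> k x)"
      by (intro continuous_intros F test_function_continuous[OF \<phi>(1)])
    show "(\<lambda>x. p x - \<psi> k x) \<in> L2 {a<..<b}"
      by (intro L2_diff p2 has_weak_deriv_test_function(2)[OF ab \<psi>(1)])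
    show "AE x in lebesgue_on {a<..<b}. F x - \<phi> k x = u x - \<phi> k x" using u by auto
    show "((\<lambda>x. F x - \<phi> k x) has_real_derivative p x - \<psi> k x) (at x)" if "x \<in> {a<..<b} - Z" for x
      using that by (intro DERIV_diff deriv \<phi>(2)) simp
  qed (rule Z)
  have "(\<lambda>k. sqrt (((b - a)\<^sup>2 + 1) * (LINT x|lebesgue_on {a<..<b}. (p x - \<psi> k x)\<^sup>2))) \<longlonglongrightarrow>
      sqrt (((b - a)\<^sup>2 + 1) * 0)"
    by (intro tendsto_intros \<psi>)
  then have lim: "(\<lambda>k. sqrt (((b - a)\<^sup>2 + 1) * (LINT x|lebesgue_on {a<..<b}. (p x - \<psi> k x)\<^sup>2))) \<longlonglongrightarrow> 0"
    by simp
  have "(\<lambda>k. W12_norm {a<..<b} (\<lambda>x. u x - \<phi> k x)) \<longlonglongrightarrow> 0"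
    using bound W12_norm_nonneg[of "{a<..<b}"]
    by (intro Lim_null_comparison[OF _ lim]) (simp add: always_eventually)
  moreover have "u \<in> W12 {a<..<b}"
    by (rule has_weak_deriv_piecewise(2)[OF ab F Z _ p2 u]) (rule deriv)
  ultimately show ?thesis unfolding W012_def using \<phi>(1) by blast
qed

section \<open>Representatives and integration by parts in the Sobolev space\<close>

lemma W012_subset_W12: "u \<in> W012 S \<Longrightarrow> u \<in> W12 S"
  by (simp add: W012_def)

lemma W012_L2:
  assumes "u \<in> W012 {a<..<b}"
  shows "u \<in> L2 {a<..<b}" "weak_deriv {a<..<b} u \<in> L2 {a<..<b}"
  using W012_subset_W12[OF assms] weak_deriv_W12(2) by (auto simp: W12_def)

text \<open>
  On a bounded interval the mean square norm dominates the mean, so the defining approximation holds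
  in the mean as well. This is the form in which limits can be taken against bounded functions.
\<close>

lemma W012_approx:
  assumes ab: "a < b" and u: "u \<in> W012 {a<..<b}"
  obtains \<phi> where "\<And>k::nat. test_function {a<..<b} (\<phi> k)"
    "(\<lambda>k. LINT x|lebesgue_on {a<..<b}. \<bar>u x - \<phi> k x\<bar>) \<longlonglongrightarrow> 0"
    "(\<lambda>k. LINT x|lebesgue_on {a<..<b}. \<bar>weak_deriv {a<..<b} u x - deriv (\<phi> k) x\<bar>) \<longlonglongrightarrow> 0"
proof -
  let ?M = "lebesgue_on {a<..<b}" and ?g = "weak_deriv {a<..<b} u"
  obtain \<phi> where \<phi>: "\<And>k::nat. test_function {a<..<b} (\<phi> k)"
    and lim: "(\<lambda>k. W12_norm {a<..<b} (\<lambda>x. u x - \<phi> k x)) \<longlonglongrightarrow> 0"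
    using u unfolding W012_def by blast
  define N where "N k = W12_norm {a<..<b} (\<lambda>x. u x - \<phi> k x)" for k
  note \<phi>2 = has_weak_deriv_test_function[OF ab \<phi>]
  have d2: "(\<lambda>x. u x - \<phi> k x) \<in> L2 {a<..<b}" "(\<lambda>x. ?g x - deriv (\<phi> k) x) \<in> L2 {a<..<b}" for k
    using W012_L2[OF u] \<phi>2 by (auto intro: L2_diff)
  have sq: "(N k)\<^sup>2 = (LINT x|?M. (u x - \<phi> k x)\<^sup>2) + (LINT x|?M. (?g x - deriv (\<phi> k) x)\<^sup>2)" for k
  proof -
    have "has_weak_deriv {a<..<b} (\<lambda>x. u x - \<phi> k x) (\<lambda>x. ?g x - deriv (\<phi> k) x)"
      by (intro has_weak_deriv_diff weak_deriv_W12 W012_subset_W12 u \<phi>2) simp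
    from integral_weak_deriv_sq[OF this d2(2)] show ?thesis
      unfolding N_def W12_norm_def
      by (subst real_sqrt_pow2) (auto intro!: add_nonneg_nonneg Bochner_Integration.integral_nonneg)
  qed
  have bound: "(LINT x|?M. \<bar>f x\<bar>) \<le> sqrt (b - a) * N k"
    if f: "f \<in> L2 {a<..<b}" and le: "(LINT x|?M. (f x)\<^sup>2) \<le> (N k)\<^sup>2" for f k
  proof (rule power2_le_imp_le)
    have "(LINT x|?M. \<bar>f x\<bar>)\<^sup>2 \<le> (b - a) * (LINT x|?M. (f x)\<^sup>2)" by (rule L1_le_L2[OF ab f])
    also have "\<dots> \<le> (b - a) * (N k)\<^sup>2" by (intro mult_left_mono le) (use ab in auto)
    finally show "(LINT x|?M. \<bar>f x\<bar>)\<^sup>2 \<le> (sqrt (b - a) * N k)\<^sup>2"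
      using ab by (simp add: power_mult_distrib)
    show "0 \<le> sqrt (b - a) * N k" using ab by (simp add: N_def W12_norm_nonneg)
  qed
  have N0: "(\<lambda>k. sqrt (b - a) * N k) \<longlonglongrightarrow> 0"
    using tendsto_mult[OF tendsto_const lim, of "sqrt (b - a)"] by (simp add: N_def)
  have nn: "0 \<le> (LINT x|?M. (f x)\<^sup>2)" for f :: "real \<Rightarrow> real" by simp
  show ?thesis
  proof (rule that[OF \<phi>])
    have "(LINT x|?M. (u x - \<phi> k x)\<^sup>2) \<le> (N k)\<^sup>2" "(LINT x|?M. (?g x - deriv (\<phi> k) x)\<^sup>2) \<le> (N k)\<^sup>2" for k
      using sq[of k] nn[of "\<lambda>x. u x - \<phi> k x"] nn[of "\<lambda>x. ?g x - deriv (\<phi> k) x"] by linarith+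
    note b = bound[OF d2(1) this(1)] bound[OF d2(2) this(2)]
    show "(\<lambda>k. LINT x|?M. \<bar>u x - \<phi> k x\<bar>) \<longlonglongrightarrow> 0"
      by (rule Lim_null_comparison[OF _ N0]) (use b(1) in \<open>simp add: always_eventually\<close>)
    show "(\<lambda>k. LINT x|?M. \<bar>?g x - deriv (\<phi> k) x\<bar>) \<longlonglongrightarrow> 0"
      by (rule Lim_null_comparison[OF _ N0]) (use b(2) in \<open>simp add: always_eventually\<close>)
  qed
qed

lemma tendsto_integral_bounded_mult:
  fixes f :: "'a \<Rightarrow> real"
  assumes f: "integrable M f" and fk: "\<And>k::nat. integrable M (\<phi> k)"
    and w: "w \<in> borel_measurable M" and wC: "\<And>x. x \<in> space M \<Longrightarrow> \<bar>w x\<bar> \<le> C"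
    and lim: "(\<lambda>k. LINT x|M. \<bar>f x - \<phi> k x\<bar>) \<longlonglongrightarrow> 0"
  shows "(\<lambda>k. LINT x|M. w x * \<phi> k x) \<longlonglongrightarrow> (LINT x|M. w x * f x)"
proof -
  note im = integrable_mult_bounded[OF _ w wC, unfolded mult.commute[of _ "w _"]]
  have C0: "(\<lambda>k. C * (LINT x|M. \<bar>f x - \<phi> k x\<bar>)) \<longlonglongrightarrow> 0"
    using tendsto_mult[OF tendsto_const lim, of C] by simp
  have bound: "\<bar>(LINT x|M. w x * \<phi> k x) - (LINT x|M. w x * f x)\<bar> \<le> C * (LINT x|M. \<bar>f x - \<phi> k x\<bar>)" for k
  proof -
    have "(LINT x|M. w x * \<phi> k x) - (LINT x|M. w x * f x) = (LINT x|M. w x * (\<phi> k x - f x))"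
      unfolding right_diff_distrib using im[OF f] im[OF fk] by simp
    also have "\<bar>\<dots>\<bar> \<le> (LINT x|M. \<bar>w x * (\<phi> k x - f x)\<bar>)"
      using integral_norm_bound[of M "\<lambda>x. w x * (\<phi> k x - f x)"] by simp
    also have "\<dots> \<le> (LINT x|M. C * \<bar>f x - \<phi> k x\<bar>)"
    proof (rule Bochner_Integration.integral_mono)
      show "integrable M (\<lambda>x. \<bar>w x * (\<phi> k x - f x)\<bar>)"
        by (intro integrable_abs im Bochner_Integration.integrable_diff f fk)
      show "integrable M (\<lambda>x. C * \<bar>f x - \<phi> k x\<bar>)"
        using f fk by (intro integrable_mult_right integrable_abs Bochner_Integration.integrable_diff)
      show "\<bar>w x * (\<phi> k x - f x)\<bar> \<le> C * \<bar>f x - \<phi> k x\<bar>" if "x \<in> space M" for x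
        using mult_right_mono[OF wC[OF that], of "\<bar>f x - \<phi> k x\<bar>"]
        by (simp add: abs_mult abs_minus_commute)
    qed
    finally show ?thesis by simp
  qed
  have "(\<lambda>k. (LINT x|M. w x * \<phi> k x) - (LINT x|M. w x * f x)) \<longlonglongrightarrow> 0"
    by (rule Lim_null_comparison[OF _ C0]) (use bound in \<open>simp add: always_eventually\<close>)
  then show ?thesis using LIM_zero_iff by blast
qed

text \<open>
  The formula holds for test functions by the fundamental theorem of calculus, and both sides are
  continuous along an approximating sequence.
\<close>

lemma W012_integral_by_parts:
  assumes ab: "a < b" and u: "u \<in> W012 {a<..<b}"
    and w: "continuous_on {a..b} w" and Z: "finite Z"
    and deriv: "\<And>x. x \<in> {a<..<b} - Z \<Longrightarrow> (w has_real_derivative w' x) (at x)"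
    and w': "w' \<in> borel_measurable (lebesgue_on {a<..<b})" "\<And>x. x \<in> {a<..<b} \<Longrightarrow> \<bar>w' x\<bar> \<le> C"
  shows "(LINT x|lebesgue_on {a<..<b}. w x * weak_deriv {a<..<b} u x) = - (LINT x|lebesgue_on {a<..<b}. w' x * u x)"
proof -
  let ?M = "lebesgue_on {a<..<b}" and ?g = "weak_deriv {a<..<b} u"
  obtain \<phi> where \<phi>: "\<And>k::nat. test_function {a<..<b} (\<phi> k)"
    and lim: "(\<lambda>k. LINT x|?M. \<bar>u x - \<phi> k x\<bar>) \<longlonglongrightarrow> 0" "(\<lambda>k. LINT x|?M. \<bar>?g x - deriv (\<phi> k) x\<bar>) \<longlonglongrightarrow> 0"
    using W012_approx[OF ab u] by blast
  note \<phi>2 = has_weak_deriv_test_function(2,3)[OF ab \<phi>, THEN L2_integrable]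
  note u2 = W012_L2[OF u, THEN L2_integrable]
  have "bounded (w ` {a..b})"
    by (intro compact_imp_bounded compact_continuous_image w) auto
  then obtain B where "\<forall>y\<in>w ` {a..b}. norm y \<le> B" unfolding bounded_iff by blast
  then have B: "\<bar>w x\<bar> \<le> B" if "x \<in> space ?M" for x using that by auto
  have wm: "w \<in> borel_measurable ?M" using continuous_on_Icc_L2[OF w] by (simp add: L2_def)
  have "(\<lambda>k. LINT x|?M. w x * deriv (\<phi> k) x) \<longlonglongrightarrow> (LINT x|?M. w x * ?g x)"
    by (rule tendsto_integral_bounded_mult[OF u2(2) \<phi>2(2) wm B lim(2)])
  moreover have "(\<lambda>k. LINT x|?M. w' x * \<phi> k x) \<longlonglongrightarrow> (LINT x|?M. w' x * u x)"
    by (rule tendsto_integral_bounded_mult[OF u2(1) \<phi>2(1) w'(1) _ lim(1)]) (use w' in auto)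
  from tendsto_minus[OF this]
  have "(\<lambda>k. LINT x|?M. w x * deriv (\<phi> k) x) \<longlonglongrightarrow> - (LINT x|?M. w' x * u x)"
    using integral_by_parts_test_function[OF ab w Z deriv L2_integrable[OF bounded_imp_L2[OF w']] \<phi>] by simp
  ultimately show ?thesis by (rule LIMSEQ_unique)
qed

text \<open>
  An approximating test function is the primitive of its derivative, and primitives depend uniformly
  on the integrand in the mean. In the limit this gives a continuous representative that vanishes
  at both end points.
\<close>

lemma W012_AE_primitive:
  assumes ab: "a < b" and u: "u \<in> W012 {a<..<b}"
  shows "AE x in lebesgue_on {a<..<b}. integral {a..x} (weak_deriv {a<..<b} u) = u x"
    and "integral {a..b} (weak_deriv {a<..<b} u) = 0"
    and "continuous_on {a..b} (\<lambda>x. integral {a..x} (weak_deriv {a<..<b} u))"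
proof -
  let ?M = "lebesgue_on {a<..<b}" and ?g = "weak_deriv {a<..<b} u"
  define R where "R x = integral {a..x} ?g" for x
  interpret finite_measure ?M by (rule finite_measure_lebesgue_on_Ioo)
  obtain \<phi> where \<phi>: "\<And>k::nat. test_function {a<..<b} (\<phi> k)"
    and lim: "(\<lambda>k. LINT x|?M. \<bar>u x - \<phi> k x\<bar>) \<longlonglongrightarrow> 0" "(\<lambda>k. LINT x|?M. \<bar>?g x - deriv (\<phi> k) x\<bar>) \<longlonglongrightarrow> 0"
    using W012_approx[OF ab u] by blast
  note \<phi>2 = has_weak_deriv_test_function(2,3)[OF ab \<phi>, THEN L2_integrable]
  note u2 = W012_L2[OF u, THEN L2_integrable]
  define e where "e k = (LINT x|?M. \<bar>?g x - deriv (\<phi> k) x\<bar>)" for k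
  have g: "?g integrable_on {a..b}"
    using integrable_on_lebesgue_on[OF u2(2)] by (simp add: integrable_on_Icc_iff_Ioo)
  then show cont: "continuous_on {a..b} (\<lambda>x. integral {a..x} ?g)"
    by (rule indefinite_integral_continuous_1)
  have dist: "\<bar>R x - \<phi> k x\<bar> \<le> e k" if x: "x \<in> {a..b}" for k x
  proof -
    let ?d = "\<lambda>x. ?g x - deriv (\<phi> k) x"
    have id: "integrable ?M (\<lambda>x. \<bar>?d x\<bar>)" using u2(2) \<phi>2(2) by auto
    have "\<phi> k a = 0" using \<phi>[of k] unfolding test_function_interval_iff by force
    then have "(deriv (\<phi> k) has_integral \<phi> k x) {a..x}"
      using fundamental_theorem_of_calculus[of a x "\<phi> k" "deriv (\<phi> k)"] x
        test_function_has_deriv[OF \<phi>, of k]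
      by (auto simp: has_real_derivative_iff_has_vector_derivative has_vector_derivative_at_within)
    moreover have gx: "(?g has_integral R x) {a..x}"
      unfolding R_def by (rule integrable_integral[OF integrable_subinterval_real[OF g]]) (use x in auto)
    ultimately have dx: "(?d has_integral R x - \<phi> k x) {a..x}"
      by (intro has_integral_diff)
    have i': "(\<lambda>x. \<bar>?d x\<bar>) integrable_on {a..b}"
      using integrable_on_lebesgue_on[OF id] by (simp add: integrable_on_Icc_iff_Ioo)
    then have i'': "(\<lambda>x. \<bar>?d x\<bar>) integrable_on {a..x}"
      by (rule integrable_subinterval_real) (use x in auto)
    have "norm (integral {a..x} ?d) \<le> integral {a..x} (\<lambda>x. \<bar>?d x\<bar>)"
      by (rule integral_norm_bound_integral) (use dx i'' in \<open>auto simp: has_integral_integrable\<close>)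
    also have "\<dots> \<le> integral {a..b} (\<lambda>x. \<bar>?d x\<bar>)"
      by (rule integral_subset_le) (use x i' i'' in auto)
    also have "\<dots> = e k"
      unfolding e_def by (subst lebesgue_integral_eq_integral[OF id]) (auto simp: integral_open_interval_real)
    finally show ?thesis using integral_unique[OF dx] by simp
  qed
  have e0: "e \<longlonglongrightarrow> 0" using lim(2) by (simp add: e_def[abs_def])
  have "\<phi> k b = 0" for k using \<phi>[of k] unfolding test_function_interval_iff by force
  then have "\<bar>R b\<bar> \<le> e k" for k using dist[of b k] ab by simp
  then have "\<bar>R b\<bar> \<le> 0" by (intro LIMSEQ_le_const[OF e0]) auto
  then show "integral {a..b} ?g = 0" by (simp add: R_def)
  have Ri: "integrable ?M R"
    using L2_integrable[OF continuous_on_Icc_L2[OF cont]] by (simp add: R_def[abs_def])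
  have "(LINT x|?M. \<bar>R x - u x\<bar>) \<le> e k * (b - a) + (LINT x|?M. \<bar>u x - \<phi> k x\<bar>)" for k
  proof -
    have "(LINT x|?M. \<bar>R x - u x\<bar>) \<le> (LINT x|?M. e k + \<bar>u x - \<phi> k x\<bar>)"
    proof (rule Bochner_Integration.integral_mono)
      show "\<bar>R x - u x\<bar> \<le> e k + \<bar>u x - \<phi> k x\<bar>" if "x \<in> space ?M" for x
        using dist[of x k] that by auto
    qed (use Ri u2 \<phi>2 in auto)
    also have "\<dots> = e k * (b - a) + (LINT x|?M. \<bar>u x - \<phi> k x\<bar>)"
      using u2 \<phi>2 ab by (simp add: measure_restrict_space)
    finally show ?thesis .
  qed
  moreover have "(\<lambda>k. e k * (b - a) + (LINT x|?M. \<bar>u x - \<phi> k x\<bar>)) \<longlonglongrightarrow> 0 * (b - a) + 0"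
    by (intro tendsto_intros e0 lim(1))
  ultimately have "(LINT x|?M. \<bar>R x - u x\<bar>) \<le> 0 * (b - a) + 0"
    by (intro LIMSEQ_le_const) auto
  moreover have "0 \<le> (LINT x|?M. \<bar>R x - u x\<bar>)" by simp
  ultimately have "(LINT x|?M. \<bar>R x - u x\<bar>) = 0" by simp
  then have "AE x in ?M. \<bar>R x - u x\<bar> = 0"
    using integral_nonneg_eq_0_iff_AE[of ?M "\<lambda>x. \<bar>R x - u x\<bar>"] Ri u2 by auto
  then show "AE x in ?M. integral {a..x} ?g = u x" by (simp add: R_def)
qed

lemma L2_mult_integrable:
  assumes "f \<in> L2 S" "g \<in> L2 S"
  shows "integrable (lebesgue_on S) (\<lambda>x. f x * g x)"
proof (rule Bochner_Integration.integrable_bound[of _ "\<lambda>x. (f x)\<^sup>2 + (g x)\<^sup>2"])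
  have "\<bar>s * t\<bar> \<le> s\<^sup>2 + t\<^sup>2" for s t :: real
    using zero_le_power2[of "\<bar>s\<bar> - \<bar>t\<bar>"] abs_ge_zero[of "s * t"]
    unfolding abs_mult power2_diff power2_abs by linarith
  then show "AE x in lebesgue_on S. norm (f x * g x) \<le> norm ((f x)\<^sup>2 + (g x)\<^sup>2)"
    by (intro AE_I2) (simp add: abs_of_nonneg)
qed (use assms in \<open>auto simp: L2_def\<close>)

lemma AE_lebesgue_on_negligible:
  assumes "AE x in lebesgue_on S. P x" "S \<in> sets lebesgue"
  shows "negligible {x \<in> S. \<not> P x}"
proof -
  have "AE x in lebesgue. x \<in> S \<longrightarrow> P x"
    using assms by (subst (asm) AE_restrict_space_iff) auto
  then show ?thesis by (simp add: completion.AE_iff_null_sets negligible_iff_null_sets)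
qed

text \<open>
  A nonempty open set is not negligible.
\<close>

lemma continuous_AE_ge_imp_ge:
  fixes R :: "real \<Rightarrow> real"
  assumes R: "continuous_on {p<..<q} R" and ae: "AE x in lebesgue_on {p<..<q}. c \<le> R x"
    and x: "x \<in> {p<..<q}"
  shows "c \<le> R x"
proof (rule ccontr)
  assume "\<not> c \<le> R x"
  let ?A = "{p<..<q} \<inter> R -` {..<c}"
  have "open ?A" by (intro continuous_open_preimage R) auto
  moreover have "negligible ?A"
    by (rule negligible_subset[OF AE_lebesgue_on_negligible[OF ae]]) auto
  ultimately have "?A = {}" using open_not_negligible by blast
  then show False using \<open>\<not> c \<le> R x\<close> x by auto
qed

section \<open>Regularity of the weak solution of the singular problem\<close>

lemma const_fun_L2: "(\<lambda>x. c) \<in> L2 {a<..<b}"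
  by (rule continuous_on_Icc_L2) simp

text \<open>
  Let \<open>g\<close> be the weak derivative of \<open>u\<close>, let \<open>R\<close> be the continuous representative of \<open>u\<close>, and let \<open>H\<close> be
  a primitive of the right-hand side \<open>h\<close>. Integrating by parts, the equation says that \<open>g + H\<close> is
  orthogonal to the weak derivative of every admissible \<open>\<phi>\<close>; so is every constant. Choose \<open>c\<close> as the
  mean of \<open>H\<close>. Then \<open>g\<close> and \<open>H - c\<close> are themselves derivatives of admissible functions, namely of \<open>u\<close>
  and of the primitive \<open>K\<close> of \<open>H - c\<close>. Hence \<open>g + H - c\<close> is orthogonal to itself, and \<open>g = c - H\<close>. As \<open>H\<close> is
  continuous, and differentiable wherever \<open>h\<close> is continuous, the solution is classical.
\<close>

lemma singular_weak_solution_regularity: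
  assumes sol: "singular_weak_solution n u"
  obtains U G where
    "AE x in lebesgue_on {-2<..<2}. U x = u x"
    "continuous_on {-2..2} U" "U (-2) = 0" "U 2 = 0"
    "\<And>t. t \<in> {-2<..<2} \<Longrightarrow> 0 < U t"
    "\<And>t. t \<in> {-2..2} \<Longrightarrow> (U has_real_derivative G t) (at t within {-2..2})"
    "\<And>t. t \<in> {-1..1} \<Longrightarrow> (G has_real_derivative - (1 / U t ^ n)) (at t within {-1..1})"
    "\<And>t. t \<le> -1 \<Longrightarrow> G t = G (-1)" "\<And>t. 1 \<le> t \<Longrightarrow> G t = G 1"
    "continuous_on UNIV G"
proof -
  let ?S = "{-2<..<2::real}" and ?M = "lebesgue_on {-2<..<2::real}"
  let ?g = "weak_deriv ?S u"
  have u: "u \<in> W012 ?S"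
    and pos: "\<And>K. compact K \<Longrightarrow> K \<subseteq> ?S \<Longrightarrow> \<exists>c>0. AE x in lebesgue_on K. c \<le> u x"
    and eq: "\<And>\<phi>. \<phi> \<in> W012 ?S \<Longrightarrow> (LINT x|?M. ?g x * weak_deriv ?S \<phi> x) = (LINT x|lebesgue_on {-1<..<1}. \<phi> x / u x ^ n)"
    using sol unfolding singular_weak_solution_def by auto
  have ab: "(-2::real) < 2" by simp
  define R where "R x = integral {-2..x} ?g" for x
  have Ru: "AE x in ?M. R x = u x" and R2: "R 2 = 0" and Rc: "continuous_on {-2..2} R"
    using W012_AE_primitive[OF ab u] by (simp_all add: R_def[abs_def])
  have Rpos: "0 < R x" if x: "x \<in> ?S" for x
  proof -
    \<comment> \<open>The midpoints between \<open>x\<close> and the two end points.\<close>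
    define p q where "p = (x - 2) / 2" and "q = (x + 2) / 2"
    have pq: "-2 < p" "p < x" "x < q" "q < 2" using x by (auto simp: p_def q_def)
    have "{p..q} \<subseteq> ?S" using pq by auto
    then obtain c where c: "c > 0" "AE x in lebesgue_on {p..q}. c \<le> u x"
      using pos[OF compact_Icc] by blast
    have "AE x in lebesgue. x \<in> {p..q} \<longrightarrow> c \<le> u x" "AE x in lebesgue. x \<in> ?S \<longrightarrow> R x = u x"
      using c(2) Ru by (subst (asm) (1 2) AE_restrict_space_iff, auto)+
    then have "AE x in lebesgue. x \<in> {p<..<q} \<longrightarrow> c \<le> R x"
      by eventually_elim (use pq in auto)
    then have "AE x in lebesgue_on {p<..<q}. c \<le> R x"
      by (subst AE_restrict_space_iff) auto
    then have "c \<le> R x"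
      by (intro continuous_AE_ge_imp_ge[of p q R c x] continuous_on_subset[OF Rc]) (use pq in auto)
    then show ?thesis using c(1) by linarith
  qed
  define h where "h x = (if x \<in> {-1<..<1} then 1 / R x ^ n else 0)" for x
  \<comment> \<open>Clamping the upper limit makes \<open>H\<close> constant outside \<open>[-1, 1]\<close>, where \<open>h\<close> vanishes.\<close>
  define H where "H t = integral {-1..max (-1) (min 1 t)} (\<lambda>x. 1 / R x ^ n)" for t
  have r: "continuous_on {-1..1} (\<lambda>x. 1 / R x ^ n)"
  proof (intro continuous_intros continuous_on_subset[OF Rc] ballI)
    fix x :: real assume "x \<in> {-1..1}"
    then show "R x ^ n \<noteq> 0" using Rpos[of x] by auto
  qed auto
  have H_deriv: "(H has_real_derivative 1 / R t ^ n) (at t within {-1..1})" if t: "t \<in> {-1..1}" for t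
  proof -
    have "((\<lambda>t. integral {-1..t} (\<lambda>x. 1 / R x ^ n)) has_real_derivative 1 / R t ^ n) (at t within {-1..1})"
      by (rule integral_has_real_derivative[OF r t])
    then show ?thesis
      by (rule has_field_derivative_transform_within[OF _ zero_less_one t]) (auto simp: H_def)
  qed
  have H_left: "H t = 0" if "t \<le> -1" for t using that by (simp add: H_def)
  have H_right: "H t = H 1" if "1 \<le> t" for t using that by (simp add: H_def)
  have H_cont: "continuous_on UNIV H"
  proof -
    have "continuous_on UNIV ((\<lambda>t. integral {-1..t} (\<lambda>x. 1 / R x ^ n)) \<circ> (\<lambda>t. max (-1) (min 1 t)))"
      by (rule continuous_on_compose)
        (auto intro!: continuous_intros continuous_on_subset[OF indefinite_integral_continuous_1[of _ _ 1]]
          integrable_continuous_real r)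
    then show ?thesis by (simp add: H_def[abs_def] o_def)
  qed
  have H_deriv': "(H has_real_derivative h t) (at t)" if t: "t \<in> ?S - {-1, 1}" for t
  proof -
    consider "t < -1" | "t \<in> {-1<..<1}" | "1 < t" using t by force
    then show ?thesis
    proof cases
      case 1
      have "(H has_real_derivative 0) (at t)"
        by (rule has_field_derivative_transform_within_open[of "\<lambda>x. 0" _ _ "{..<-1}"])
          (use 1 H_left in auto)
      then show ?thesis using 1 by (simp add: h_def)
    next
      case 2
      then show ?thesis using H_deriv[of t] by (simp add: h_def at_within_Icc_at)
    next
      case 3
      have "H 1 = H y" if "y \<in> {1<..}" for y using H_right[of y] that by simp
      then have "(H has_real_derivative 0) (at t)"
        by (rule has_field_derivative_transform_within_open[of "\<lambda>x. H 1" _ _ "{1<..}", rotated 3])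
          (use 3 in auto)
      then show ?thesis using 3 by (simp add: h_def)
    qed
  qed
  have h_meas: "h \<in> borel_measurable ?M"
  proof -
    have m: "(\<lambda>x. 1 / R x ^ n) \<in> borel_measurable (lebesgue_on {-1<..<1})"
      by (rule continuous_imp_measurable_on_sets_lebesgue[OF continuous_on_subset[OF r]]) auto
    show ?thesis
      unfolding h_def[abs_def] by (rule iffD2[OF borel_measurable_if_lebesgue_on m]) auto
  qed
  obtain C where hC: "\<And>x. x \<in> ?S \<Longrightarrow> \<bar>h x\<bar> \<le> C"
  proof -
    have "bounded ((\<lambda>x. 1 / R x ^ n) ` {-1..1})"
      by (intro compact_imp_bounded compact_continuous_image r) auto
    then obtain C where C: "\<forall>y\<in>(\<lambda>x. 1 / R x ^ n) ` {-1..1}. norm y \<le> C" unfolding bounded_iff by blast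
    have "\<bar>h x\<bar> \<le> max C 0" for x
    proof (cases "x \<in> {-1<..<1}")
      case True
      then have "norm (1 / R x ^ n) \<le> C" by (intro bspec[OF C] imageI) auto
      then have "\<bar>h x\<bar> \<le> C" unfolding h_def real_norm_def if_P[OF True] .
      then show ?thesis by linarith
    qed (auto simp: h_def)
    then show ?thesis using that by blast
  qed
  \<comment> \<open>The equation with \<open>u\<close> replaced by its continuous representative.\<close>
  have weak: "(LINT x|?M. ?g x * weak_deriv ?S \<phi> x) = (LINT x|?M. h x * \<phi> x)" if \<phi>: "\<phi> \<in> W012 ?S" for \<phi>
  proof -
    have sub: "AE x in lebesgue_on {-1<..<1}. R x = u x"
    proof -
      have "AE x in lebesgue. x \<in> ?S \<longrightarrow> R x = u x"
        using Ru by (subst (asm) AE_restrict_space_iff) auto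
      then have "AE x in lebesgue. x \<in> {-1<..<1} \<longrightarrow> R x = u x" by eventually_elim auto
      then show ?thesis by (subst AE_restrict_space_iff) auto
    qed
    have m: "f \<in> borel_measurable (lebesgue_on {-1<..<1})" if "f \<in> L2 ?S" for f
    proof -
      have "{-1<..<1} \<subseteq> ?S" by auto
      from integrable_lebesgue_on_subset[OF L2_integrable[OF that] this]
      show ?thesis by simp
    qed
    have "(LINT x|lebesgue_on {-1<..<1}. \<phi> x / u x ^ n) = (LINT x|lebesgue_on {-1<..<1}. \<phi> x / R x ^ n)"
      by (rule integral_cong_AE)
        (use sub m W012_L2(1)[OF u] W012_L2(1)[OF \<phi>] continuous_on_Icc_L2[OF Rc] in auto)
    also have "\<dots> = (LINT x|?M. (if x \<in> {-1<..<1} then \<phi> x / R x ^ n else 0))"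
    proof (rule Lebesgue_Measure.integral_restrict[symmetric])
      show "{-1<..<1} \<subseteq> ?S" by auto
    qed auto
    also have "\<dots> = (LINT x|?M. h x * \<phi> x)"
      by (rule Bochner_Integration.integral_cong) (auto simp: h_def)
    finally show ?thesis using eq[OF \<phi>] by simp
  qed
  have Hc: "continuous_on {-2..2} H" by (rule continuous_on_subset[OF H_cont]) simp
  define c where "c = integral {-2..2} H / 4"
  define K where "K t = integral {-2..t} (\<lambda>x. H x - c)" for t
  have Kcc: "continuous_on {-2..2} (\<lambda>x. H x - c)" by (intro continuous_intros Hc)
  have K_deriv: "(K has_real_derivative H t - c) (at t within {-2..2})" if "t \<in> {-2..2}" for t
    unfolding K_def[abs_def] by (rule integral_has_real_derivative[OF Kcc that])
  have Kc: "continuous_on {-2..2} K"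
    by (rule DERIV_continuous_on) (rule K_deriv)
  have K_deriv': "(K has_real_derivative H t - c) (at t)" if "t \<in> ?S" for t
    using K_deriv[of t] that by (simp add: at_within_Icc_at)
  have "integral {-2..2} (\<lambda>x. H x - c) = integral {-2..2} H - c * 4"
    by (subst Henstock_Kurzweil_Integration.integral_diff) (auto intro!: integrable_continuous_real Hc)
  then have K2: "K 2 = 0" by (simp add: K_def c_def)
  have Kzero: "K (-2) = 0" by (simp add: K_def)
  have KW: "K \<in> W012 ?S"
    by (rule W012_if_continuous_deriv[OF ab Kc Kzero K2 Kcc finite.emptyI]) (simp_all add: K_deriv')
  have Kd: "AE x in ?M. weak_deriv ?S K x = H x - c"
    by (rule weak_deriv_AE_eq[OF has_weak_deriv_piecewise(1)[OF ab Kc finite.emptyI _ continuous_on_Icc_L2[OF Kcc]]])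
      (use K_deriv' in auto)
  have H2: "H \<in> L2 ?S" "(\<lambda>x. H x - c) \<in> L2 ?S" by (intro continuous_on_Icc_L2 Hc Kcc)+
  note g2 = W012_L2(2)[OF u]
  have orth: "(LINT x|?M. (?g x + (H x - c)) * weak_deriv ?S \<phi> x) = 0" if \<phi>: "\<phi> \<in> W012 ?S" for \<phi>
  proof -
    note \<phi>2 = W012_L2(2)[OF \<phi>]
    have 1: "(LINT x|?M. H x * weak_deriv ?S \<phi> x) = - (LINT x|?M. h x * \<phi> x)"
      by (rule W012_integral_by_parts[where Z="{-1, 1}", OF ab \<phi> Hc _ H_deriv' h_meas hC]) simp_all
    have "(LINT x|?M. 1 * weak_deriv ?S \<phi> x) = - (LINT x|?M. 0 * \<phi> x)"
      by (rule W012_integral_by_parts[OF ab \<phi> _ finite.emptyI, where C=0]) auto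
    then have 2: "(LINT x|?M. c * weak_deriv ?S \<phi> x) = 0" by simp
    have "(\<lambda>x. (?g x + (H x - c)) * weak_deriv ?S \<phi> x) =
        (\<lambda>x. ?g x * weak_deriv ?S \<phi> x + H x * weak_deriv ?S \<phi> x - c * weak_deriv ?S \<phi> x)"
      by (auto simp: algebra_simps)
    then show ?thesis
      using L2_mult_integrable[OF g2 \<phi>2] L2_mult_integrable[OF H2(1) \<phi>2] L2_integrable[OF \<phi>2] 1 2 weak[OF \<phi>]
      by simp
  qed
  \<comment> \<open>Add the orthogonality relations for \<open>\<phi> = u\<close> and \<open>\<phi> = K\<close>.\<close>
  let ?q = "\<lambda>x. ?g x + (H x - c)"
  have q2: "?q \<in> L2 ?S"
    using L2_diff[OF g2, of "\<lambda>x. c - H x"] L2_diff[OF const_fun_L2 H2(1)] by (simp add: algebra_simps)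
  have "(LINT x|?M. (?q x)\<^sup>2) = (LINT x|?M. ?q x * ?g x + ?q x * weak_deriv ?S K x)"
    by (rule integral_cong_AE)
      (use q2 g2 Kd W012_L2(2)[OF KW] in \<open>auto simp: L2_def power2_eq_square distrib_left\<close>)
  also have "\<dots> = 0"
    using orth[OF u] orth[OF KW] L2_mult_integrable[OF q2 g2] L2_mult_integrable[OF q2 W012_L2(2)[OF KW]] by simp
  finally have "AE x in ?M. (?q x)\<^sup>2 = 0"
    using integral_nonneg_eq_0_iff_AE[of ?M "\<lambda>x. (?q x)\<^sup>2"] q2 by (auto simp: L2_def)
  then have "AE x in ?M. ?g x = c - H x"
    by eventually_elim simp
  from AE_lebesgue_on_negligible[OF this]
  have neg: "negligible ({x \<in> ?S. \<not> ?g x = c - H x} \<union> {-2, 2})"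
    by (intro negligible_Un) auto
  define G where "G t = c - H t" for t
  have RG: "R t = integral {-2..t} G" if "t \<in> {-2..2}" for t
    unfolding R_def by (rule integral_spike[OF neg]) (use that in \<open>auto simp: G_def\<close>)
  have Gc: "continuous_on T G" for T
    unfolding G_def[abs_def] by (intro continuous_intros continuous_on_subset[OF H_cont]) simp
  show ?thesis
  proof (rule that[of R G])
    show "(R has_real_derivative G t) (at t within {-2..2})" if t: "t \<in> {-2..2}" for t
      by (rule has_field_derivative_transform_within[OF integral_has_real_derivative[OF Gc t] zero_less_one t])
        (use RG in auto)
    show "(G has_real_derivative - (1 / R t ^ n)) (at t within {-1..1})" if t: "t \<in> {-1..1}" for t
      unfolding G_def[abs_def] using DERIV_diff[OF DERIV_const[of c] H_deriv[OF t]] by simp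
    show "G t = G (-1)" if "t \<le> -1" for t using H_left that by (simp add: G_def)
    show "G t = G 1" if "1 \<le> t" for t using H_right[OF that] by (simp add: G_def)
    show "R (-2) = 0" by (simp add: R_def)
  qed (use Ru Rc R2 Rpos Gc in auto)
qed

section \<open>The singular problem in polar form\<close>

lemma mvt_within_Icc:
  fixes a b x y :: real
  assumes "a \<le> x" "x < y" "y \<le> b"
    and "\<And>t. t \<in> {a..b} \<Longrightarrow> (f has_real_derivative f' t) (at t within {a..b})"
  shows "\<exists>z\<in>{x<..<y}. f y - f x = f' z * (y - x)"
proof (rule mvt_simple[OF assms(2)])
  fix t assume "x \<le> t" "t \<le> y"
  then have "(f has_real_derivative f' t) (at t within {x..y})"
    using assms by (intro has_field_derivative_subset[OF assms(4)]) auto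
  then show "(f has_derivative (*) (f' t)) (at t within {x..y})"
    by (simp add: has_field_derivative_def)
qed

text \<open>
  A bound, uniform in \<open>n\<close>, for the radius \<open>s\<close> introduced below. The lower bound \<open>2 / (3 * pi)\<close> for the
  boundary value of \<open>s\<close> and \<open>n \<ge> 4\<close> give \<open>arctan (1 / pi)\<close> as a lower bound for the boundary angle, and
  the product of boundary value and boundary angle is at most 1.
\<close>

definition profile_bound :: real where "profile_bound = 3 / arctan (1 / pi)"

lemma profile_bound_pos: "0 < profile_bound"
  by (simp add: profile_bound_def)

text \<open>
  The classical form of the singular problem: \<open>U\<close> is the solution and \<open>G\<close> its derivative. It is affine
  outside \<open>(-1, 1)\<close>.
\<close>

locale singular_profile =
  fixes n :: nat and U G :: "real \<Rightarrow> real"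
  assumes n_gt_3: "3 < n"
    and U_cont: "continuous_on {-2..2} U" and U_left: "U (-2) = 0" and U_right: "U 2 = 0"
    and U_pos: "t \<in> {-2<..<2} \<Longrightarrow> 0 < U t"
    and U_deriv: "t \<in> {-2..2} \<Longrightarrow> (U has_real_derivative G t) (at t within {-2..2})"
    and G_deriv: "t \<in> {-1..1} \<Longrightarrow> (G has_real_derivative - (1 / U t ^ n)) (at t within {-1..1})"
    and G_left: "t \<le> -1 \<Longrightarrow> G t = G (-1)" and G_right: "1 \<le> t \<Longrightarrow> G t = G 1"
    and G_cont: "continuous_on UNIV G"
begin

lemma U_deriv_at: "t \<in> {-2<..<2} \<Longrightarrow> (U has_real_derivative G t) (at t)"
  using U_deriv[of t] by (simp add: at_within_Icc_at)

lemma U_deriv_inner: "t \<in> {-1..1} \<Longrightarrow> (U has_real_derivative G t) (at t within {-1..1})"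
  using U_deriv_at[of t] by (auto intro: has_field_derivative_at_within)

lemma G_deriv_at: "t \<in> {-1<..<1} \<Longrightarrow> (G has_real_derivative - (1 / U t ^ n)) (at t)"
  using G_deriv[of t] by (simp add: at_within_Icc_at)

lemma U_inner_pos: "t \<in> {-1..1} \<Longrightarrow> 0 < U t"
  using U_pos[of t] by simp

lemma U_outer_right:
  assumes "t \<in> {1..2}"
  shows "U t = - G 1 * (2 - t)"
proof -
  have "\<exists>c. \<forall>x\<in>{1..2}. U x - G 1 * x = c"
  proof (rule has_field_derivative_zero_constant)
    fix x :: real assume x: "x \<in> {1..2}"
    have "(U has_real_derivative G 1) (at x within {1..2})"
      using has_field_derivative_subset[OF U_deriv[of x], of "{1..2}"] x G_right[of x] by auto
    then show "((\<lambda>x. U x - G 1 * x) has_real_derivative 0) (at x within {1..2})"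
      by (auto intro!: derivative_eq_intros)
  qed simp
  then have "U t - G 1 * t = U 2 - G 1 * 2" using assms by auto
  then show ?thesis by (simp add: U_right algebra_simps)
qed

lemma U_outer_left:
  assumes "t \<in> {-2..-1}"
  shows "U t = G (-1) * (t + 2)"
proof -
  have "\<exists>c. \<forall>x\<in>{-2..-1}. U x - G (-1) * x = c"
  proof (rule has_field_derivative_zero_constant)
    fix x :: real assume x: "x \<in> {-2..-1}"
    have "(U has_real_derivative G (-1)) (at x within {-2..-1})"
      using has_field_derivative_subset[OF U_deriv[of x], of "{-2..-1}"] x G_left[of x] by auto
    then show "((\<lambda>x. U x - G (-1) * x) has_real_derivative 0) (at x within {-2..-1})"
      by (auto intro!: derivative_eq_intros)
  qed simp
  then obtain c where c: "\<forall>x\<in>{-2..-1}. U x - G (-1) * x = c" by blast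
  have "U t - G (-1) * t = U (-2) - G (-1) * (-2)"
    using bspec[OF c assms] bspec[OF c, of "-2"] by simp
  then show ?thesis by (simp add: U_left algebra_simps)
qed

text \<open>
  The first integral of \<open>- U'' = U powr (- n)\<close>, obtained by multiplying the equation by \<open>U'\<close>.
\<close>

definition energy :: "real \<Rightarrow> real" where
  "energy t = 1 / U t ^ (n - 1) - (real n - 1) / 2 * (G t)\<^sup>2"

lemma energy_constant: "s \<in> {-1..1} \<Longrightarrow> t \<in> {-1..1} \<Longrightarrow> energy s = energy t"
proof -
  have "\<exists>c. \<forall>x\<in>{-1..1}. energy x = c"
  proof (rule has_field_derivative_zero_constant)
    fix x :: real assume x: "x \<in> {-1..1}"
    have U0: "U x \<noteq> 0" using U_inner_pos[OF x] by simp
    obtain m where m: "n = Suc (Suc m)" using n_gt_3 by (metis One_nat_def Suc_lessE numeral_3_eq_3)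
    have d1: "((\<lambda>x. inverse (U x ^ (n - 1))) has_real_derivative - ((real n - 1) * G x / U x ^ n)) (at x within {-1..1})"
    proof -
      have "((\<lambda>x. U x ^ (n - 1)) has_real_derivative real (Suc m) * (U x ^ m * G x)) (at x within {-1..1})"
        using DERIV_power[OF U_deriv_inner[OF x], of "n - 1"] by (simp add: m mult_ac)
      then have "((\<lambda>x. inverse (U x ^ (n - 1))) has_real_derivative
          - (real (Suc m) * (U x ^ m * G x) * inverse ((U x ^ (n - 1)) ^ Suc (Suc 0)))) (at x within {-1..1})"
        by (rule DERIV_inverse_fun) (use U0 in simp)
      moreover have "real (Suc m) * (U x ^ m * G x) * inverse ((U x ^ (n - 1)) ^ Suc (Suc 0)) = (real n - 1) * G x / U x ^ n"
        using U0 by (simp add: m divide_simps)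
      ultimately show ?thesis by simp
    qed
    have d2: "((\<lambda>x. (real n - 1) / 2 * (G x)\<^sup>2) has_real_derivative
        (real n - 1) / 2 * (2 * G x * - (1 / U x ^ n))) (at x within {-1..1})"
      by (auto intro!: derivative_eq_intros G_deriv x)
    have "- ((real n - 1) * G x / U x ^ n) - (real n - 1) / 2 * (2 * G x * - (1 / U x ^ n)) = 0"
      by simp
    moreover have "energy = (\<lambda>x. inverse (U x ^ (n - 1)) - (real n - 1) / 2 * (G x)\<^sup>2)"
      by (simp add: energy_def[abs_def] inverse_eq_divide)
    ultimately show "(energy has_real_derivative 0) (at x within {-1..1})"
      using DERIV_diff[OF d1 d2] by simp
  qed simp
  then show "s \<in> {-1..1} \<Longrightarrow> t \<in> {-1..1} \<Longrightarrow> energy s = energy t" by auto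
qed

text \<open>
  The affine pieces have length one, so the boundary value of \<open>U\<close> is also the absolute value of its
  slope there.
\<close>

definition slope :: real where "slope = U 1"
definition level :: real where "level = energy 0"

lemma energy_eq_level: "t \<in> {-1..1} \<Longrightarrow> 1 / U t ^ (n - 1) - (real n - 1) / 2 * (G t)\<^sup>2 = level"
  unfolding level_def using energy_constant[of t 0] by (simp add: energy_def)

lemma slope_pos: "0 < slope"
  unfolding slope_def by (rule U_inner_pos) simp

lemma G_1: "G 1 = - slope"
  using U_outer_right[of 1] by (simp add: slope_def)

lemma U_minus_1_eq_G: "U (-1) = G (-1)"
  using U_outer_left[of "-1"] by simp

text \<open>
  The energy at a boundary point is a strictly decreasing function of the boundary value; equal
  energies force equal boundary values.
\<close>

lemma U_minus_1: "U (-1) = slope"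
proof -
  let ?b = "U (-1)"
  have b: "0 < ?b" by (rule U_inner_pos) simp
  have eq: "1 / slope ^ (n - 1) - (real n - 1) / 2 * slope\<^sup>2 = 1 / ?b ^ (n - 1) - (real n - 1) / 2 * ?b\<^sup>2"
    using energy_eq_level[of 1] energy_eq_level[of "-1"] by (simp add: G_1 U_minus_1_eq_G[symmetric] slope_def)
  have mono: "1 / y ^ (n - 1) - (real n - 1) / 2 * y\<^sup>2 < 1 / x ^ (n - 1) - (real n - 1) / 2 * x\<^sup>2"
    if "0 < x" "x < y" for x y :: real
  proof -
    have "x ^ (n - 1) < y ^ (n - 1)" by (rule power_strict_mono) (use that n_gt_3 in auto)
    then have 1: "1 / y ^ (n - 1) < 1 / x ^ (n - 1)"
      using that by (intro divide_strict_left_mono) auto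
    have "x\<^sup>2 < y\<^sup>2" by (rule power_strict_mono) (use that in auto)
    then have "(real n - 1) / 2 * x\<^sup>2 < (real n - 1) / 2 * y\<^sup>2"
      using n_gt_3 by (intro mult_strict_left_mono) auto
    with 1 show ?thesis by linarith
  qed
  show ?thesis
    using mono[of ?b slope] mono[of slope ?b] eq b slope_pos by (cases ?b slope rule: linorder_cases) auto
qed

lemma G_minus_1: "G (-1) = slope"
  using U_minus_1 U_minus_1_eq_G by simp

text \<open>
  The derivative changes sign, and the energy is positive where the derivative vanishes.
\<close>

lemma level_pos: "0 < level"
proof -
  have "\<exists>x. -1 \<le> x \<and> x \<le> 1 \<and> G x = 0"
    by (rule IVT2') (use slope_pos in \<open>auto simp: G_1 G_minus_1 intro: continuous_on_subset[OF G_cont]\<close>)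
  then obtain x where x: "x \<in> {-1..1}" "G x = 0" by auto
  then show ?thesis
    using energy_eq_level[OF x(1)] U_inner_pos[OF x(1)] by (simp add: zero_less_divide_iff)
      (metis zero_less_divide_1_iff zero_less_power)
qed

text \<open>
  The conserved energy reads \<open>level * U^(n-1) = 1 / (1 + tan^2 \<theta>)\<close> when \<open>tan \<theta>\<close> is the suitably scaled
  derivative of \<open>U\<close>. This suggests the angle \<open>\<theta>\<close> as a new unknown, together with the rescaled solution \<open>s\<close>.
  The scale \<open>\<kappa>\<close> is chosen such that the system for \<open>s\<close> and \<open>\<theta>\<close> contains no other constant than \<open>n\<close>.
\<close>

definition \<kappa> :: real where "\<kappa> = sqrt ((real n - 1) * level / 2)"
definition s :: "real \<Rightarrow> real" where "s t = U t / \<kappa>"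
definition \<theta> :: "real \<Rightarrow> real" where "\<theta> t = arctan (- (\<kappa> / level * G t))"

lemma kappa_pos: "0 < \<kappa>"
  unfolding \<kappa>_def using level_pos n_gt_3 by simp

lemma kappa_sq: "\<kappa>\<^sup>2 = (real n - 1) * level / 2"
  unfolding \<kappa>_def using level_pos n_gt_3 by simp

lemma kappa_div_level: "\<kappa> / level = (real n - 1) / 2 * (1 / \<kappa>)"
  using kappa_sq kappa_pos level_pos by (simp add: field_simps power2_eq_square)

lemma tan_theta: "tan (\<theta> t) = - (\<kappa> / level * G t)"
  by (simp add: \<theta>_def tan_arctan)

lemma theta_bounds: "- (pi / 2) < \<theta> t" "\<theta> t < pi / 2"
  unfolding \<theta>_def by (rule arctan_lbound, rule arctan_ubound)

lemma one_plus_tan_sq: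
  assumes "t \<in> {-1..1}"
  shows "1 + (\<kappa> / level * G t)\<^sup>2 = 1 / (level * U t ^ (n - 1))"
proof -
  have "(\<kappa> / level * G t)\<^sup>2 = (real n - 1) / 2 * (G t)\<^sup>2 / level"
    using level_pos by (simp add: power_mult_distrib power_divide kappa_sq power2_eq_square[of level])
  also have "(real n - 1) / 2 * (G t)\<^sup>2 = 1 / U t ^ (n - 1) - level"
    using energy_eq_level[OF assms] by simp
  finally show ?thesis using level_pos U_inner_pos[OF assms] by (simp add: field_simps)
qed

text \<open>
  Together with \<open>s_deriv\<close> this is the system \<open>\<theta>' = 1 / s\<close>, \<open>s' = - 2 / (n - 1) * tan \<theta>\<close>. As \<open>n\<close> grows, \<open>s\<close>
  becomes constant and \<open>\<theta>\<close> linear.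
\<close>

lemma theta_deriv:
  assumes t: "t \<in> {-1..1}"
  shows "(\<theta> has_real_derivative 1 / s t) (at t within {-1..1})"
proof -
  have U0: "0 < U t" by (rule U_inner_pos[OF t])
  have "((\<lambda>t. - (\<kappa> / level * G t)) has_real_derivative - (\<kappa> / level * - (1 / U t ^ n))) (at t within {-1..1})"
    by (rule DERIV_minus[OF DERIV_cmult[OF G_deriv[OF t]]])
  then have "(\<theta> has_real_derivative inverse (1 + (- (\<kappa> / level * G t))\<^sup>2) * - (\<kappa> / level * - (1 / U t ^ n))) (at t within {-1..1})"
    unfolding \<theta>_def[abs_def] by (rule DERIV_chain2[OF DERIV_arctan])
  moreover have "inverse (1 + (- (\<kappa> / level * G t))\<^sup>2) * - (\<kappa> / level * - (1 / U t ^ n)) = 1 / s t"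
  proof -
    have "U t ^ n = U t * U t ^ (n - 1)" using n_gt_3 by (metis gr_implies_not0 power_eq_if)
    moreover have "1 + (- (\<kappa> / level * G t))\<^sup>2 = 1 / (level * U t ^ (n - 1))"
      using one_plus_tan_sq[OF t] by simp
    moreover have "0 < U t ^ (n - 1)" using U0 by simp
    ultimately show ?thesis
      using U0 level_pos kappa_pos by (simp add: s_def divide_simps)
  qed
  ultimately show ?thesis by simp
qed

lemma s_deriv:
  assumes t: "t \<in> {-1..1}"
  shows "(s has_real_derivative - (2 / (real n - 1) * tan (\<theta> t))) (at t within {-1..1})"
proof -
  have "(s has_real_derivative G t / \<kappa>) (at t within {-1..1})"
    unfolding s_def[abs_def] by (rule DERIV_cdivide[OF U_deriv_inner[OF t]])
  moreover have "G t / \<kappa> = - (2 / (real n - 1) * tan (\<theta> t))"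
    using n_gt_3 by (simp add: tan_theta kappa_div_level)
  ultimately show ?thesis by simp
qed

text \<open>
  The derivative of \<open>U^(n+1) / (n+1)\<close> is \<open>U^n * G\<close>. In the new unknowns \<open>n\<close> disappears from it
  altogether.
\<close>

lemma flux_polar:
  assumes t: "t \<in> {-1..1}"
  shows "U t ^ n * G t = - (s t * sin (\<theta> t) * cos (\<theta> t))"
proof -
  have c: "cos (\<theta> t) \<noteq> 0" by (simp add: \<theta>_def)
  have "sin (\<theta> t) * cos (\<theta> t) = tan (\<theta> t) * (cos (\<theta> t))\<^sup>2"
    using c by (simp add: tan_def power2_eq_square)
  also have "(cos (\<theta> t))\<^sup>2 = level * U t ^ (n - 1)"
  proof -
    have "(cos (\<theta> t))\<^sup>2 = 1 / (1 + (\<kappa> / level * G t)\<^sup>2)"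
      unfolding \<theta>_def cos_arctan by (simp add: power_divide add_nonneg_nonneg)
    then show ?thesis unfolding one_plus_tan_sq[OF t] by simp
  qed
  finally have "sin (\<theta> t) * cos (\<theta> t) = - (\<kappa> * G t * U t ^ (n - 1))"
    using level_pos by (simp add: tan_theta)
  then have "s t * (sin (\<theta> t) * cos (\<theta> t)) = - (U t * U t ^ (n - 1) * G t)"
    using kappa_pos by (simp add: s_def)
  moreover have "U t ^ n = U t * U t ^ (n - 1)" using n_gt_3 by (metis gr_implies_not0 power_eq_if)
  ultimately show ?thesis by (simp add: mult.assoc)
qed

lemma G_antimono:
  assumes "-1 \<le> x" "x \<le> y" "y \<le> 1"
  shows "G y \<le> G x"
proof (rule DERIV_nonpos_imp_decreasing_open[OF assms(2)])
  show "\<exists>d. (G has_real_derivative d) (at t) \<and> d \<le> 0" if "x < t" "t < y" for t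
    using G_deriv_at[of t] U_inner_pos[of t] that assms
    by (intro exI[of _ "- (1 / U t ^ n)"]) auto
qed (rule continuous_on_subset[OF G_cont], simp)

lemma G_bound: "t \<in> {-1..1} \<Longrightarrow> \<bar>G t\<bar> \<le> slope"
  using G_antimono[of t 1] G_antimono[of "-1" t] by (simp add: G_1 G_minus_1 abs_le_iff)

lemma U_lower:
  assumes t: "t \<in> {-1..1}"
  shows "slope \<le> U t"
proof (rule ccontr)
  assume "\<not> slope \<le> U t"
  then have "U t < slope" by simp
  then have "U t ^ (n - 1) < slope ^ (n - 1)"
    by (intro power_strict_mono) (use U_inner_pos[OF t] n_gt_3 in auto)
  then have "1 / slope ^ (n - 1) < 1 / U t ^ (n - 1)"
    using U_inner_pos[OF t] slope_pos by (intro divide_strict_left_mono) auto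
  moreover have "(real n - 1) / 2 * (G t)\<^sup>2 \<le> (real n - 1) / 2 * slope\<^sup>2"
    using power_mono[OF G_bound[OF t], of 2] n_gt_3 by (intro mult_left_mono) auto
  ultimately show False
    using energy_eq_level[OF t] energy_eq_level[of 1] by (simp add: G_1 slope_def[symmetric])
qed

text \<open>
  The slope on \<open>[-1, 1]\<close> is at most the boundary value and the interval has length two.
\<close>

lemma U_upper:
  assumes t: "t \<in> {-1..1}"
  shows "U t \<le> 3 * slope"
proof -
  have "norm (U t - U 1) \<le> slope * norm (t - 1)"
    by (rule field_differentiable_bound[of "{-1..1}" U G])
      (use t U_deriv_inner G_bound in auto)
  also have "\<dots> \<le> slope * 2" using t slope_pos by (intro mult_left_mono) auto
  finally show ?thesis by (simp add: slope_def)
qed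

definition \<sigma> :: real where "\<sigma> = s 1"

lemma sigma_pos: "0 < \<sigma>"
  using slope_pos kappa_pos by (simp add: \<sigma>_def s_def slope_def)

lemma s_bounds_sigma: "t \<in> {-1..1} \<Longrightarrow> \<sigma> \<le> s t \<and> s t \<le> 3 * \<sigma>"
  using U_lower[of t] U_upper[of t] kappa_pos by (simp add: \<sigma>_def s_def slope_def divide_right_mono field_simps)

lemma theta_minus_1: "\<theta> (-1) = - \<theta> 1"
  by (simp add: \<theta>_def G_1 G_minus_1 arctan_minus)

lemma theta_1: "\<theta> 1 = arctan ((real n - 1) / 2 * \<sigma>)"
  by (simp add: \<theta>_def G_1 kappa_div_level \<sigma>_def s_def slope_def)

lemma theta_increment:
  assumes "-1 \<le> x" "x \<le> y" "y \<le> 1"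
  shows "(y - x) / (3 * \<sigma>) \<le> \<theta> y - \<theta> x \<and> \<theta> y - \<theta> x \<le> (y - x) / \<sigma>"
proof (cases "x = y")
  case False
  then have xy: "x < y" using assms by simp
  obtain z where z: "z \<in> {x<..<y}" "\<theta> y - \<theta> x = 1 / s z * (y - x)"
    using mvt_within_Icc[OF assms(1) xy assms(3) theta_deriv] by blast
  have sz: "\<sigma> \<le> s z" "s z \<le> 3 * \<sigma>" using s_bounds_sigma[of z] z(1) assms by auto
  have "1 / (3 * \<sigma>) \<le> 1 / s z" "1 / s z \<le> 1 / \<sigma>"
    using sz sigma_pos by (auto intro!: divide_left_mono)
  then have "1 / (3 * \<sigma>) * (y - x) \<le> 1 / s z * (y - x)" "1 / s z * (y - x) \<le> 1 / \<sigma> * (y - x)"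
    using xy by (auto intro!: mult_right_mono simp del: times_divide_eq_left)
  then show ?thesis using z(2) by simp
qed simp

lemma sigma_lower: "2 / (3 * pi) \<le> \<sigma>"
proof -
  have "2 / (3 * \<sigma>) \<le> 2 * \<theta> 1"
    using theta_increment[of "-1" 1] by (simp add: theta_minus_1)
  also have "\<dots> < pi" using theta_bounds(2)[of 1] by linarith
  finally show ?thesis using sigma_pos by (simp add: field_simps)
qed

lemma sigma_upper: "3 * \<sigma> \<le> profile_bound"
proof -
  have "1 / pi \<le> (real n - 1) / 2 * \<sigma>"
  proof -
    have "1 / pi = 3 / 2 * (2 / (3 * pi))" by simp
    also have "\<dots> \<le> (real n - 1) / 2 * \<sigma>"
      using n_gt_3 by (intro mult_mono sigma_lower) auto
    finally show ?thesis .
  qed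
  then have "arctan (1 / pi) \<le> \<theta> 1" unfolding theta_1 by (rule arctan_monotone')
  moreover have "\<theta> 1 \<le> 1 / \<sigma>"
    using theta_increment[of "-1" 1] by (simp add: theta_minus_1)
  ultimately have "arctan (1 / pi) \<le> 1 / \<sigma>" by linarith
  moreover have "0 < arctan (1 / pi)" by simp
  ultimately show ?thesis using sigma_pos by (simp add: profile_bound_def field_simps)
qed

lemma s_bounds: "t \<in> {-1..1} \<Longrightarrow> 2 / (3 * pi) \<le> s t \<and> s t \<le> profile_bound"
  using s_bounds_sigma[of t] sigma_lower sigma_upper by auto

text \<open>
  The angle is below \<open>pi / 2\<close> at 1 and increases at a rate of at least \<open>1 / profile_bound\<close>, so at distance
  \<open>1 - t\<close> from the end point it has not yet come close to \<open>pi / 2\<close>. The same holds at the other end.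
\<close>

lemma theta_away_from_right_angle:
  assumes t: "t \<in> {-1..1}"
  shows "\<bar>\<theta> t\<bar> \<le> pi / 2 - (1 - \<bar>t\<bar>) / profile_bound"
proof -
  have le: "x / profile_bound \<le> x / (3 * \<sigma>)" if "0 \<le> x" for x
    using that sigma_upper sigma_pos by (intro divide_left_mono) (auto intro: mult_pos_pos profile_bound_pos)
  note half = theta_bounds(2)[of 1]
  have "\<theta> t \<le> pi / 2 - (1 - t) / profile_bound"
    using theta_increment[of t 1] le[of "1 - t"] half t by auto
  moreover have "- (pi / 2 - (1 + t) / profile_bound) \<le> \<theta> t"
    using theta_increment[of "-1" t] le[of "1 + t"] half t theta_minus_1 by (auto simp: add.commute)
  moreover have "(1 - \<bar>t\<bar>) / profile_bound \<le> (1 - t) / profile_bound"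
      "(1 - \<bar>t\<bar>) / profile_bound \<le> (1 + t) / profile_bound"
    using profile_bound_pos by (intro divide_right_mono; simp)+
  ultimately show ?thesis by linarith
qed

text \<open>
  Away from the end points \<open>tan \<theta>\<close> is bounded independently of \<open>n\<close>, and \<open>s'\<close> carries the factor
  \<open>2 / (n - 1)\<close>.
\<close>

lemma s_variation:
  assumes t: "t \<in> {-1<..<1}"
  shows "\<bar>s t - s 0\<bar> \<le> 2 / (real n - 1) * tan (pi / 2 - (1 - \<bar>t\<bar>) / profile_bound)"
proof -
  let ?\<beta> = "pi / 2 - (1 - \<bar>t\<bar>) / profile_bound"
  have "0 < (1 - \<bar>t\<bar>) / profile_bound" using t profile_bound_pos by auto
  then have \<beta>: "?\<beta> < pi / 2" by linarith
  have tan: "\<bar>tan (\<theta> z)\<bar> \<le> tan ?\<beta>" if z: "z \<in> {-\<bar>t\<bar>..\<bar>t\<bar>}" for z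
  proof -
    have "(1 - \<bar>t\<bar>) / profile_bound \<le> (1 - \<bar>z\<bar>) / profile_bound"
      using z profile_bound_pos by (intro divide_right_mono) auto
    moreover have "\<bar>\<theta> z\<bar> \<le> pi / 2 - (1 - \<bar>z\<bar>) / profile_bound"
      by (rule theta_away_from_right_angle) (use z t in auto)
    ultimately have "\<bar>\<theta> z\<bar> \<le> ?\<beta>" by linarith
    then have "\<theta> z \<le> ?\<beta>" "- \<theta> z \<le> ?\<beta>" by linarith+
    moreover have "- (pi / 2) < \<theta> z" "- (pi / 2) < - \<theta> z"
      using theta_bounds[of z] by linarith+
    ultimately have "tan (\<theta> z) \<le> tan ?\<beta>" "tan (- \<theta> z) \<le> tan ?\<beta>"
      using tan_mono_le[OF _ _ \<beta>] by blast+
    then show ?thesis by simp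
  qed
  have "0 \<in> {-\<bar>t\<bar>..\<bar>t\<bar>}" by simp
  from order_trans[OF abs_ge_zero tan[OF this]] have tan0: "0 \<le> tan ?\<beta>" .
  have "norm (s t - s 0) \<le> 2 / (real n - 1) * tan ?\<beta> * norm (t - 0)"
  proof (rule field_differentiable_bound[of "{-\<bar>t\<bar>..\<bar>t\<bar>}" s "\<lambda>z. - (2 / (real n - 1) * tan (\<theta> z))"])
    fix z assume z: "z \<in> {-\<bar>t\<bar>..\<bar>t\<bar>}"
    show "(s has_real_derivative - (2 / (real n - 1) * tan (\<theta> z))) (at z within {-\<bar>t\<bar>..\<bar>t\<bar>})"
      by (rule has_field_derivative_subset[OF s_deriv]) (use z t in auto)
    show "norm (- (2 / (real n - 1) * tan (\<theta> z))) \<le> 2 / (real n - 1) * tan ?\<beta>"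
    proof -
      have "norm (- (2 / (real n - 1) * tan (\<theta> z))) = 2 / (real n - 1) * \<bar>tan (\<theta> z)\<bar>"
        using n_gt_3 by (simp add: abs_mult)
      also have "\<dots> \<le> 2 / (real n - 1) * tan ?\<beta>"
        by (intro mult_left_mono tan z) (use n_gt_3 in auto)
      finally show ?thesis .
    qed
  qed auto
  also have "\<dots> \<le> 2 / (real n - 1) * tan ?\<beta> * 1"
    using tan0 n_gt_3 t by (intro mult_left_mono) auto
  finally show ?thesis by simp
qed

lemma flux_inner_bound: "t \<in> {-1..1} \<Longrightarrow> \<bar>U t ^ n * G t\<bar> \<le> profile_bound"
proof -
  assume t: "t \<in> {-1..1}"
  have s0: "0 \<le> s t" using s_bounds_sigma[OF t] sigma_pos by linarith
  have "\<bar>sin (\<theta> t) * cos (\<theta> t)\<bar> \<le> 1"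
    unfolding abs_mult by (intro mult_le_one) auto
  then have "s t * \<bar>sin (\<theta> t) * cos (\<theta> t)\<bar> \<le> s t * 1"
    using s0 by (intro mult_left_mono) auto
  then have "\<bar>U t ^ n * G t\<bar> \<le> s t"
    unfolding flux_polar[OF t] using s0 by (simp add: abs_mult mult.assoc)
  then show ?thesis using s_bounds[OF t] by linarith
qed

text \<open>
  On the affine pieces the flux is the boundary flux times the \<open>n\<close>-th power of the distance to the
  nearer of the points \<open>-2\<close> and \<open>2\<close>.
\<close>

lemma flux_outer_bound:
  assumes t: "1 \<le> \<bar>t\<bar>" "\<bar>t\<bar> \<le> 2"
  shows "\<bar>U t ^ n * G t\<bar> \<le> profile_bound * (2 - \<bar>t\<bar>) ^ n"
proof -
  have b: "slope ^ n * slope \<le> profile_bound"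
    using flux_inner_bound[of 1] slope_pos by (simp add: slope_def[symmetric] G_1 abs_mult)
  have eq: "\<bar>U t ^ n * G t\<bar> = slope ^ n * slope * (2 - \<bar>t\<bar>) ^ n"
  proof (cases "1 \<le> t")
    case True
    then show ?thesis
      using U_outer_right[of t] G_right[of t] t slope_pos
      by (simp add: G_1 power_mult_distrib abs_mult)
  next
    case False
    then have t': "t \<le> -1" "\<bar>t\<bar> = - t" using t by auto
    have "0 \<le> (t + 2) ^ n * slope ^ n * slope"
      using slope_pos t t' by (intro mult_nonneg_nonneg zero_le_power) auto
    then show ?thesis
      using U_outer_left[of t] G_left[of t] t t'
      by (simp add: G_minus_1 power_mult_distrib add.commute mult_ac)
  qed
  show ?thesis unfolding eq by (intro mult_right_mono b) (use t in auto)
qed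

lemma flux_bound:
  assumes "t \<in> {-2..2}"
  shows "\<bar>U t ^ n * G t\<bar> \<le> profile_bound"
proof (cases "t \<in> {-1..1}")
  case False
  then have t: "1 \<le> \<bar>t\<bar>" "\<bar>t\<bar> \<le> 2" using assms by auto
  have "(2 - \<bar>t\<bar>) ^ n \<le> 1" using t by (intro power_le_one) auto
  then have "profile_bound * (2 - \<bar>t\<bar>) ^ n \<le> profile_bound * 1"
    using profile_bound_pos by (intro mult_left_mono) auto
  then show ?thesis using flux_outer_bound[OF t] by simp
qed (rule flux_inner_bound)

section \<open>The quadratic equation for the power of the solution\<close>

lemma G_deriv_off_jump:
  assumes t: "t \<in> {-2<..<2} - {-1, 1}"
  shows "(G has_real_derivative - (indicator {-1<..<1} t / U t ^ n)) (at t)"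
proof -
  consider "t < -1" | "t \<in> {-1<..<1}" | "1 < t" using t by force
  then show ?thesis
  proof cases
    case 1
    have "G (-1) = G y" if "y \<in> {..<-1}" for y using G_left[of y] that by simp
    then have "(G has_real_derivative 0) (at t)"
      by (rule has_field_derivative_transform_within_open[of "\<lambda>x. G (-1)" _ _ "{..<-1}", rotated 3])
        (use 1 in auto)
    then show ?thesis using 1 by simp
  next
    case 2
    then show ?thesis using G_deriv_at by simp
  next
    case 3
    have "G 1 = G y" if "y \<in> {1<..}" for y using G_right[of y] that by simp
    then have "(G has_real_derivative 0) (at t)"
      by (rule has_field_derivative_transform_within_open[of "\<lambda>x. G 1" _ _ "{1<..}", rotated 3])
        (use 3 in auto)
    then show ?thesis using 3 by simp
  qed
qed

lemma flux_deriv: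
  assumes t: "t \<in> {-2<..<2} - {-1, 1}"
  shows "((\<lambda>t. U t ^ n * G t) has_real_derivative
    real n * U t ^ (n - 1) * (G t)\<^sup>2 - indicator {-1<..<1} t) (at t)"
proof -
  have U0: "U t \<noteq> 0" using U_pos[of t] t by auto
  have "((\<lambda>t. U t ^ n * G t) has_real_derivative
      U t ^ n * - (indicator {-1<..<1} t / U t ^ n) + real n * (G t * U t ^ (n - Suc 0)) * G t) (at t)"
    by (rule DERIV_mult'[OF DERIV_power[OF U_deriv_at] G_deriv_off_jump[OF t]]) (use t in auto)
  then show ?thesis using U0 by (simp add: power2_eq_square algebra_simps)
qed

lemma flux_cont: "continuous_on {-2..2} (\<lambda>t. U t ^ n * G t)"
  by (intro continuous_intros U_cont continuous_on_subset[OF G_cont]) simp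

definition W :: "real \<Rightarrow> real" where "W t = U t ^ (n + 1) / real (n + 1)"

lemma W_cont: "continuous_on {-2..2} W"
  unfolding W_def[abs_def] by (intro continuous_intros U_cont) auto

lemma W_deriv: "t \<in> {-2<..<2} \<Longrightarrow> (W has_real_derivative U t ^ n * G t) (at t)"
  using DERIV_cdivide[OF DERIV_power[OF U_deriv_at], of t "n + 1" "real (n + 1)"]
  by (simp add: W_def[abs_def] mult_ac)

lemma W_boundary: "W (-2) = 0" "W 2 = 0"
  by (simp_all add: W_def U_left U_right)

text \<open>
  The transformed solution is only given almost everywhere, through the weak solution.
\<close>

context
  fixes V :: "real \<Rightarrow> real"
  assumes V: "AE x in lebesgue_on {-2<..<2}. W x = V x"
begin

lemma V_W012: "V \<in> W012 {-2<..<2}"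
  by (rule W012_if_continuous_deriv[OF _ W_cont W_boundary flux_cont finite.emptyI _ V]) (simp_all add: W_deriv)

lemma weak_deriv_V: "AE x in lebesgue_on {-2<..<2}. weak_deriv {-2<..<2} V x = U x ^ n * G x"
  by (rule weak_deriv_AE_eq[OF has_weak_deriv_piecewise(1)[OF _ W_cont finite.emptyI _ continuous_on_Icc_L2[OF flux_cont] V]])
    (simp_all add: W_deriv)

text \<open>
  With \<open>w = U^n * G\<close> the derivative of \<open>V\<close>, the quadratic term \<open>n / (n+1) * V'^2 / V\<close> is
  \<open>n * U^(n-1) * G^2\<close>, which is exactly the first term of \<open>w'\<close>; the second term of \<open>w'\<close> is minus the
  indicator. The weak equation is integration by parts for \<open>w\<close>.
\<close>

lemma quadratic_V: "quadratic_weak_solution (real n / real (n + 1)) (indicator {-1<..<1}) V"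
proof -
  let ?S = "{-2<..<2::real}" and ?M = "lebesgue_on {-2<..<2::real}"
  let ?v = "weak_deriv ?S V"
  define Q where "Q x = U x ^ (n - 1) * (G x)\<^sup>2" for x
  have Qc: "continuous_on {-2..2} Q"
    unfolding Q_def[abs_def] by (intro continuous_intros U_cont continuous_on_subset[OF G_cont]) simp
  have Q2: "Q \<in> L2 ?S" by (rule continuous_on_Icc_L2[OF Qc])
  have V2: "V \<in> L2 ?S" "?v \<in> L2 ?S" using W012_L2[OF V_W012] by auto
  then have [measurable]: "V \<in> borel_measurable ?M" "?v \<in> borel_measurable ?M" by (auto simp: L2_def)
  have "AE x in ?M. x \<in> ?S" by (rule AE_I2) simp
  then have Vpos: "AE x in ?M. 0 < V x"
    using V
  proof eventually_elim
    case (elim x)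
    then have "0 < U x" using U_pos by simp
    then have "0 < W x" unfolding W_def by (intro divide_pos_pos zero_less_power) auto
    then show ?case using elim by simp
  qed
  have quot: "AE x in ?M. (?v x)\<^sup>2 / V x = real (n + 1) * Q x"
    using \<open>AE x in ?M. x \<in> ?S\<close> V weak_deriv_V
  proof eventually_elim
    case (elim x)
    have U0: "0 < U x" using U_pos elim by simp
    have Un: "U x ^ n = U x * U x ^ (n - 1)" using n_gt_3 by (metis gr_implies_not0 power_eq_if)
    have "(U x ^ n * G x)\<^sup>2 / W x = real (n + 1) * Q x"
      using U0 by (simp add: W_def Q_def power2_eq_square Un divide_simps)
    then show ?case using elim by simp
  qed
  have quot_int: "integrable ?M (\<lambda>x. (?v x)\<^sup>2 / V x)"
  proof (rule integrable_cong_AE_imp[of _ "\<lambda>x. real (n + 1) * Q x"])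
    show "integrable ?M (\<lambda>x. real (n + 1) * Q x)" by (intro integrable_mult_right L2_integrable Q2)
    show "AE x in ?M. real (n + 1) * Q x = (?v x)\<^sup>2 / V x" using quot by eventually_elim simp
  qed measurable
  have eq: "(LINT x|?M. ?v x * weak_deriv ?S \<phi> x) + real n / real (n + 1) * (LINT x|?M. (?v x)\<^sup>2 / V x * \<phi> x) =
      (LINT x|?M. indicator {-1<..<1} x * \<phi> x)" if \<phi>: "\<phi> \<in> W012 ?S" for \<phi>
  proof -
    note \<phi>2 = W012_L2[OF \<phi>]
    have [measurable]: "\<phi> \<in> borel_measurable ?M" "weak_deriv ?S \<phi> \<in> borel_measurable ?M"
        "Q \<in> borel_measurable ?M" "(\<lambda>x. U x ^ n * G x) \<in> borel_measurable ?M"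
      using \<phi>2 Q2 continuous_on_Icc_L2[OF flux_cont] by (auto simp: L2_def)
    have ind2: "indicator {-1<..<1} \<in> L2 ?S"
    proof (rule bounded_imp_L2[where C=1])
      have "{-1<..<1} \<subseteq> ?S" by auto
      then show "indicator {-1<..<1} \<in> borel_measurable ?M"
        by (intro borel_measurable_indicator) (simp add: sets_restrict_space_iff)
    qed (simp add: indicator_def)
    have "bounded (Q ` {-2..2})"
      by (intro compact_imp_bounded compact_continuous_image Qc) auto
    then obtain C where C: "\<forall>y\<in>Q ` {-2..2}. norm y \<le> C" unfolding bounded_iff by blast
    have b: "\<bar>real n * Q x - indicator {-1<..<1} x\<bar> \<le> real n * C + 1" if "x \<in> ?S" for x
    proof -
      have "norm (Q x) \<le> C" by (rule bspec[OF C]) (use that in auto)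
      then have "real n * \<bar>Q x\<bar> \<le> real n * C" by (intro mult_left_mono) auto
      moreover have "\<bar>real n * Q x\<bar> = real n * \<bar>Q x\<bar>" by (simp add: abs_mult)
      moreover have "\<bar>indicat_real {-1<..<1} x\<bar> \<le> 1" by (simp add: indicator_def)
      ultimately show ?thesis by linarith
    qed
    have "(LINT x|?M. ?v x * weak_deriv ?S \<phi> x) = (LINT x|?M. (U x ^ n * G x) * weak_deriv ?S \<phi> x)"
      by (rule integral_cong_AE) (use weak_deriv_V in auto)
    also have "\<dots> = - (LINT x|?M. (real n * Q x - indicator {-1<..<1} x) * \<phi> x)"
    proof (rule W012_integral_by_parts[OF _ \<phi> flux_cont, where Z="{-1, 1}" and C="real n * C + 1"])
      show "((\<lambda>t. U t ^ n * G t) has_real_derivative real n * Q x - indicator {-1<..<1} x) (at x)"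
        if "x \<in> ?S - {-1, 1}" for x
        using flux_deriv[OF that] by (simp add: Q_def mult.assoc)
      show "(\<lambda>x. real n * Q x - indicator {-1<..<1} x) \<in> borel_measurable ?M"
        using ind2 by (auto simp: L2_def)
    qed (use b in auto)
    also have "\<dots> = - (real n * (LINT x|?M. Q x * \<phi> x) - (LINT x|?M. indicator {-1<..<1} x * \<phi> x))"
      unfolding left_diff_distrib
      using L2_mult_integrable[OF Q2 \<phi>2(1)] L2_mult_integrable[OF ind2 \<phi>2(1)] by (simp add: mult.assoc)
    finally have 1: "(LINT x|?M. ?v x * weak_deriv ?S \<phi> x) =
        - (real n * (LINT x|?M. Q x * \<phi> x) - (LINT x|?M. indicator {-1<..<1} x * \<phi> x))" .
    have "(LINT x|?M. (?v x)\<^sup>2 / V x * \<phi> x) = (LINT x|?M. real (n + 1) * (Q x * \<phi> x))"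
    proof (rule integral_cong_AE)
      show "AE x in ?M. (?v x)\<^sup>2 / V x * \<phi> x = real (n + 1) * (Q x * \<phi> x)"
        using quot by eventually_elim (simp only: mult.assoc)
    qed measurable
    also have "\<dots> = real (n + 1) * (LINT x|?M. Q x * \<phi> x)" by simp
    finally show ?thesis unfolding 1 by (simp add: field_simps)
  qed
  show ?thesis
    unfolding quadratic_weak_solution_def using V_W012 Vpos quot_int eq by blast
qed

end

end

section \<open>The limit profile\<close>

text \<open>
  Clamping the argument to \<open>[-1, 1]\<close> extends the function by zero, because \<open>1 + cos\<close> vanishes at \<open>\<plusminus>pi\<close>.
  By the half-angle formula this is \<open>2 / pi^2 * cos^2 (pi * t / 2)\<close> on \<open>[-1, 1]\<close>; the form with the
  double angle is easier to differentiate.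
\<close>

definition limit_profile :: "real \<Rightarrow> real" where
  "limit_profile t = (1 + cos (pi * max (-1) (min 1 t))) / pi\<^sup>2"

definition limit_flux :: "real \<Rightarrow> real" where
  "limit_flux t = - sin (pi * max (-1) (min 1 t)) / pi"

lemma limit_profile_inner: "t \<in> {-1..1} \<Longrightarrow> limit_profile t = (1 + cos (pi * t)) / pi\<^sup>2"
  by (simp add: limit_profile_def)

lemma limit_flux_inner: "t \<in> {-1..1} \<Longrightarrow> limit_flux t = - sin (pi * t) / pi"
  by (simp add: limit_flux_def)

lemma limit_outer: "1 \<le> \<bar>t\<bar> \<Longrightarrow> limit_profile t = 0 \<and> limit_flux t = 0"
  by (cases "t \<le> -1") (auto simp: limit_profile_def limit_flux_def)

lemma limit_profile_cont: "continuous_on T limit_profile"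
  unfolding limit_profile_def[abs_def] by (intro continuous_intros) auto

lemma limit_flux_cont: "continuous_on T limit_flux"
  unfolding limit_flux_def[abs_def] by (intro continuous_intros) auto

lemma limit_profile_deriv_inner:
  assumes "t \<in> {-1<..<1}"
  shows "(limit_profile has_real_derivative - sin (pi * t) / pi) (at t)"
proof -
  have "((\<lambda>t. (1 + cos (pi * t)) / pi\<^sup>2) has_real_derivative - sin (pi * t) / pi) (at t)"
    by (auto intro!: derivative_eq_intros simp: power2_eq_square)
  then show ?thesis
    by (rule has_field_derivative_transform_within_open[of _ _ _ "{-1<..<1}"])
      (use assms limit_profile_inner in auto)
qed

lemma limit_profile_deriv:
  assumes t: "t \<notin> {-1, 1}"
  shows "(limit_profile has_real_derivative limit_flux t) (at t)"
proof (cases "t \<in> {-1<..<1}")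
  case True
  then show ?thesis using limit_profile_deriv_inner limit_flux_inner by simp
next
  case False
  then have t': "t \<in> - {-1..1}" using t by auto
  have out: "0 = limit_profile y" if "y \<in> - {-1..1}" for y
    using that limit_outer[of y] by auto
  have "(limit_profile has_real_derivative 0) (at t)"
    by (rule has_field_derivative_transform_within_open[OF DERIV_const _ t' out]) (simp_all add: open_Compl)
  then show ?thesis using limit_outer[of t] t' by auto
qed

lemma smooth_on_limit_profile: "smooth_on {-1<..<1} limit_profile"
proof (rule smooth_on_closed_family[where F="insert limit_profile (range (\<lambda>(A, B) t. A * cos (pi * t) + B * sin (pi * t)))"])
  fix h assume "h \<in> insert limit_profile (range (\<lambda>(A, B) t. A * cos (pi * t) + B * sin (pi * t)))"
  then consider "h = limit_profile" | A B where "h = (\<lambda>t. A * cos (pi * t) + B * sin (pi * t))" by auto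
  then show "\<exists>h'\<in>insert limit_profile (range (\<lambda>(A, B) t. A * cos (pi * t) + B * sin (pi * t))).
      \<forall>x\<in>{-1<..<1}. (h has_real_derivative h' x) (at x)"
  proof cases
    case 1
    have "\<forall>x\<in>{-1<..<1}. (h has_real_derivative 0 * cos (pi * x) + - (1 / pi) * sin (pi * x)) (at x)"
      using limit_profile_deriv_inner 1 by simp
    then show ?thesis
      by (intro bexI[of _ "\<lambda>x. 0 * cos (pi * x) + - (1 / pi) * sin (pi * x)"] insertI2
          range_eqI[of _ _ "(0, - (1 / pi))"]) auto
  next
    case 2
    have "\<forall>x\<in>{-1<..<1}. (h has_real_derivative (pi * B) * cos (pi * x) + - (pi * A) * sin (pi * x)) (at x)"
      unfolding 2 by (auto intro!: derivative_eq_intros)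
    then show ?thesis
      by (intro bexI[of _ "\<lambda>x. (pi * B) * cos (pi * x) + - (pi * A) * sin (pi * x)"] insertI2
          range_eqI[of _ _ "(pi * B, - (pi * A))"]) auto
  qed
qed auto

lemma limit_profile_half_angle: "t \<in> {-1..1} \<Longrightarrow> limit_profile t = 2 / pi\<^sup>2 * (cos (pi / 2 * t))\<^sup>2"
  using cos_double_cos[of "pi / 2 * t"] by (simp add: limit_profile_inner)

text \<open>
  The quotient \<open>v'^2 / v\<close> equals \<open>sin^2 / (1 + cos) = 1 - cos\<close> and \<open>v''\<close> equals \<open>- cos\<close>, all at \<open>pi * t\<close>.
\<close>

lemma limit_profile_classical: "quadratic_classical_solution limit_profile"
proof -
  let ?I = "{-1<..<1::real}"
  have d1: "deriv limit_profile t = - sin (pi * t) / pi" if "t \<in> ?I" for t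
    by (rule DERIV_imp_deriv[OF limit_profile_deriv_inner[OF that]])
  have d2: "deriv (deriv limit_profile) t = - cos (pi * t)" if t: "t \<in> ?I" for t
  proof (rule DERIV_imp_deriv)
    have "((\<lambda>t. - sin (pi * t) / pi) has_real_derivative - cos (pi * t)) (at t)"
      by (auto intro!: derivative_eq_intros)
    then show "(deriv limit_profile has_real_derivative - cos (pi * t)) (at t)"
      by (rule has_field_derivative_transform_within_open[of _ _ _ ?I]) (use t d1 in auto)
  qed
  have "(deriv ^^ k) limit_profile differentiable_on ?I" for k
    using smooth_on_limit_profile unfolding smooth_on_def differentiable_on_def
    by (auto intro: differentiable_at_withinI)
  from this[of 0] this[of 1] this[of 2]
  have D: "limit_profile differentiable_on ?I" "deriv limit_profile differentiable_on ?I"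
    "deriv (deriv limit_profile) differentiable_on ?I" by (simp_all add: numeral_2_eq_2)
  have "0 < limit_profile t \<and> - deriv (deriv limit_profile) t + (deriv limit_profile t)\<^sup>2 / limit_profile t = 1"
    if t: "t \<in> ?I" for t
  proof -
    have "0 < cos (pi / 2 * t)"
      by (rule cos_gt_zero_pi) (use t mult_strict_left_mono[of "-1" t "pi / 2"] mult_strict_left_mono[of t 1 "pi / 2"] in auto)
    then have p: "0 < limit_profile t"
      using limit_profile_half_angle[of t] t by simp
    then have c: "0 < 1 + cos (pi * t)"
      using limit_profile_inner[of t] t by (simp add: zero_less_divide_iff)
    have "(deriv limit_profile t)\<^sup>2 / limit_profile t = (sin (pi * t))\<^sup>2 / (1 + cos (pi * t))"
      using t by (simp add: d1 limit_profile_inner power_divide)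
    also have "(sin (pi * t))\<^sup>2 = (1 - cos (pi * t)) * (1 + cos (pi * t))"
      by (simp add: sin_squared_eq power2_eq_square algebra_simps)
    also have "\<dots> / (1 + cos (pi * t)) = 1 - cos (pi * t)" using c by simp
    finally show ?thesis using p d2[OF t] by simp
  qed
  then show ?thesis
    unfolding quadratic_classical_solution_def
    using D differentiable_imp_continuous_on[OF D(3)] limit_profile_cont limit_outer[of 1] limit_outer[of "-1"] by simp
qed

section \<open>Convergence as the exponent tends to infinity\<close>

locale profile_sequence =
  fixes N :: "nat \<Rightarrow> nat" and U G :: "nat \<Rightarrow> real \<Rightarrow> real"
  assumes profile: "singular_profile (N k) (U k) (G k)"
    and N_at_top: "filterlim N at_top sequentially"
begin

abbreviation S :: "nat \<Rightarrow> real \<Rightarrow> real" where "S k \<equiv> singular_profile.s (N k) (U k) (G k)"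
abbreviation \<Theta> :: "nat \<Rightarrow> real \<Rightarrow> real" where "\<Theta> k \<equiv> singular_profile.\<theta> (N k) (U k) (G k)"

lemma N_ge: "3 < N k"
  by (rule singular_profile.n_gt_3[OF profile])

lemma S_pos: "t \<in> {-1..1} \<Longrightarrow> 0 < S k t"
  using singular_profile.s_bounds[OF profile, of t k] less_le_trans[of 0 "2 / (3 * pi)" "S k t"] by simp

lemma inverse_S_bounds: "t \<in> {-1..1} \<Longrightarrow> 0 < 1 / S k t \<and> 1 / S k t \<le> 3 * pi / 2"
proof -
  assume t: "t \<in> {-1..1}"
  have "2 / (3 * pi) \<le> S k t" using singular_profile.s_bounds[OF profile t] by simp
  then show ?thesis using S_pos[OF t, of k] by (simp add: field_simps)
qed

lemma S_oscillation_tendsto_0: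
  assumes t: "t \<in> {-1<..<1}"
  shows "(\<lambda>k. S k t - S k 0) \<longlonglongrightarrow> 0"
proof -
  let ?T = "tan (pi / 2 - (1 - \<bar>t\<bar>) / profile_bound)"
  have "filterlim (\<lambda>k. - 1 + real (N k)) at_top sequentially"
    by (intro filterlim_tendsto_add_at_top[OF tendsto_const]
        filterlim_compose[OF filterlim_real_sequentially N_at_top])
  then have "(\<lambda>k. 2 / (- 1 + real (N k))) \<longlonglongrightarrow> 0"
    by (rule tendsto_divide_0[OF tendsto_const filterlim_at_top_imp_at_infinity])
  from tendsto_mult[OF this tendsto_const[of ?T]]
  have "(\<lambda>k. 2 / (real (N k) - 1) * ?T) \<longlonglongrightarrow> 0" by simp
  then show ?thesis
    by (rule Lim_null_comparison[rotated])
      (use singular_profile.s_variation[OF profile t] in \<open>simp add: always_eventually\<close>)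
qed

lemma inverse_S_oscillation_tendsto_0:
  assumes t: "t \<in> {-1<..<1}"
  shows "(\<lambda>k. 1 / S k t - 1 / S k 0) \<longlonglongrightarrow> 0"
proof -
  have lim: "(\<lambda>k. (3 * pi / 2)\<^sup>2 * \<bar>S k t - S k 0\<bar>) \<longlonglongrightarrow> 0"
    using tendsto_mult[OF tendsto_const tendsto_rabs[OF S_oscillation_tendsto_0[OF t]], of "(3 * pi / 2)\<^sup>2"] by simp
  have "norm (1 / S k t - 1 / S k 0) \<le> (3 * pi / 2)\<^sup>2 * \<bar>S k t - S k 0\<bar>" for k
  proof -
    have t': "t \<in> {-1..1}" and z: "0 \<in> {-1..1::real}" using t by auto
    have "1 / S k t - 1 / S k 0 = (1 / S k t) * (1 / S k 0) * (S k 0 - S k t)"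
      using S_pos[OF t', of k] S_pos[OF z, of k] by (simp add: field_simps)
    then have "norm (1 / S k t - 1 / S k 0) = ((1 / S k t) * (1 / S k 0)) * \<bar>S k t - S k 0\<bar>"
      using S_pos[OF t', of k] S_pos[OF z, of k] by (simp add: abs_mult abs_minus_commute)
    also have "\<dots> \<le> ((3 * pi / 2) * (3 * pi / 2)) * \<bar>S k t - S k 0\<bar>"
      by (intro mult_right_mono mult_mono)
        (use inverse_S_bounds[OF t', of k] inverse_S_bounds[OF z, of k] in auto)
    finally show ?thesis by (simp add: power2_eq_square)
  qed
  then show ?thesis by (intro Lim_null_comparison[OF _ lim]) (simp add: always_eventually)
qed

text \<open>
  The tangent of the boundary angle is \<open>(n - 1) / 2\<close> times the boundary value of \<open>s\<close>, which is bounded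
  below.
\<close>

lemma theta_1_tendsto: "(\<lambda>k. \<Theta> k 1) \<longlonglongrightarrow> pi / 2"
proof -
  have "filterlim (\<lambda>k. 1 / (3 * pi) * (- 1 + real (N k))) at_top sequentially"
    by (intro filterlim_tendsto_pos_mult_at_top[OF tendsto_const]
        filterlim_tendsto_add_at_top[OF tendsto_const]
        filterlim_compose[OF filterlim_real_sequentially N_at_top]) simp
  then have "filterlim (\<lambda>k. (real (N k) - 1) / 2 * singular_profile.\<sigma> (N k) (U k) (G k)) at_top sequentially"
  proof (rule filterlim_at_top_mono[OF _ always_eventually[rule_format]])
    fix k
    have "(real (N k) - 1) / 2 * (2 / (3 * pi)) \<le> (real (N k) - 1) / 2 * singular_profile.\<sigma> (N k) (U k) (G k)"
      using N_ge[of k] by (intro mult_left_mono singular_profile.sigma_lower[OF profile]) auto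
    moreover have "(real (N k) - 1) / 2 * (2 / (3 * pi)) = 1 / (3 * pi) * (- 1 + real (N k))"
      by (simp add: field_simps)
    ultimately show "1 / (3 * pi) * (- 1 + real (N k)) \<le> (real (N k) - 1) / 2 * singular_profile.\<sigma> (N k) (U k) (G k)"
      by (simp only:)
  qed
  from filterlim_compose[OF tendsto_arctan_at_top this] show ?thesis
    by (simp add: singular_profile.theta_1[OF profile])
qed

text \<open>
  Integrate \<open>\<theta>' = 1 / s\<close> from \<open>-1\<close>, where the angle is minus the boundary angle. The integrand differs from
  the constant \<open>1 / s 0\<close> by a bounded function that tends to zero pointwise.
\<close>

lemma theta_minus_linear_tendsto_0:
  assumes t: "t \<in> {-1..1}"
  shows "(\<lambda>k. \<Theta> k t + \<Theta> k 1 - (t + 1) * (1 / S k 0)) \<longlonglongrightarrow> 0"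
proof -
  have I: "((\<lambda>x. 1 / S k x - 1 / S k 0) has_integral \<Theta> k t + \<Theta> k 1 - (t + 1) * (1 / S k 0)) {-1<..<t}" for k
  proof -
    have "((\<lambda>x. 1 / S k x) has_integral \<Theta> k t - \<Theta> k (-1)) {-1..t}"
    proof (rule fundamental_theorem_of_calculus)
      fix x assume x: "x \<in> {-1..t}"
      have "(\<Theta> k has_real_derivative 1 / S k x) (at x within {-1..t})"
        by (rule has_field_derivative_subset[OF singular_profile.theta_deriv[OF profile]]) (use x t in auto)
      then show "(\<Theta> k has_vector_derivative 1 / S k x) (at x within {-1..t})"
        by (simp add: has_real_derivative_iff_has_vector_derivative)
    qed (use t in auto)
    moreover have "((\<lambda>x. 1 / S k 0) has_integral (t + 1) * (1 / S k 0)) {-1..t}"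
      using has_integral_const_real[of "1 / S k 0" "-1" t] t by simp
    ultimately have "((\<lambda>x. 1 / S k x - 1 / S k 0) has_integral (\<Theta> k t - \<Theta> k (-1)) - (t + 1) * (1 / S k 0)) {-1..t}"
      by (rule has_integral_diff)
    then show ?thesis
      by (simp add: has_integral_Icc_iff_Ioo singular_profile.theta_minus_1[OF profile])
  qed
  have "(\<lambda>k. integral {-1<..<t} (\<lambda>x. 1 / S k x - 1 / S k 0)) \<longlonglongrightarrow> integral {-1<..<t} (\<lambda>x. 0)"
  proof (rule dominated_convergence(2)[where h="\<lambda>x. 3 * pi"])
    show "(\<lambda>x. 1 / S k x - 1 / S k 0) integrable_on {-1<..<t}" for k
      using I by (rule has_integral_integrable)
    show "(\<lambda>x. 3 * pi) integrable_on {-1<..<t}"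
      unfolding integrable_on_Icc_iff_Ioo[symmetric] by (rule integrable_const_ivl)
    show "norm (1 / S k x - 1 / S k 0) \<le> 3 * pi" if "x \<in> {-1<..<t}" for k x
    proof -
      have "x \<in> {-1..1}" "0 \<in> {-1..1::real}" using that t by auto
      from this[THEN inverse_S_bounds, of k] show ?thesis unfolding real_norm_def by linarith
    qed
    show "(\<lambda>k. 1 / S k x - 1 / S k 0) \<longlonglongrightarrow> 0" if "x \<in> {-1<..<t}" for x
      by (rule inverse_S_oscillation_tendsto_0) (use that t in auto)
  qed
  then show ?thesis using integral_unique[OF I] by simp
qed

text \<open>
  At the right end point the angle has increased by twice the boundary angle, hence by \<open>pi\<close> in the limit,
  over a distance of 2. This identifies the limit of the speed \<open>1 / s\<close>, and with it the amplitude of the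
  limit profile.
\<close>

lemma inverse_S_0_tendsto: "(\<lambda>k. 1 / S k 0) \<longlonglongrightarrow> pi / 2"
proof -
  have "(\<lambda>k. \<Theta> k 1 + \<Theta> k 1 - (1 + 1) * (1 / S k 0)) \<longlonglongrightarrow> 0"
    by (rule theta_minus_linear_tendsto_0) simp
  then have "(\<lambda>k. \<Theta> k 1 - (\<Theta> k 1 + \<Theta> k 1 - (1 + 1) * (1 / S k 0)) / 2) \<longlonglongrightarrow> pi / 2 - 0 / 2"
    by (intro tendsto_intros theta_1_tendsto) auto
  then show ?thesis by (simp add: field_simps)
qed

lemma theta_tendsto:
  assumes t: "t \<in> {-1..1}"
  shows "(\<lambda>k. \<Theta> k t) \<longlonglongrightarrow> pi * t / 2"
proof -
  have lim: "(\<lambda>k. (\<Theta> k t + \<Theta> k 1 - (t + 1) * (1 / S k 0)) - \<Theta> k 1 + (t + 1) * (1 / S k 0)) \<longlonglongrightarrow>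
      0 - pi / 2 + (t + 1) * (pi / 2)"
    by (intro tendsto_intros theta_1_tendsto inverse_S_0_tendsto theta_minus_linear_tendsto_0 t)
  have eq: "0 - pi / 2 + (t + 1) * (pi / 2) = pi * t / 2" by (simp add: field_simps)
  show ?thesis using lim unfolding eq by simp
qed

lemma S_tendsto:
  assumes t: "t \<in> {-1<..<1}"
  shows "(\<lambda>k. S k t) \<longlonglongrightarrow> 2 / pi"
proof -
  have "(\<lambda>k. (S k t - S k 0) + 1 / (1 / S k 0)) \<longlonglongrightarrow> 0 + 1 / (pi / 2)"
    by (intro tendsto_intros S_oscillation_tendsto_0 t inverse_S_0_tendsto) simp
  then show ?thesis by simp
qed

text \<open>
  Inside \<open>(-1, 1)\<close> this is the polar form of the flux. Outside, the \<open>n\<close>-th power of a number below 1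
  tends to zero.
\<close>

lemma flux_tendsto:
  assumes t: "t \<in> {-2<..<2} - {-1, 1}"
  shows "(\<lambda>k. U k t ^ N k * G k t) \<longlonglongrightarrow> limit_flux t"
proof (cases "t \<in> {-1<..<1}")
  case True
  then have t': "t \<in> {-1..1}" by auto
  have "(\<lambda>k. - (S k t * sin (\<Theta> k t) * cos (\<Theta> k t))) \<longlonglongrightarrow> - (2 / pi * sin (pi * t / 2) * cos (pi * t / 2))"
    by (intro tendsto_intros S_tendsto True theta_tendsto t')
  moreover have "- (2 / pi * sin (pi * t / 2) * cos (pi * t / 2)) = limit_flux t"
    using sin_double[of "pi * t / 2"] by (simp add: limit_flux_inner[OF t'])
  ultimately show ?thesis by (simp add: singular_profile.flux_polar[OF profile t'])
next
  case False
  then have t': "1 < \<bar>t\<bar>" "\<bar>t\<bar> < 2" using t by auto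
  have "(\<lambda>k. (2 - \<bar>t\<bar>) ^ N k) \<longlonglongrightarrow> 0"
    by (rule filterlim_compose[OF LIMSEQ_power_zero N_at_top]) (use t' in auto)
  from tendsto_mult[OF tendsto_const this, of profile_bound]
  have lim: "(\<lambda>k. profile_bound * (2 - \<bar>t\<bar>) ^ N k) \<longlonglongrightarrow> 0" by simp
  have "(\<lambda>k. U k t ^ N k * G k t) \<longlonglongrightarrow> 0"
    by (rule Lim_null_comparison[OF _ lim])
      (use singular_profile.flux_outer_bound[OF profile, of t] t' in \<open>simp add: always_eventually\<close>)
  then show ?thesis using limit_outer[of t] t' by simp
qed

lemma flux_L2_tendsto:
  "(\<lambda>k. LINT x|lebesgue_on {-2<..<2}. (U k x ^ N k * G k x - limit_flux x)\<^sup>2) \<longlonglongrightarrow> 0"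
proof -
  let ?M = "lebesgue_on {-2<..<2::real}"
  interpret finite_measure ?M by (rule finite_measure_lebesgue_on_Ioo)
  have m: "(\<lambda>x. U k x ^ N k * G k x) \<in> borel_measurable ?M" "limit_flux \<in> borel_measurable ?M" for k
    using continuous_on_Icc_L2[OF singular_profile.flux_cont[OF profile]]
      continuous_on_Icc_L2[OF limit_flux_cont] by (auto simp: L2_def)
  have "(\<lambda>k. LINT x|?M. (U k x ^ N k * G k x - limit_flux x)\<^sup>2) \<longlonglongrightarrow> (LINT x|?M. 0)"
  proof (rule integral_dominated_convergence[where w="\<lambda>x. (profile_bound + 1)\<^sup>2"])
    \<comment> \<open>The two points where the right-hand side of the equation jumps form a null set.\<close>
    show "AE x in ?M. (\<lambda>k. (U k x ^ N k * G k x - limit_flux x)\<^sup>2) \<longlonglongrightarrow> 0"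
    proof -
      have "AE x in lebesgue. x \<notin> {-1, 1::real}"
        by (rule AE_not_in) (simp add: negligible_iff_null_sets[symmetric])
      then have "AE x in ?M. x \<notin> {-1, 1}"
        by (subst AE_restrict_space_iff) auto
      moreover have "AE x in ?M. x \<in> {-2<..<2}" by (rule AE_I2) simp
      ultimately show ?thesis
      proof eventually_elim
        case (elim x)
        then have "(\<lambda>k. (U k x ^ N k * G k x - limit_flux x)\<^sup>2) \<longlonglongrightarrow> (limit_flux x - limit_flux x)\<^sup>2"
          by (intro tendsto_intros flux_tendsto) auto
        then show ?case by simp
      qed
    qed
    show "AE x in ?M. norm ((U k x ^ N k * G k x - limit_flux x)\<^sup>2) \<le> (profile_bound + 1)\<^sup>2" for k
    proof (rule AE_I2)
      fix x assume x: "x \<in> space ?M"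
      have "\<bar>limit_flux x\<bar> \<le> 1 / pi" by (simp add: limit_flux_def divide_right_mono)
      also have "1 / pi \<le> 1" using pi_gt3 by simp
      finally have "\<bar>U k x ^ N k * G k x - limit_flux x\<bar> \<le> profile_bound + 1"
        using singular_profile.flux_bound[OF profile, of x k] x by auto
      from power_mono[OF this, of 2]
      show "norm ((U k x ^ N k * G k x - limit_flux x)\<^sup>2) \<le> (profile_bound + 1)\<^sup>2" by simp
    qed
  qed (use m in auto)
  then show ?thesis by simp
qed

lemma W12_norm_tendsto:
  assumes V: "\<And>k. AE x in lebesgue_on {-2<..<2}. singular_profile.W (N k) (U k) x = V k x"
  shows "(\<lambda>k. W12_norm {-2<..<2} (\<lambda>x. V k x - limit_profile x)) \<longlonglongrightarrow> 0"
    and "(\<lambda>x. V k x - limit_profile x) \<in> W012 {-2<..<2}"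
proof -
  let ?S = "{-2<..<2::real}" and ?W = "\<lambda>k. singular_profile.W (N k) (U k)"
  have Vd: "AE x in lebesgue_on ?S. ?W k x - limit_profile x = V k x - limit_profile x" for k
    using V[of k] by eventually_elim simp
  have c: "continuous_on {-2..2} (\<lambda>x. ?W k x - limit_profile x)" for k
    by (intro continuous_intros singular_profile.W_cont[OF profile] limit_profile_cont)
  have c': "continuous_on {-2..2} (\<lambda>x. U k x ^ N k * G k x - limit_flux x)" for k
    by (intro continuous_on_diff singular_profile.flux_cont[OF profile] limit_flux_cont)
  have b: "?W k (-2) - limit_profile (-2) = 0" "?W k 2 - limit_profile 2 = 0" for k
    using singular_profile.W_boundary[OF profile, of k] limit_outer[of "-2"] limit_outer[of 2] by auto
  have d: "((\<lambda>x. ?W k x - limit_profile x) has_real_derivative U k x ^ N k * G k x - limit_flux x) (at x)"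
    if "x \<in> ?S - {-1, 1}" for x k
    by (intro DERIV_diff singular_profile.W_deriv[OF profile] limit_profile_deriv) (use that in auto)
  have fin: "finite {-1, 1::real}" by simp
  show "(\<lambda>x. V k x - limit_profile x) \<in> W012 ?S"
    by (rule W012_if_continuous_deriv[OF _ c b c' fin d Vd]) simp
  have le: "W12_norm ?S (\<lambda>x. V k x - limit_profile x) \<le>
      sqrt (((2 - (-2))\<^sup>2 + 1) * (LINT x|lebesgue_on ?S. (U k x ^ N k * G k x - limit_flux x)\<^sup>2))" for k
    by (rule W12_norm_le_deriv[OF _ c fin d continuous_on_Icc_L2[OF c'] b(1) Vd]) simp
  have "(\<lambda>k. sqrt (((2 - (-2))\<^sup>2 + 1) * (LINT x|lebesgue_on ?S. (U k x ^ N k * G k x - limit_flux x)\<^sup>2)))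
      \<longlonglongrightarrow> sqrt (((2 - (-2))\<^sup>2 + 1) * 0)"
    by (intro tendsto_intros flux_L2_tendsto)
  then have lim: "(\<lambda>k. sqrt (((2 - (-2))\<^sup>2 + 1) * (LINT x|lebesgue_on ?S. (U k x ^ N k * G k x - limit_flux x)\<^sup>2)))
      \<longlonglongrightarrow> 0" by simp
  show "(\<lambda>k. W12_norm ?S (\<lambda>x. V k x - limit_profile x)) \<longlonglongrightarrow> 0"
    by (rule Lim_null_comparison[OF _ lim])
      (use le W12_norm_nonneg[of ?S] in \<open>simp add: always_eventually\<close>)
qed

end

lemma limit_profile_W012: "limit_profile \<in> W012 {-2<..<2}"
  by (rule W012_if_continuous_deriv[of "-2" 2 limit_profile limit_flux "{-1, 1}"])
    (use limit_profile_cont limit_flux_cont limit_profile_deriv limit_outer[of 2] limit_outer[of "-2"] in auto)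

lemma norm_convergence_imp_weak:
  assumes V: "\<And>k. V k \<in> W012 S" and v: "v \<in> W012 S"
    and diff: "\<And>k. (\<lambda>x. V k x - v x) \<in> W012 S"
    and lim: "(\<lambda>k. W12_norm S (\<lambda>x. V k x - v x)) \<longlonglongrightarrow> 0"
  shows "weakly_converges_W012 S V v"
  unfolding weakly_converges_W012_def
proof (intro conjI allI ballI V v)
  fix F assume F: "F \<in> W012_dual S"
  then obtain C where add: "\<And>u w. u \<in> W012 S \<Longrightarrow> w \<in> W012 S \<Longrightarrow> F (\<lambda>x. u x + w x) = F u + F w"
    and C: "\<And>u. u \<in> W012 S \<Longrightarrow> \<bar>F u\<bar> \<le> C * W12_norm S u"
    unfolding W012_dual_def by blast
  have lim': "(\<lambda>k. C * W12_norm S (\<lambda>x. V k x - v x)) \<longlonglongrightarrow> 0"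
    using tendsto_mult[OF tendsto_const lim, of C] by simp
  have "F (V k) - F v = F (\<lambda>x. V k x - v x)" for k
    using add[OF diff v, of k] by simp
  then have "norm (F (V k) - F v) \<le> C * W12_norm S (\<lambda>x. V k x - v x)" for k
    using C[OF diff, of k] by simp
  then have "(\<lambda>k. F (V k) - F v) \<longlonglongrightarrow> 0"
    by (intro Lim_null_comparison[OF _ lim']) (simp add: always_eventually)
  then show "(\<lambda>k. F (V k)) \<longlonglongrightarrow> F v" using LIM_zero_iff by blast
qed

theorem theorem2p7:
  fixes u V :: "nat \<Rightarrow> real \<Rightarrow> real"
  assumes u: "\<And>n. n > 3 \<Longrightarrow> singular_weak_solution n (u n)"
    and V: "\<And>n t. n > 3 \<Longrightarrow> V n t = u n t ^ (n + 1) / real (n + 1)"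
  shows "(\<forall>n>3. quadratic_weak_solution (real n / real (n + 1)) (indicator {-1<..<1}) (V n)) \<and>
    (\<exists>v. weakly_converges_W012 {-2<..<2} (\<lambda>k. V (k + 4)) v \<and>
         v \<in> C0_infinity (-1) 1 \<and>
         quadratic_classical_solution v \<and>
         (\<forall>t\<in>{-1<..<1}. v t = 2 / pi\<^sup>2 * (cos (pi / 2 * t))\<^sup>2) \<and>
         (\<forall>t\<in>{-2..-1} \<union> {1..2}. v t = 0))"
proof -
  let ?M = "lebesgue_on {-2<..<2::real}"
  have "\<exists>U G. singular_profile n U G \<and> (AE x in ?M. U x = u n x)" if n: "3 < n" for n
  proof -
    obtain U G where UG:
      "AE x in ?M. U x = u n x" "continuous_on {-2..2} U" "U (-2) = 0" "U 2 = 0"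
      "\<And>t. t \<in> {-2<..<2} \<Longrightarrow> 0 < U t"
      "\<And>t. t \<in> {-2..2} \<Longrightarrow> (U has_real_derivative G t) (at t within {-2..2})"
      "\<And>t. t \<in> {-1..1} \<Longrightarrow> (G has_real_derivative - (1 / U t ^ n)) (at t within {-1..1})"
      "\<And>t. t \<le> -1 \<Longrightarrow> G t = G (-1)" "\<And>t. 1 \<le> t \<Longrightarrow> G t = G 1"
      "continuous_on UNIV G"
      using singular_weak_solution_regularity[OF u[OF n]] by blast
    have "singular_profile n U G" by unfold_locales (fact n UG)+
    with UG(1) show ?thesis by blast
  qed
  then obtain U G where profile: "\<And>n. 3 < n \<Longrightarrow> singular_profile n (U n) (G n)"
    and Uu: "\<And>n. 3 < n \<Longrightarrow> AE x in ?M. U n x = u n x" by metis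
  have VW: "AE x in ?M. singular_profile.W n (U n) x = V n x" if n: "3 < n" for n
    using Uu[OF n] by eventually_elim (simp add: singular_profile.W_def[OF profile[OF n]] V[OF n])
  have quadratic: "\<forall>n>3. quadratic_weak_solution (real n / real (n + 1)) (indicator {-1<..<1}) (V n)"
    using singular_profile.quadratic_V[OF profile VW] by blast
  have VW012: "V (k + 4) \<in> W012 {-2<..<2}" for k
    by (rule singular_profile.V_W012[OF profile VW]) simp_all
  interpret profile_sequence "\<lambda>k. k + 4" "\<lambda>k. U (k + 4)" "\<lambda>k. G (k + 4)"
    by (rule profile_sequence.intro) (auto intro: profile filterlim_add_const_nat_at_top)
  have VW': "AE x in ?M. singular_profile.W (k + 4) (U (k + 4)) x = V (k + 4) x" for k
    by (rule VW) simp
  have "weakly_converges_W012 {-2<..<2} (\<lambda>k. V (k + 4)) limit_profile"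
    by (intro norm_convergence_imp_weak limit_profile_W012 W12_norm_tendsto
        VW012 VW')
  moreover have "limit_profile \<in> C0_infinity (-1) 1"
    unfolding C0_infinity_def
    using smooth_on_limit_profile limit_profile_cont limit_outer[of 1] limit_outer[of "-1"] by simp
  moreover have "\<forall>t\<in>{-1<..<1}. limit_profile t = 2 / pi\<^sup>2 * (cos (pi / 2 * t))\<^sup>2"
    using limit_profile_half_angle by simp
  moreover have "\<forall>t\<in>{-2..-1} \<union> {1..2}. limit_profile t = 0"
    using limit_outer by auto
  ultimately show ?thesis
    using limit_profile_classical quadratic by blast
qed

end
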